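(* Let $V$ be a superspace over $\mathbb{C}$ with $\dim V=(n,n)$ and let $p,q\ge0$. The inner products $(v_s,v_t)$, $s,t\in S$, form a system of generators of the algebra of $\mathfrak{pe}(V)$-invariants in $\mathfrak{A}^{p,q}$.
   Context: All superspaces are over $\mathbb{C}$; $\dim V=(n,n)$ means $\dim V_{\bar 0}=\dim V_{\bar 1}=n$; $\Pi$ is the parity shift. Let $W$ be a superspace with $\dim W=(p,q)$ and $$\mathfrak{A}^{p,q}=S^{\bullet}(V^{*p}\oplus\Pi(V)^{*q})=S^{\bullet}(V^*\otimes W)$$ (symmetric algebra in the super sense), on which $\mathfrak{gl}(V)$ acts by superderivations. Invariant means annihilated by the Lie superalgebra. (The existence of an odd $\mathfrak{pe}(V)$-invariant form identifies $S^{\bullet}(V^{k}\oplus\Pi(V)^{l}\oplus V^{*p}\oplus\Pi(V)^{*q})$ with $\mathfrak{A}^{p+l,q+k}$, so only $\mathfrak A^{p,q}$ need be considered.) Index sets: $S=\{1,\dots,p,\bar1,\dots,\bar q\}$, $I=\{1,\dots,n,\bar1,\dots,\bar n\}$, $I_{\bar0}=\{1,\dots,n\}$; barred indices are odd, unbarred even; $p(s)\in\{0,1\}$ is the parity of $s$. $\{e_i\}_{i\in I}$ and $\{w_s\}_{s\in S}$ are homogeneous bases of $V$ and $W$ with parities of their indices, $\{e^*_i\}$ is the dual basis of $V^*$, $e_i^*(e_j)=\delta_{ij}$, and $x^*_{is}=e^*_i\otimes w_s$. $\mathfrak{pe}(V)\subset\mathfrak{gl}(V)$ is the Lie superalgebra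 preserving the tensor $\sum_{i\in I_{\bar0}}(e^*_i\otimes e^*_{\bar i}+e^*_{\bar i}\otimes e^*_i)$. The inner products are $$(v_s,v_t)=\sum_{i\in I_{\bar0}}\bigl((-1)^{p(s)}x^*_{is}x^*_{\bar i t}+x^*_{\bar i s}x^*_{it}\bigr).$$ *)

theory Defs
  imports Complex_Main "HOL-Library.Poly_Mapping"
begin

section \<open>Complex vector spaces and superspaces\<close>

class cvector = ab_group_add +
  fixes cscale :: "complex \<Rightarrow> 'a \<Rightarrow> 'a"  (infixr \<open>*\<^sub>C\<close> 75)
  assumes cscale_add_right: "c *\<^sub>C (x + y) = c *\<^sub>C x + c *\<^sub>C y"
    and cscale_add_left: "(c + d) *\<^sub>C x = c *\<^sub>C x + d *\<^sub>C x"
    and cscale_cscale [simp]: "c *\<^sub>C d *\<^sub>C x = (c * d) *\<^sub>C x"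
    and cscale_one [simp]: "1 *\<^sub>C x = x"

global_interpretation cvec: vector_space "cscale :: complex \<Rightarrow> 'a \<Rightarrow> 'a::cvector"
  by unfold_locales (simp_all add: cscale_add_right cscale_add_left)

abbreviation clinear :: "('a::cvector \<Rightarrow> 'b::cvector) \<Rightarrow> bool"
  where "clinear \<equiv> Vector_Spaces.linear cscale cscale"

lemma clinearI:
  assumes "\<And>x y. f (x + y) = f x + f y" "\<And>c x. f (c *\<^sub>C x) = c *\<^sub>C f x"
  shows "clinear f"
  using assms
  by (simp add: Vector_Spaces.linear_iff cvec.vector_space_axioms)

lemma clinear_add: "clinear f \<Longrightarrow> f (x + y) = f x + f y"
  and clinear_scale: "clinear f \<Longrightarrow> f (c *\<^sub>C x) = c *\<^sub>C f x"
  by (auto simp add: Vector_Spaces.linear_iff)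

lemma clinear_0: "clinear f \<Longrightarrow> f 0 = 0"
  using clinear_scale[of f 0 0] by simp

lemma clinear_diff: "clinear f \<Longrightarrow> f (x - y) = f x - f y"
  using clinear_add[of f "x - y" y] by (simp add: algebra_simps)

instantiation complex :: cvector
begin
definition cscale_complex :: "complex \<Rightarrow> complex \<Rightarrow> complex"
  where [simp]: "cscale_complex c x = c * x"
instance by standard (simp_all add: algebra_simps)
end

text \<open>
  A superspace is given by its projection onto the even component along the odd one; so
  \<open>V\<^sub>0\<close> is the range and \<open>V\<^sub>1\<close> the kernel of \<open>even_part\<close>.
\<close>
class superspace = cvector +
  fixes even_part :: "'a \<Rightarrow> 'a"
  assumes even_part_add: "even_part (x + y) = even_part x + even_part y"
    and even_part_scale: "even_part (c *\<^sub>C x) = c *\<^sub>C even_part x"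
    and even_part_idem [simp]: "even_part (even_part x) = even_part x"

definition odd_part :: "'a::superspace \<Rightarrow> 'a"
  where "odd_part x = x - even_part x"

definition has_parity :: "nat \<Rightarrow> 'a::superspace \<Rightarrow> bool"
  where "has_parity k x \<longleftrightarrow> (if even k then even_part x = x else even_part x = 0)"

text \<open>The linear map \<open>x \<mapsto> (-1)\<^bsup>p(x)\<^esup> x\<close> (for homogeneous \<open>x\<close>).\<close>
definition grade_inv :: "'a::superspace \<Rightarrow> 'a"
  where "grade_inv x = even_part x - odd_part x"

lemma clinear_even_part: "clinear even_part"
  by (intro clinearI even_part_add even_part_scale)

lemma even_part_0 [simp]: "even_part 0 = 0"
  by (rule clinear_0[OF clinear_even_part])

lemma even_part_diff: "even_part (x - y) = even_part x - even_part y"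
  by (rule clinear_diff[OF clinear_even_part])

lemma even_part_odd_part [simp]: "even_part (odd_part x) = 0"
  and odd_part_even_part [simp]: "odd_part (even_part x) = 0"
  and odd_part_odd_part [simp]: "odd_part (odd_part x) = odd_part x"
  and odd_part_0 [simp]: "odd_part 0 = 0"
  by (simp_all add: odd_part_def even_part_diff)

lemma even_plus_odd [simp]: "even_part x + odd_part x = x"
  by (simp add: odd_part_def)

lemma odd_part_add: "odd_part (x + y) = odd_part x + odd_part y"
  and odd_part_scale: "odd_part (c *\<^sub>C x) = c *\<^sub>C odd_part x"
  by (simp_all add: odd_part_def even_part_add even_part_scale cvec.scale_right_diff_distrib)

lemma grade_inv_add: "grade_inv (x + y) = grade_inv x + grade_inv y"
  and grade_inv_scale: "grade_inv (c *\<^sub>C x) = c *\<^sub>C grade_inv x"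
  by (simp_all add: grade_inv_def even_part_add even_part_scale odd_part_add odd_part_scale
      cvec.scale_right_diff_distrib)

lemma grade_inv_parity: "has_parity k x \<Longrightarrow> grade_inv x = (-1) ^ k *\<^sub>C x"
  by (auto simp: has_parity_def grade_inv_def odd_part_def split: if_splits)


section \<open>The general linear Lie superalgebra\<close>

typedef (overloaded) 'v gl = "{f :: 'v::superspace \<Rightarrow> 'v. clinear f}"
  morphisms gl_apply Abs_gl
  by (rule exI[of _ "\<lambda>_. 0"]) (simp add: clinearI)

setup_lifting type_definition_gl

lemma clinear_gl_apply: "clinear (gl_apply D)"
  using gl_apply[of D] by simp

lemmas gl_apply_add = clinear_add[OF clinear_gl_apply]
  and gl_apply_scale = clinear_scale[OF clinear_gl_apply]
  and gl_apply_0 [simp] = clinear_0[OF clinear_gl_apply]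

instantiation gl :: (superspace) superspace
begin
lift_definition zero_gl :: "'a gl" is "\<lambda>_. 0" by (rule clinearI) simp_all
lift_definition plus_gl :: "'a gl \<Rightarrow> 'a gl \<Rightarrow> 'a gl" is "\<lambda>f g x. f x + g x"
  by (rule clinearI) (simp_all add: clinear_add clinear_scale cscale_add_right)
lift_definition minus_gl :: "'a gl \<Rightarrow> 'a gl \<Rightarrow> 'a gl" is "\<lambda>f g x. f x - g x"
  by (rule clinearI) (simp_all add: clinear_add clinear_scale cvec.scale_right_diff_distrib)
lift_definition uminus_gl :: "'a gl \<Rightarrow> 'a gl" is "\<lambda>f x. - f x"
  by (rule clinearI) (simp_all add: clinear_add clinear_scale)
lift_definition cscale_gl :: "complex \<Rightarrow> 'a gl \<Rightarrow> 'a gl" is "\<lambda>c f x. c *\<^sub>C f x"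
  by (rule clinearI) (simp_all add: clinear_add clinear_scale cscale_add_right mult.commute)
lift_definition even_part_gl :: "'a gl \<Rightarrow> 'a gl"
  is "\<lambda>f x. even_part (f (even_part x)) + odd_part (f (odd_part x))"
  by (rule clinearI) (simp_all add: clinear_add clinear_scale cscale_add_right
      even_part_add even_part_scale odd_part_add odd_part_scale)
instance
  by standard (transfer; auto simp: fun_eq_iff cscale_add_right cscale_add_left even_part_add
      even_part_scale odd_part_add odd_part_scale)+
end


section \<open>The dual superspace\<close>

typedef (overloaded) 'v sdual = "{f :: 'v::superspace \<Rightarrow> complex. clinear f}"
  morphisms dual_apply Abs_sdual
  by (rule exI[of _ "\<lambda>_. 0"]) (simp add: clinearI)

setup_lifting type_definition_sdual

lemma clinear_dual_apply: "clinear (dual_apply f)"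
  using dual_apply[of f] by simp

instantiation sdual :: (superspace) superspace
begin
lift_definition zero_sdual :: "'a sdual" is "\<lambda>_. 0" by (rule clinearI) simp_all
lift_definition plus_sdual :: "'a sdual \<Rightarrow> 'a sdual \<Rightarrow> 'a sdual" is "\<lambda>f g x. f x + g x"
  by (rule clinearI) (simp_all add: clinear_add clinear_scale algebra_simps)
lift_definition minus_sdual :: "'a sdual \<Rightarrow> 'a sdual \<Rightarrow> 'a sdual" is "\<lambda>f g x. f x - g x"
  by (rule clinearI) (simp_all add: clinear_add clinear_scale algebra_simps)
lift_definition uminus_sdual :: "'a sdual \<Rightarrow> 'a sdual" is "\<lambda>f x. - f x"
  by (rule clinearI) (simp_all add: clinear_add clinear_scale)
lift_definition cscale_sdual :: "complex \<Rightarrow> 'a sdual \<Rightarrow> 'a sdual" is "\<lambda>c f x. c * f x"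
  by (rule clinearI) (simp_all add: clinear_add clinear_scale algebra_simps)
lift_definition even_part_sdual :: "'a sdual \<Rightarrow> 'a sdual" is "\<lambda>f x. f (even_part x)"
  by (rule clinearI) (simp_all add: clinear_add clinear_scale even_part_add even_part_scale)
instance
  by standard (transfer; auto simp: fun_eq_iff algebra_simps)+
end

definition dual_comp :: "'v::superspace sdual \<Rightarrow> 'v gl \<Rightarrow> 'v sdual"
  where "dual_comp f D = Abs_sdual (\<lambda>v. dual_apply f (gl_apply D v))"

lemma dual_apply_comp [simp]: "dual_apply (dual_comp f D) v = dual_apply f (gl_apply D v)"
  unfolding dual_comp_def
  by (subst Abs_sdual_inverse)
    (auto intro!: clinearI simp: gl_apply_add gl_apply_scale
      clinear_add[OF clinear_dual_apply] clinear_scale[OF clinear_dual_apply]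
      simp del: cscale_complex_def)

text \<open>
  The action of \<open>gl(V)\<close> on the dual space: \<open>(D f)(v) = -(-1)\<^bsup>p(D)p(f)\<^esup> f(D v)\<close> for
  homogeneous \<open>D\<close> and \<open>f\<close>.
\<close>
definition dual_act :: "'v::superspace gl \<Rightarrow> 'v sdual gl"
  where "dual_act D =
    Abs_gl (\<lambda>f. - dual_comp f (even_part D) - dual_comp (grade_inv f) (odd_part D))"

lemma dual_eqI: "(\<And>v. dual_apply f v = dual_apply g v) \<Longrightarrow> f = g"
  by (metis dual_apply_inverse ext)

lemma dual_apply_simps [simp]:
  "dual_apply (f + g) v = dual_apply f v + dual_apply g v"
  "dual_apply (f - g) v = dual_apply f v - dual_apply g v"
  "dual_apply (- f) v = - dual_apply f v"
  "dual_apply (c *\<^sub>C f) v = c * dual_apply f v"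
  "dual_apply 0 v = 0"
  by (transfer; simp)+

lemma gl_apply_dual_act:
  "gl_apply (dual_act D) f = - dual_comp f (even_part D) - dual_comp (grade_inv f) (odd_part D)"
  unfolding dual_act_def
  by (subst Abs_gl_inverse)
    (auto intro!: clinearI dual_eqI simp: grade_inv_add grade_inv_scale algebra_simps)


section \<open>Free vector spaces\<close>

instantiation poly_mapping :: (type, cvector) cvector
begin
definition cscale_poly_mapping :: "complex \<Rightarrow> ('a \<Rightarrow>\<^sub>0 'b) \<Rightarrow> ('a \<Rightarrow>\<^sub>0 'b)"
  where "cscale_poly_mapping c = Poly_Mapping.map (cscale c)"

lemma lookup_cscale: "Poly_Mapping.lookup (c *\<^sub>C a) k = c *\<^sub>C Poly_Mapping.lookup (a :: 'a \<Rightarrow>\<^sub>0 'b) k"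
  by (simp add: cscale_poly_mapping_def map.rep_eq when_def)

instance
  by standard (simp_all add: poly_mapping_eq_iff fun_eq_iff lookup_cscale lookup_add
      cscale_add_right cscale_add_left del: cscale_complex_def)
end

text \<open>The linear extension of a function on the standard basis.\<close>
definition lin_ext :: "('x \<Rightarrow> 'a::cvector) \<Rightarrow> ('x \<Rightarrow>\<^sub>0 complex) \<Rightarrow> 'a"
  where "lin_ext F a = (\<Sum>k\<in>Poly_Mapping.keys a. Poly_Mapping.lookup a k *\<^sub>C F k)"

lemma lin_ext_superset:
  "finite K \<Longrightarrow> Poly_Mapping.keys a \<subseteq> K \<Longrightarrow> lin_ext F a = (\<Sum>k\<in>K. Poly_Mapping.lookup a k *\<^sub>C F k)"
  unfolding lin_ext_def by (intro sum.mono_neutral_left) (auto simp: in_keys_iff)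

lemma clinear_lin_ext: "clinear (lin_ext F)"
proof (rule clinearI)
  fix a b :: "'a \<Rightarrow>\<^sub>0 complex"
  let ?K = "Poly_Mapping.keys a \<union> Poly_Mapping.keys b"
  have "Poly_Mapping.keys (a + b) \<subseteq> ?K" by (rule Poly_Mapping.keys_add)
  then show "lin_ext F (a + b) = lin_ext F a + lin_ext F b"
    by (simp add: lin_ext_superset[of ?K] lookup_add cscale_add_left sum.distrib)
next
  fix c and a :: "'a \<Rightarrow>\<^sub>0 complex"
  have "Poly_Mapping.keys (c *\<^sub>C a) \<subseteq> Poly_Mapping.keys a" by (auto simp: in_keys_iff lookup_cscale)
  then show "lin_ext F (c *\<^sub>C a) = c *\<^sub>C lin_ext F a"
    by (simp add: lin_ext_superset[of "Poly_Mapping.keys a"] lookup_cscale cvec.scale_sum_right)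
qed

lemmas lin_ext_add = clinear_add[OF clinear_lin_ext]
  and lin_ext_scale = clinear_scale[OF clinear_lin_ext]
  and lin_ext_diff = clinear_diff[OF clinear_lin_ext]
  and lin_ext_0 [simp] = clinear_0[OF clinear_lin_ext]

lemma lin_ext_single [simp]: "lin_ext F (Poly_Mapping.single k c) = c *\<^sub>C F k"
  by (simp add: lin_ext_superset[of "{k}"])

lemma cscale_single [simp]: "c *\<^sub>C Poly_Mapping.single k d = Poly_Mapping.single k (c * d :: complex)"
  by (simp add: poly_mapping_eq_iff fun_eq_iff lookup_cscale lookup_single when_def)

lemma free_decomp: "(\<Sum>k\<in>Poly_Mapping.keys a. Poly_Mapping.lookup a k *\<^sub>C Poly_Mapping.single k 1) = (a :: 'x \<Rightarrow>\<^sub>0 complex)"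
  by (simp add: poly_mapping_eq_iff fun_eq_iff lookup_sum lookup_single when_def in_keys_iff)

lemma lin_ext_unique:
  assumes "clinear G" shows "G a = lin_ext (\<lambda>k. G (Poly_Mapping.single k 1)) a"
proof -
  have "G (\<Sum>k\<in>K. Poly_Mapping.lookup a k *\<^sub>C Poly_Mapping.single k 1) = (\<Sum>k\<in>K. Poly_Mapping.lookup a k *\<^sub>C G (Poly_Mapping.single k 1))"
    if "finite K" for K
    using that by (induction) (simp_all add: clinear_0[OF assms] clinear_add[OF assms]
        clinear_scale[OF assms] del: cscale_single)
  from this[OF finite_keys, of a] show ?thesis unfolding lin_ext_def free_decomp .
qed

lemma free_clinear_eqI:
  assumes "clinear G" "clinear H" "\<And>k. G (Poly_Mapping.single k 1) = H (Poly_Mapping.single k 1)"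
  shows "G (a :: 'x \<Rightarrow>\<^sub>0 complex) = H a"
  using lin_ext_unique[OF assms(1), of a] lin_ext_unique[OF assms(2), of a]
  by (simp add: assms(3))

lemma free_span_cong:
  assumes "clinear G" "\<And>r. r \<in> R \<Longrightarrow> G r = 0" "a - b \<in> cvec.span R"
  shows "G a = G b"
proof -
  have "G x = 0" if "x \<in> cvec.span R" for x
    using that
    by (induction rule: cvec.span_induct_alt)
      (simp_all add: clinear_0[OF assms(1)] clinear_add[OF assms(1)] clinear_scale[OF assms(1)]
        assms(2))
  from this[OF assms(3)] show ?thesis by (simp add: clinear_diff[OF assms(1)])
qed


section \<open>Tensor products\<close>

definition bilin_relators :: "(('a::superspace \<times> 'b::superspace) \<Rightarrow>\<^sub>0 complex) set"
  where "bilin_relators =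
      {Poly_Mapping.single (x + y, z) 1 - Poly_Mapping.single (x, z) 1 - Poly_Mapping.single (y, z) 1 | x y z. True}
    \<union> {Poly_Mapping.single (x, y + z) 1 - Poly_Mapping.single (x, y) 1 - Poly_Mapping.single (x, z) 1 | x y z. True}
    \<union> {Poly_Mapping.single (c *\<^sub>C x, y) 1 - c *\<^sub>C Poly_Mapping.single (x, y) 1 | c x y. True}
    \<union> {Poly_Mapping.single (x, c *\<^sub>C y) 1 - c *\<^sub>C Poly_Mapping.single (x, y) 1 | c x y. True}"

definition tensor_rel ::
  "(('a::superspace \<times> 'b::superspace) \<Rightarrow>\<^sub>0 complex) \<Rightarrow> (('a \<times> 'b) \<Rightarrow>\<^sub>0 complex) \<Rightarrow> bool"
  where "tensor_rel a b \<longleftrightarrow> a - b \<in> cvec.span bilin_relators"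

lemma equivp_span_diff: "equivp (\<lambda>a b. a - b \<in> cvec.span R)"
proof (rule equivpI)
  show "reflp (\<lambda>a b. a - b \<in> cvec.span R)" by (simp add: reflp_def cvec.span_zero)
  show "symp (\<lambda>a b. a - b \<in> cvec.span R)"
    by (rule sympI) (metis cvec.span_neg minus_diff_eq)
  show "transp (\<lambda>a b. a - b \<in> cvec.span R)"
  proof (rule transpI)
    fix a b c assume "a - b \<in> cvec.span R" "b - c \<in> cvec.span R"
    from cvec.span_add[OF this] show "a - c \<in> cvec.span R" by simp
  qed
qed

quotient_type (overloaded) ('a, 'b) stensor =
  "(('a::superspace \<times> 'b::superspace) \<Rightarrow>\<^sub>0 complex)" / tensor_rel
  unfolding tensor_rel_def[abs_def] by (rule equivp_span_diff)

lift_definition tensor :: "'a::superspace \<Rightarrow> 'b::superspace \<Rightarrow> ('a, 'b) stensor"  (infixl \<open>\<otimes>\<^sub>s\<close> 70)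
  is "\<lambda>x y. Poly_Mapping.single (x, y) 1" .

instantiation stensor :: (superspace, superspace) cvector
begin
lift_definition zero_stensor :: "('a, 'b) stensor" is 0 .
lift_definition plus_stensor :: "('a, 'b) stensor \<Rightarrow> ('a, 'b) stensor \<Rightarrow> ('a, 'b) stensor" is "(+)"
proof -
  fix a b c d :: "('a \<times> 'b) \<Rightarrow>\<^sub>0 complex"
  assume "tensor_rel a b" "tensor_rel c d"
  from cvec.span_add[OF this[unfolded tensor_rel_def]] show "tensor_rel (a + c) (b + d)"
    by (simp add: tensor_rel_def algebra_simps)
qed
lift_definition minus_stensor :: "('a, 'b) stensor \<Rightarrow> ('a, 'b) stensor \<Rightarrow> ('a, 'b) stensor" is "(-)"
proof -
  fix a b c d :: "('a \<times> 'b) \<Rightarrow>\<^sub>0 complex"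
  assume "tensor_rel a b" "tensor_rel c d"
  from cvec.span_diff[OF this[unfolded tensor_rel_def]] show "tensor_rel (a - c) (b - d)"
    by (simp add: tensor_rel_def algebra_simps)
qed
lift_definition uminus_stensor :: "('a, 'b) stensor \<Rightarrow> ('a, 'b) stensor" is uminus
proof -
  fix a b :: "('a \<times> 'b) \<Rightarrow>\<^sub>0 complex"
  assume "tensor_rel a b"
  from cvec.span_neg[OF this[unfolded tensor_rel_def]] show "tensor_rel (- a) (- b)"
    by (simp add: tensor_rel_def algebra_simps)
qed
lift_definition cscale_stensor :: "complex \<Rightarrow> ('a, 'b) stensor \<Rightarrow> ('a, 'b) stensor" is cscale
proof -
  fix c and a b :: "('a \<times> 'b) \<Rightarrow>\<^sub>0 complex"
  assume "tensor_rel a b"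
  from cvec.span_scale[OF this[unfolded tensor_rel_def], of c] show "tensor_rel (c *\<^sub>C a) (c *\<^sub>C b)"
    by (simp add: tensor_rel_def cvec.scale_right_diff_distrib)
qed
instance
  by standard (transfer; simp add: equivp_reflp[OF stensor_equivp] algebra_simps
      cscale_add_right cscale_add_left)+
end

lemma tensor_eqI:
  "Poly_Mapping.single (x, y) 1 - b \<in> cvec.span bilin_relators \<Longrightarrow> x \<otimes>\<^sub>s y = abs_stensor b"
  by (simp add: tensor.abs_eq stensor.abs_eq_iff tensor_rel_def)

lemma tensor_add_left: "(x + y) \<otimes>\<^sub>s z = x \<otimes>\<^sub>s z + y \<otimes>\<^sub>s z"
  and tensor_add_right: "x' \<otimes>\<^sub>s (y' + z') = x' \<otimes>\<^sub>s y' + x' \<otimes>\<^sub>s z'"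
  and tensor_scale_left: "(c *\<^sub>C x) \<otimes>\<^sub>s z = c *\<^sub>C (x \<otimes>\<^sub>s z)"
  and tensor_scale_right: "x \<otimes>\<^sub>s (c *\<^sub>C z) = c *\<^sub>C (x \<otimes>\<^sub>s z)"
  by (transfer, unfold tensor_rel_def diff_diff_add[symmetric], rule cvec.span_base,
      unfold bilin_relators_def, blast)+

lemma stensor_cases: obtains a where "t = abs_stensor a"
  by (metis Quotient_abs_rep[OF Quotient_stensor])

text \<open>The linear map on the tensor product induced by a bilinear map.\<close>
definition tensor_ext ::
  "('a::superspace \<Rightarrow> 'b::superspace \<Rightarrow> 'c::cvector) \<Rightarrow> ('a, 'b) stensor \<Rightarrow> 'c"
  where "tensor_ext F t = lin_ext (\<lambda>(x, y). F x y) (rep_stensor t)"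

definition bilin :: "('a::cvector \<Rightarrow> 'b::cvector \<Rightarrow> 'c::cvector) \<Rightarrow> bool"
  where "bilin F \<longleftrightarrow> (\<forall>x. clinear (F x)) \<and> (\<forall>y. clinear (\<lambda>x. F x y))"

lemma tensor_ext_abs:
  assumes "bilin F"
  shows "tensor_ext F (abs_stensor a) = lin_ext (\<lambda>(x, y). F x y) a"
  unfolding tensor_ext_def
proof (rule free_span_cong[OF clinear_lin_ext])
  show "rep_stensor (abs_stensor a) - a \<in> cvec.span bilin_relators"
    using Quotient_rep_abs[OF Quotient_stensor, of a] equivp_reflp[OF stensor_equivp]
    by (simp add: tensor_rel_def)
next
  fix r assume "r \<in> (bilin_relators :: (('a \<times> 'b) \<Rightarrow>\<^sub>0 complex) set)"
  with assms show "lin_ext (\<lambda>(x, y). F x y) r = 0"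
    unfolding bilin_relators_def bilin_def
    by (auto simp: lin_ext_diff lin_ext_scale clinear_add[of "F _"] clinear_add[of "\<lambda>x. F x _"]
        clinear_scale[of "F _"] clinear_scale[of "\<lambda>x. F x _"] simp del: cscale_single)
qed

lemma tensor_ext_tensor: "bilin F \<Longrightarrow> tensor_ext F (x \<otimes>\<^sub>s y) = F x y"
  by (simp add: tensor.abs_eq tensor_ext_abs)

lemma clinear_tensor_ext: assumes "bilin F" shows "clinear (tensor_ext F)"
proof (rule clinearI)
  show "tensor_ext F (s + t) = tensor_ext F s + tensor_ext F t" for s t
    by (cases s rule: stensor_cases, cases t rule: stensor_cases)
      (simp add: plus_stensor.abs_eq tensor_ext_abs[OF assms] lin_ext_add)
  show "tensor_ext F (c *\<^sub>C s) = c *\<^sub>C tensor_ext F s" for c s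
    by (cases s rule: stensor_cases)
      (simp add: cscale_stensor.abs_eq tensor_ext_abs[OF assms] lin_ext_scale)
qed

lemma clinear_abs_stensor: "clinear abs_stensor"
  by (rule clinearI) (simp_all add: plus_stensor.abs_eq cscale_stensor.abs_eq)

lemma tensor_clinear_eqI:
  assumes "clinear G" "clinear H" "\<And>x y. G (x \<otimes>\<^sub>s y) = H (x \<otimes>\<^sub>s y)"
  shows "G t = H t"
proof -
  obtain a where t: "t = abs_stensor a" by (rule stensor_cases)
  have "clinear (G \<circ> abs_stensor)" "clinear (H \<circ> abs_stensor)"
    by (auto intro!: clinearI simp: clinear_add[OF clinear_abs_stensor]
        clinear_scale[OF clinear_abs_stensor] clinear_add[OF assms(1)] clinear_scale[OF assms(1)]
        clinear_add[OF assms(2)] clinear_scale[OF assms(2)])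
  then have "(G \<circ> abs_stensor) a = (H \<circ> abs_stensor) a"
  proof (rule free_clinear_eqI)
    show "(G \<circ> abs_stensor) (Poly_Mapping.single k 1) = (H \<circ> abs_stensor) (Poly_Mapping.single k 1)" for k
      using assms(3)[of "fst k" "snd k"] by (simp add: tensor.abs_eq)
  qed
  then show ?thesis by (simp add: t)
qed

definition stensor_even ::
  "'a::superspace \<Rightarrow> 'b::superspace \<Rightarrow> ('a, 'b) stensor"
  where "stensor_even x y = even_part x \<otimes>\<^sub>s even_part y + odd_part x \<otimes>\<^sub>s odd_part y"

lemma tensor_0 [simp]: "0 \<otimes>\<^sub>s y = 0" "x \<otimes>\<^sub>s 0 = 0"
  using tensor_scale_left[of 0 0 y] tensor_scale_right[of x 0 0] by simp_all

lemma bilin_stensor_even: "bilin stensor_even"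
  unfolding bilin_def stensor_even_def
  by (auto intro!: clinearI simp: even_part_add odd_part_add even_part_scale odd_part_scale
      tensor_add_left tensor_add_right tensor_scale_left tensor_scale_right cscale_add_right)

lemma stensor_even_stensor_even:
  "tensor_ext stensor_even (stensor_even x y) = stensor_even x y"
  by (simp add: stensor_even_def[of x y] clinear_add[OF clinear_tensor_ext[OF bilin_stensor_even]]
      tensor_ext_tensor[OF bilin_stensor_even])
    (simp add: stensor_even_def)

instantiation stensor :: (superspace, superspace) superspace
begin
definition even_part_stensor :: "('a, 'b) stensor \<Rightarrow> ('a, 'b) stensor"
  where "even_part_stensor = tensor_ext stensor_even"
instance
proof
  note lin = clinear_tensor_ext[OF bilin_stensor_even]
  show "even_part (s + t) = even_part s + even_part t" for s t :: "('a, 'b) stensor"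
    unfolding even_part_stensor_def by (rule clinear_add[OF lin])
  show "even_part (c *\<^sub>C t) = c *\<^sub>C even_part t" for c and t :: "('a, 'b) stensor"
    unfolding even_part_stensor_def by (rule clinear_scale[OF lin])
  show "even_part (even_part t) = even_part t" for t :: "('a, 'b) stensor"
    unfolding even_part_stensor_def
    by (rule tensor_clinear_eqI[of "\<lambda>t. tensor_ext stensor_even (tensor_ext stensor_even t)"])
      (auto intro!: clinearI simp: clinear_add[OF lin] clinear_scale[OF lin]
        tensor_ext_tensor[OF bilin_stensor_even] stensor_even_stensor_even lin)
qed
end

lemma even_part_tensor:
  "even_part (x \<otimes>\<^sub>s y) = even_part x \<otimes>\<^sub>s even_part y + odd_part x \<otimes>\<^sub>s odd_part y"
  by (simp add: even_part_stensor_def tensor_ext_tensor bilin_stensor_even stensor_even_def)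

text \<open>
  The operator \<open>A \<otimes> 1 + 1 \<otimes> B\<close> with the sign rule
  \<open>(1 \<otimes> B)(x \<otimes> y) = (-1)\<^bsup>p(B)p(x)\<^esup> x \<otimes> B y\<close>.  If \<open>A\<close> and \<open>B\<close> are the actions of an element of a
  Lie superalgebra on two modules, this is its action on the tensor product.
\<close>
definition leibniz_bilin ::
  "'a::superspace gl \<Rightarrow> 'b::superspace gl \<Rightarrow> 'a \<Rightarrow> 'b \<Rightarrow> ('a, 'b) stensor"
  where "leibniz_bilin A B x y = gl_apply A x \<otimes>\<^sub>s y
    + x \<otimes>\<^sub>s gl_apply (even_part B) y + grade_inv x \<otimes>\<^sub>s gl_apply (odd_part B) y"

definition leibniz ::
  "'a::superspace gl \<Rightarrow> 'b::superspace gl \<Rightarrow> ('a, 'b) stensor gl"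
  where "leibniz A B = Abs_gl (tensor_ext (leibniz_bilin A B))"

lemma bilin_leibniz: "bilin (leibniz_bilin A B)"
  unfolding bilin_def leibniz_bilin_def
  by (auto intro!: clinearI simp: gl_apply_add gl_apply_scale grade_inv_add grade_inv_scale
      tensor_add_left tensor_add_right tensor_scale_left tensor_scale_right cscale_add_right)

lemma gl_apply_leibniz:
  "gl_apply (leibniz A B) (x \<otimes>\<^sub>s y) = gl_apply A x \<otimes>\<^sub>s y
    + x \<otimes>\<^sub>s gl_apply (even_part B) y + grade_inv x \<otimes>\<^sub>s gl_apply (odd_part B) y"
  by (simp add: leibniz_def Abs_gl_inverse clinear_tensor_ext bilin_leibniz tensor_ext_tensor)
    (simp add: leibniz_bilin_def)


section \<open>The symmetric algebra of a superspace\<close>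

text \<open>
  \<open>S(U)\<close> is the quotient of the free associative algebra on the set \<open>U\<close> by the ideal generated by
  the relations making \<open>U \<rightarrow> S(U)\<close> linear and by \<open>u v = (-1)\<^bsup>p(u)p(v)\<^esup> v u\<close> for homogeneous
  \<open>u\<close>, \<open>v\<close>.  The free algebra is the monoid algebra of the monoid of words.
\<close>

datatype 'u fword = FWord (letters: "'u list")

instantiation fword :: (type) monoid_add
begin
definition zero_fword :: "'a fword" where "zero_fword = FWord []"
definition plus_fword :: "'a fword \<Rightarrow> 'a fword \<Rightarrow> 'a fword"
  where "plus_fword a b = FWord (letters a @ letters b)"
instance by standard (simp_all add: zero_fword_def plus_fword_def)
end

type_synonym 'u free_alg = "'u fword \<Rightarrow>\<^sub>0 complex"

definition fgen :: "'u \<Rightarrow> 'u free_alg"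
  where "fgen u = Poly_Mapping.single (FWord [u]) 1"

definition sym_relators :: "'u::superspace free_alg set"
  where "sym_relators =
      {fgen (u + v) - fgen u - fgen v | u v. True}
    \<union> {fgen (c *\<^sub>C u) - c *\<^sub>C fgen u | c u. True}
    \<union> {fgen u * fgen v - (-1) ^ (k * l) *\<^sub>C (fgen v * fgen u) | u v k l.
         has_parity k u \<and> has_parity l v}"

definition sym_ideal :: "'u::superspace free_alg set"
  where "sym_ideal = cvec.span {x * r * y | x r y. r \<in> sym_relators}"

definition sym_rel :: "'u::superspace free_alg \<Rightarrow> 'u free_alg \<Rightarrow> bool"
  where "sym_rel a b \<longleftrightarrow> a - b \<in> sym_ideal"

quotient_type (overloaded) 'u symalg = "'u::superspace free_alg" / sym_rel
  unfolding sym_rel_def[abs_def] sym_ideal_def by (rule equivp_span_diff)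

lemma free_cscale_conv:
  fixes a :: "'u free_alg"
  shows "c *\<^sub>C a = Poly_Mapping.single 0 c * a" "c *\<^sub>C a = a * Poly_Mapping.single 0 c"
proof -
  define K where "K = Poly_Mapping.keys a"
  have a: "a = (\<Sum>k\<in>K. Poly_Mapping.single k (Poly_Mapping.lookup a k))"
    using free_decomp[of a] by (simp add: K_def)
  show "c *\<^sub>C a = Poly_Mapping.single 0 c * a"
    by (subst (1 2) a) (simp add: sum_distrib_left mult_single cvec.scale_sum_right)
  show "c *\<^sub>C a = a * Poly_Mapping.single 0 c"
    by (subst (1 2) a) (simp add: sum_distrib_right mult_single cvec.scale_sum_right mult.commute)
qed

lemma free_cscale_mult:
  fixes a b :: "'u free_alg"
  shows "(c *\<^sub>C a) * b = c *\<^sub>C (a * b)" "a * (c *\<^sub>C b) = c *\<^sub>C (a * b)"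
proof -
  show "(c *\<^sub>C a) * b = c *\<^sub>C (a * b)"
    unfolding free_cscale_conv(1) by (rule mult.assoc)
  show "a * (c *\<^sub>C b) = c *\<^sub>C (a * b)"
    unfolding free_cscale_conv(2) by (rule mult.assoc[symmetric])
qed

text \<open>The constant term; it vanishes on the ideal, so the symmetric algebra is not zero.\<close>
definition counit :: "'u free_alg \<Rightarrow> complex"
  where "counit = lin_ext (\<lambda>m. if m = 0 then 1 else 0)"

lemma clinear_counit: "clinear counit"
  unfolding counit_def by (rule clinear_lin_ext)

lemma counit_mult: "counit (a * b) = counit a * counit b"
proof (rule free_clinear_eqI[of "\<lambda>a. counit (a * b)" "\<lambda>a. counit a * counit b"])
  show "clinear (\<lambda>a. counit (a * b))"
    by (rule clinearI) (simp_all add: distrib_right free_cscale_mult clinear_add[OF clinear_counit]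
        clinear_scale[OF clinear_counit])
  show "clinear (\<lambda>a. counit a * counit b)"
    by (rule clinearI) (simp_all add: distrib_right clinear_add[OF clinear_counit]
        clinear_scale[OF clinear_counit])
  fix k :: "'a fword"
  let ?s = "Poly_Mapping.single k 1 :: 'a free_alg"
  show "counit (?s * b) = counit ?s * counit b"
  proof (rule free_clinear_eqI[of "\<lambda>b. counit (?s * b)" "\<lambda>b. counit ?s * counit b"])
    show "clinear (\<lambda>b. counit (?s * b))"
      by (rule clinearI) (simp_all add: distrib_left free_cscale_mult clinear_add[OF clinear_counit]
          clinear_scale[OF clinear_counit])
    show "clinear (\<lambda>b. counit ?s * counit b)"
      by (rule clinearI) (simp_all add: distrib_left clinear_add[OF clinear_counit]
          clinear_scale[OF clinear_counit])
    fix l :: "'a fword"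
    show "counit (?s * Poly_Mapping.single l 1) = counit ?s * counit (Poly_Mapping.single l 1)"
      by (cases k; cases l)
        (simp add: mult_single counit_def zero_fword_def plus_fword_def)
  qed
qed

lemma counit_sym_ideal:
  assumes "a \<in> sym_ideal" shows "counit a = 0"
proof -
  have 0: "counit (fgen u) = 0" for u :: 'a
    by (simp add: counit_def fgen_def zero_fword_def)
  have "counit r = 0" if "r \<in> sym_relators" for r :: "'a free_alg"
    using that unfolding sym_relators_def
    by (auto simp: clinear_diff[OF clinear_counit] clinear_scale[OF clinear_counit] counit_mult 0)
  then have "counit a = counit (0 :: 'a free_alg)"
  proof (intro free_span_cong[OF clinear_counit])
    show "a - 0 \<in> cvec.span {x * r * y | x r y. r \<in> sym_relators}"
      using assms unfolding sym_ideal_def by simp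
  qed (auto simp: counit_mult)
  then show ?thesis by (simp add: clinear_0[OF clinear_counit])
qed

lemma sym_ideal_mult:
  assumes "a \<in> sym_ideal" shows "x * a * y \<in> sym_ideal"
  using assms unfolding sym_ideal_def
proof (induction rule: cvec.span_induct_alt)
  show "x * 0 * y \<in> cvec.span {x * r * y | x r y. r \<in> sym_relators}"
    by (simp add: cvec.span_zero)
next
  fix c and a b :: "'a free_alg"
  assume *: "a \<in> {x * r * y | x r y. r \<in> sym_relators}"
    "x * b * y \<in> cvec.span {x * r * y | x r y. r \<in> sym_relators}"
  from *(1) obtain x' r y' where a: "a = x' * r * y'" "r \<in> sym_relators" by blast
  have "x * a * y \<in> {x * r * y | x r y. r \<in> sym_relators}"
    unfolding a(1) mem_Collect_eq using a(2)
    by (intro exI[of _ "x * x'"] exI[of _ r] exI[of _ "y' * y"]) (simp add: mult.assoc)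
  moreover have "x * (c *\<^sub>C a + b) * y = c *\<^sub>C (x * a * y) + x * b * y"
    by (simp add: algebra_simps free_cscale_mult)
  ultimately show "x * (c *\<^sub>C a + b) * y \<in> cvec.span {x * r * y | x r y. r \<in> sym_relators}"
    using * by (simp add: cvec.span_add cvec.span_scale cvec.span_base)
qed

instantiation symalg :: (superspace) "{ring_1, cvector}"
begin
lift_definition zero_symalg :: "'a symalg" is 0 .
lift_definition one_symalg :: "'a symalg" is 1 .
lift_definition plus_symalg :: "'a symalg \<Rightarrow> 'a symalg \<Rightarrow> 'a symalg" is "(+)"
  unfolding sym_rel_def sym_ideal_def by (simp add: add_diff_add cvec.span_add)
lift_definition minus_symalg :: "'a symalg \<Rightarrow> 'a symalg \<Rightarrow> 'a symalg" is "(-)"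
proof -
  fix a b c d :: "'a free_alg"
  assume "sym_rel a b" "sym_rel c d"
  from cvec.span_diff[OF this[unfolded sym_rel_def sym_ideal_def]] show "sym_rel (a - c) (b - d)"
    by (simp add: sym_rel_def sym_ideal_def algebra_simps)
qed
lift_definition uminus_symalg :: "'a symalg \<Rightarrow> 'a symalg" is uminus
proof -
  fix a b :: "'a free_alg"
  assume "sym_rel a b"
  from cvec.span_neg[OF this[unfolded sym_rel_def sym_ideal_def]] show "sym_rel (- a) (- b)"
    by (simp add: sym_rel_def sym_ideal_def algebra_simps)
qed
lift_definition times_symalg :: "'a symalg \<Rightarrow> 'a symalg \<Rightarrow> 'a symalg" is "(*)"
proof -
  fix a b c d :: "'a free_alg"
  assume *: "sym_rel a b" "sym_rel c d"
  have "1 * (a - b) * c \<in> sym_ideal" "b * (c - d) * 1 \<in> sym_ideal"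
    using * unfolding sym_rel_def by (blast intro: sym_ideal_mult)+
  then have "1 * (a - b) * c + b * (c - d) * 1 \<in> sym_ideal"
    unfolding sym_ideal_def by (rule cvec.span_add)
  then show "sym_rel (a * c) (b * d)"
    by (simp add: sym_rel_def algebra_simps)
qed
lift_definition cscale_symalg :: "complex \<Rightarrow> 'a symalg \<Rightarrow> 'a symalg" is cscale
proof -
  fix c and a b :: "'a free_alg"
  assume "sym_rel a b"
  from cvec.span_scale[OF this[unfolded sym_rel_def sym_ideal_def], of c]
  show "sym_rel (c *\<^sub>C a) (c *\<^sub>C b)"
    by (simp add: sym_rel_def sym_ideal_def cvec.scale_right_diff_distrib)
qed
instance
proof
  show "(0 :: 'a symalg) \<noteq> 1"
  proof (transfer, rule notI)
    assume "sym_rel (0 :: 'a free_alg) 1"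
    from counit_sym_ideal[OF this[unfolded sym_rel_def]] show False
      by (simp only: clinear_diff[OF clinear_counit] clinear_0[OF clinear_counit])
        (simp add: counit_def flip: single_one)
  qed
qed (transfer; simp add: equivp_reflp[OF symalg_equivp] algebra_simps
      cscale_add_right cscale_add_left)+
end

lift_definition sym_gen :: "'u::superspace \<Rightarrow> 'u symalg" is fgen .

lemma symalg_cases: obtains a where "t = abs_symalg a"
  by (metis Quotient_abs_rep[OF Quotient_symalg])

lemma clinear_abs_symalg: "clinear abs_symalg"
  by (rule clinearI) (simp_all add: plus_symalg.abs_eq cscale_symalg.abs_eq)

lemma abs_symalg_0: "r \<in> sym_ideal \<Longrightarrow> abs_symalg r = 0"
  by (simp add: zero_symalg.abs_eq symalg.abs_eq_iff sym_rel_def)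

lemma sym_relators_ideal: "r \<in> sym_relators \<Longrightarrow> r \<in> sym_ideal"
  unfolding sym_ideal_def
  by (rule cvec.span_base, unfold mem_Collect_eq, intro exI[of _ 1] exI[of _ r]) simp

lemma sym_cscale_mult:
  fixes a b :: "'u::superspace symalg"
  shows "(c *\<^sub>C a) * b = c *\<^sub>C (a * b)" "a * (c *\<^sub>C b) = c *\<^sub>C (a * b)"
  by (transfer, simp add: free_cscale_mult equivp_reflp[OF symalg_equivp])+

lemma clinear_sym_gen: "clinear sym_gen"
proof (rule clinearI)
  fix u v :: 'a and c
  have "abs_symalg (fgen (u + v) - fgen u - fgen v) = 0"
    by (intro abs_symalg_0 sym_relators_ideal) (auto simp: sym_relators_def)
  then show "sym_gen (u + v) = sym_gen u + sym_gen v"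
    by (simp add: sym_gen.abs_eq clinear_diff[OF clinear_abs_symalg] plus_symalg.abs_eq
        diff_diff_add)
  have "abs_symalg (fgen (c *\<^sub>C u) - c *\<^sub>C fgen u) = 0"
    by (intro abs_symalg_0 sym_relators_ideal) (auto simp: sym_relators_def)
  then show "sym_gen (c *\<^sub>C u) = c *\<^sub>C sym_gen u"
    by (simp add: sym_gen.abs_eq clinear_diff[OF clinear_abs_symalg] cscale_symalg.abs_eq)
qed

lemmas sym_gen_add = clinear_add[OF clinear_sym_gen]
  and sym_gen_scale = clinear_scale[OF clinear_sym_gen]
  and sym_gen_0 [simp] = clinear_0[OF clinear_sym_gen]

lemma sym_gen_supercommute:
  assumes "has_parity k u" "has_parity l v"
  shows "sym_gen u * sym_gen v = (-1) ^ (k * l) *\<^sub>C (sym_gen v * sym_gen u)"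
proof -
  have "abs_symalg (fgen u * fgen v - (-1) ^ (k * l) *\<^sub>C (fgen v * fgen u)) = 0"
    using assms by (intro abs_symalg_0 sym_relators_ideal) (auto simp: sym_relators_def)
  then show ?thesis
    by (simp add: sym_gen.abs_eq clinear_diff[OF clinear_abs_symalg] cscale_symalg.abs_eq
        times_symalg.abs_eq)
qed

text \<open>
  The action of \<open>D \<in> gl(U)\<close> on \<open>S(U)\<close> by superderivations: on a product of generators,
  \<open>D (u v) = (D u) v + (-1)\<^bsup>p(D)p(u)\<^esup> u (D v)\<close> for homogeneous \<open>D\<close> and \<open>u\<close>.
  The theorems \<open>clinear_sym_act\<close>, \<open>sym_act_gen\<close> and \<open>sym_act_mult\<close> below show that it is
  well defined on the quotient and is the superderivation extending \<open>D\<close>.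
\<close>
definition sym_word :: "'u::superspace list \<Rightarrow> 'u symalg"
  where "sym_word us = prod_list (map sym_gen us)"

fun der_word :: "'u::superspace gl \<Rightarrow> 'u list \<Rightarrow> 'u symalg"
  where "der_word D [] = 0"
  | "der_word D (u # us) = sym_gen (gl_apply D u) * sym_word us
      + sym_gen u * der_word (even_part D) us + sym_gen (grade_inv u) * der_word (odd_part D) us"

definition sym_act :: "'u::superspace gl \<Rightarrow> 'u symalg \<Rightarrow> 'u symalg"
  where "sym_act D s = lin_ext (\<lambda>m. der_word D (letters m)) (rep_symalg s)"

lemma gl_apply_zero [simp]: "gl_apply 0 u = 0"
  by transfer simp

lemma gl_apply_plus: "gl_apply (C + D) u = gl_apply C u + gl_apply D u"
  by transfer simp

lemma der_word_0 [simp]: "der_word 0 us = 0"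
  by (induction us) simp_all

lemma sym_word_append: "sym_word (us @ vs) = sym_word us * sym_word vs"
  by (simp add: sym_word_def)

lemma sym_gen_split:
  "sym_gen (gl_apply D u) = sym_gen (gl_apply (even_part D) u) + sym_gen (gl_apply (odd_part D) u)"
  by (simp flip: sym_gen_add gl_apply_plus)

lemma der_word_split: "der_word D vs = der_word (even_part D) vs + der_word (odd_part D) vs"
  by (induction vs) (simp_all add: sym_gen_split[of D] algebra_simps)

lemma der_word_append:
  "der_word D (us @ vs) = der_word D us * sym_word vs + sym_word us * der_word (even_part D) vs
    + sym_word (map grade_inv us) * der_word (odd_part D) vs"
proof (induction us arbitrary: D)
  case Nil
  show ?case by (simp add: sym_word_def flip: der_word_split)
next
  case (Cons u us)
  show ?case
    by (simp add: Cons.IH sym_word_append) (simp add: sym_word_def algebra_simps)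
qed

lemma sym_word_grade_inv_append:
  "sym_word (map grade_inv (us @ vs)) = sym_word (map grade_inv us) * sym_word (map grade_inv vs)"
  by (simp add: sym_word_def)

definition free_der :: "'u::superspace gl \<Rightarrow> 'u free_alg \<Rightarrow> 'u symalg"
  where "free_der D = lin_ext (\<lambda>m. der_word D (letters m))"

definition free_inv :: "'u::superspace free_alg \<Rightarrow> 'u symalg"
  where "free_inv = lin_ext (\<lambda>m. sym_word (map grade_inv (letters m)))"

lemma clinear_free_der: "clinear (free_der D)" and clinear_free_inv: "clinear free_inv"
  unfolding free_der_def free_inv_def by (rule clinear_lin_ext)+

lemma abs_symalg_word: "abs_symalg (Poly_Mapping.single (FWord us) 1) = sym_word us"
proof (induction us)
  case Nil
  show ?case
    by (simp add: sym_word_def one_symalg.abs_eq flip: zero_fword_def)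
next
  case (Cons u us)
  have "Poly_Mapping.single (FWord (u # us)) 1 = fgen u * Poly_Mapping.single (FWord us) (1::complex)"
    by (simp add: fgen_def mult_single plus_fword_def)
  then show ?case
    using Cons by (simp add: sym_word_def sym_gen.abs_eq flip: times_symalg.abs_eq)
qed

lemma free_mult_eqI:
  fixes F G :: "'u free_alg \<Rightarrow> 'u free_alg \<Rightarrow> 'c::cvector"
  assumes "bilin F" "bilin G"
    and "\<And>us vs. F (Poly_Mapping.single (FWord us) 1) (Poly_Mapping.single (FWord vs) 1)
      = G (Poly_Mapping.single (FWord us) 1) (Poly_Mapping.single (FWord vs) 1)"
  shows "F a b = G a b"
proof (rule free_clinear_eqI[of "\<lambda>a. F a b" "\<lambda>a. G a b"])
  show "clinear (\<lambda>a. F a b)" "clinear (\<lambda>a. G a b)" using assms(1,2) by (auto simp: bilin_def)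
  fix k
  show "F (Poly_Mapping.single k 1) b = G (Poly_Mapping.single k 1) b"
  proof (rule free_clinear_eqI)
    show "clinear (F (Poly_Mapping.single k 1))" "clinear (G (Poly_Mapping.single k 1))"
      using assms(1,2) by (auto simp: bilin_def)
    show "F (Poly_Mapping.single k 1) (Poly_Mapping.single l 1)
      = G (Poly_Mapping.single k 1) (Poly_Mapping.single l 1)" for l
      using assms(3)[of "letters k" "letters l"] by simp
  qed
qed

lemma bilin_free_comp_mult: "clinear f \<Longrightarrow> bilin (\<lambda>a b :: 'u free_alg. f (a * b))"
  unfolding bilin_def
  by (auto intro!: clinearI simp: clinear_add[of f] clinear_scale[of f] algebra_simps
      free_cscale_mult)

lemma bilin_mult_comp:
  fixes f :: "_ \<Rightarrow> 'u::superspace symalg"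
  shows "clinear f \<Longrightarrow> clinear g \<Longrightarrow> bilin (\<lambda>a b. f a * g b)"
  unfolding bilin_def
  by (auto intro!: clinearI simp: clinear_add[of f] clinear_scale[of f]
      clinear_add[of g] clinear_scale[of g] algebra_simps sym_cscale_mult)

lemma bilin_add: "bilin F \<Longrightarrow> bilin G \<Longrightarrow> bilin (\<lambda>a b. F a b + G a b)"
  unfolding bilin_def
  by (auto intro!: clinearI simp: clinear_add[of "F _"] clinear_add[of "G _"]
      clinear_add[of "\<lambda>x. F x _"] clinear_add[of "\<lambda>x. G x _"] clinear_scale[of "F _"]
      clinear_scale[of "G _"] clinear_scale[of "\<lambda>x. F x _"] clinear_scale[of "\<lambda>x. G x _"]
      cscale_add_right)

lemma free_inv_mult: "free_inv (a * b) = free_inv a * free_inv b"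
proof (rule free_mult_eqI[of "\<lambda>a b. free_inv (a * b)" "\<lambda>a b. free_inv a * free_inv b"])
  show "bilin (\<lambda>a b. free_inv (a * b))"
    by (rule bilin_free_comp_mult[OF clinear_free_inv])
  show "bilin (\<lambda>a b. free_inv a * free_inv b)"
    by (rule bilin_mult_comp[OF clinear_free_inv clinear_free_inv])
qed (simp add: mult_single free_inv_def plus_fword_def sym_word_def)

lemma free_der_mult:
  "free_der D (a * b) = free_der D a * abs_symalg b + abs_symalg a * free_der (even_part D) b
    + free_inv a * free_der (odd_part D) b"
proof (rule free_mult_eqI[of "\<lambda>a b. free_der D (a * b)" "\<lambda>a b. free_der D a * abs_symalg b
        + abs_symalg a * free_der (even_part D) b + free_inv a * free_der (odd_part D) b"])
  show "bilin (\<lambda>a b. free_der D (a * b))"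
    by (rule bilin_free_comp_mult[OF clinear_free_der])
  show "bilin (\<lambda>a b. free_der D a * abs_symalg b
        + abs_symalg a * free_der (even_part D) b + free_inv a * free_der (odd_part D) b)"
    by (intro bilin_add bilin_mult_comp clinear_free_der clinear_free_inv clinear_abs_symalg)
qed (simp add: mult_single abs_symalg_word free_inv_def free_der_def plus_fword_def der_word_append)

lemma free_der_gen: "free_der D (fgen u) = sym_gen (gl_apply D u)"
  and free_inv_gen: "free_inv (fgen u) = sym_gen (grade_inv u)"
  and abs_symalg_gen: "abs_symalg (fgen u) = sym_gen u"
  by (simp_all add: free_der_def free_inv_def fgen_def abs_symalg_word sym_word_def)

lemma grade_inv_even_odd: "has_parity k (grade_inv u) = has_parity k u"
  by (auto simp: has_parity_def grade_inv_def even_part_diff odd_part_def)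

lemma gl_apply_even_part:
  "gl_apply (even_part D) u = even_part (gl_apply D (even_part u)) + odd_part (gl_apply D (odd_part u))"
  by transfer simp

lemma gl_apply_odd_part:
  "gl_apply (odd_part D) u = even_part (gl_apply D (odd_part u)) + odd_part (gl_apply D (even_part u))"
proof -
  have "gl_apply D u = gl_apply D (even_part u) + gl_apply D (odd_part u)"
    by (simp flip: gl_apply_add)
  then have "gl_apply D u = even_part (gl_apply D (even_part u)) + odd_part (gl_apply D (even_part u))
     + (even_part (gl_apply D (odd_part u)) + odd_part (gl_apply D (odd_part u)))"
    by simp
  moreover have "gl_apply D u = gl_apply (even_part D) u + gl_apply (odd_part D) u"
    by (simp flip: gl_apply_plus)
  ultimately show ?thesis
    by (simp add: gl_apply_even_part algebra_simps)
qed

lemma has_parity_gl_even: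
  assumes "has_parity k u" shows "has_parity k (gl_apply (even_part D) u)"
proof (cases "even k")
  case True
  with assms have "even_part u = u" "odd_part u = 0" by (auto simp: has_parity_def odd_part_def)
  with True show ?thesis by (simp add: has_parity_def gl_apply_even_part even_part_add)
next
  case False
  with assms have "even_part u = 0" "odd_part u = u" by (auto simp: has_parity_def odd_part_def)
  with False show ?thesis by (simp add: has_parity_def gl_apply_even_part even_part_add)
qed

lemma has_parity_gl_odd:
  assumes "has_parity k u" shows "has_parity (Suc k) (gl_apply (odd_part D) u)"
proof (cases "even k")
  case True
  with assms have "even_part u = u" "odd_part u = 0" by (auto simp: has_parity_def odd_part_def)
  with True show ?thesis by (simp add: has_parity_def gl_apply_odd_part even_part_add)
next
  case False
  with assms have "even_part u = 0" "odd_part u = u" by (auto simp: has_parity_def odd_part_def)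
  with False show ?thesis by (simp add: has_parity_def gl_apply_odd_part even_part_add)
qed

lemma free_der_commutator:
  assumes u: "has_parity k u" and v: "has_parity l v"
  shows "free_der D (fgen u * fgen v) = (-1) ^ (k * l) *\<^sub>C free_der D (fgen v * fgen u)"
proof -
  let ?E = "even_part D" and ?O = "odd_part D"
  have sq: "(-1) ^ m * ((-1) ^ m * z) = (z :: complex)" for m z
    by (simp flip: mult.assoc power_mult_distrib)
  note comm = sym_gen_supercommute[OF has_parity_gl_even[OF u, of D] v]
    sym_gen_supercommute[OF has_parity_gl_odd[OF u, of D] v]
    sym_gen_supercommute[OF u has_parity_gl_even[OF v, of D]]
    sym_gen_supercommute[OF u has_parity_gl_odd[OF v, of D]]
  have "free_der D (fgen u * fgen v) = sym_gen (gl_apply ?E u) * sym_gen v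
      + sym_gen (gl_apply ?O u) * sym_gen v + sym_gen u * sym_gen (gl_apply ?E v)
      + (-1) ^ k *\<^sub>C (sym_gen u * sym_gen (gl_apply ?O v))"
    by (simp add: free_der_mult free_der_gen free_inv_gen abs_symalg_gen grade_inv_parity[OF u]
        sym_gen_scale sym_cscale_mult sym_gen_split[of D] distrib_right)
  also have "\<dots> = (-1) ^ (k * l) *\<^sub>C (sym_gen (gl_apply ?E v) * sym_gen u
      + sym_gen (gl_apply ?O v) * sym_gen u + sym_gen v * sym_gen (gl_apply ?E u)
      + (-1) ^ l *\<^sub>C (sym_gen v * sym_gen (gl_apply ?O u)))"
    unfolding comm by (simp add: cscale_add_right power_add sq algebra_simps)
  also have "sym_gen (gl_apply ?E v) * sym_gen u
      + sym_gen (gl_apply ?O v) * sym_gen u + sym_gen v * sym_gen (gl_apply ?E u)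
      + (-1) ^ l *\<^sub>C (sym_gen v * sym_gen (gl_apply ?O u)) = free_der D (fgen v * fgen u)"
    by (simp add: free_der_mult free_der_gen free_inv_gen abs_symalg_gen grade_inv_parity[OF v]
        sym_gen_scale sym_cscale_mult sym_gen_split[of D] distrib_right)
  finally show ?thesis .
qed

lemma sym_relators_cases:
  assumes "r \<in> sym_relators"
  obtains (add) u v where "r = fgen (u + v) - fgen u - fgen v"
    | (scale) c u where "r = fgen (c *\<^sub>C u) - c *\<^sub>C fgen u"
    | (commute) k l u v where "has_parity k u" "has_parity l v"
      "r = fgen u * fgen v - (-1) ^ (k * l) *\<^sub>C (fgen v * fgen u)"
  using assms unfolding sym_relators_def by blast

lemma free_inv_relator:
  assumes "r \<in> sym_relators" shows "free_inv r = 0"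
  using assms
proof (cases r rule: sym_relators_cases)
  case (commute k l u v)
  have "free_inv (fgen u * fgen v) = (-1) ^ (k * l) *\<^sub>C free_inv (fgen v * fgen u)"
    unfolding free_inv_mult free_inv_gen
    using commute by (intro sym_gen_supercommute) (simp_all add: grade_inv_even_odd)
  then show ?thesis
    by (simp add: commute(3) clinear_diff[OF clinear_free_inv] clinear_scale[OF clinear_free_inv])
qed (simp_all add: clinear_diff[OF clinear_free_inv] clinear_scale[OF clinear_free_inv]
    free_inv_gen grade_inv_add grade_inv_scale sym_gen_add sym_gen_scale)

lemma free_der_relator:
  assumes "r \<in> sym_relators" shows "free_der D r = 0"
  using assms
proof (cases r rule: sym_relators_cases)
  case (commute k l u v)
  show ?thesis
    unfolding commute(3) clinear_diff[OF clinear_free_der] clinear_scale[OF clinear_free_der]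
      free_der_commutator[OF commute(1,2)] by simp
qed (simp_all add: clinear_diff[OF clinear_free_der] clinear_scale[OF clinear_free_der]
    free_der_gen gl_apply_add gl_apply_scale sym_gen_add sym_gen_scale)

lemma abs_symalg_mult: "abs_symalg (a * b) = abs_symalg a * abs_symalg b"
  by (simp add: times_symalg.abs_eq)

lemma free_der_ideal_generator:
  assumes "s \<in> {x * r * y | x r y. r \<in> sym_relators}" shows "free_der D s = 0"
proof -
  from assms obtain x r y where s: "s = x * r * y" and r: "r \<in> sym_relators" by blast
  show ?thesis
    unfolding s by (simp add: free_der_mult free_inv_mult abs_symalg_mult free_der_relator[OF r]
        free_inv_relator[OF r] abs_symalg_0[OF sym_relators_ideal[OF r]])
qed

lemma sym_act_abs: "sym_act D (abs_symalg a) = free_der D a"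
  unfolding sym_act_def free_der_def[symmetric]
proof (rule free_span_cong[OF clinear_free_der])
  show "rep_symalg (abs_symalg a) - a \<in> cvec.span {x * r * y | x r y. r \<in> sym_relators}"
    using Quotient_rep_abs[OF Quotient_symalg, of a] equivp_reflp[OF symalg_equivp]
    by (simp add: sym_rel_def sym_ideal_def)
qed (rule free_der_ideal_generator)

definition sym_grade_inv :: "'u::superspace symalg \<Rightarrow> 'u symalg"
  where "sym_grade_inv s = free_inv (rep_symalg s)"

lemma sym_grade_inv_abs: "sym_grade_inv (abs_symalg a) = free_inv a"
  unfolding sym_grade_inv_def
proof (rule free_span_cong[OF clinear_free_inv])
  show "rep_symalg (abs_symalg a) - a \<in> cvec.span {x * r * y | x r y. r \<in> sym_relators}"
    using Quotient_rep_abs[OF Quotient_symalg, of a] equivp_reflp[OF symalg_equivp]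
    by (simp add: sym_rel_def sym_ideal_def)
qed (auto simp: free_inv_mult free_inv_relator)

theorem sym_act_mult:
  "sym_act D (a * b)
    = sym_act D a * b + a * sym_act (even_part D) b + sym_grade_inv a * sym_act (odd_part D) b"
  by (cases a rule: symalg_cases, cases b rule: symalg_cases)
    (simp add: sym_act_abs sym_grade_inv_abs free_der_mult flip: abs_symalg_mult)

theorem sym_act_gen: "sym_act D (sym_gen u) = sym_gen (gl_apply D u)"
  by (simp add: sym_gen.abs_eq sym_act_abs free_der_gen)

theorem clinear_sym_act: "clinear (sym_act D)"
proof (rule clinearI)
  show "sym_act D (s + t) = sym_act D s + sym_act D t" for s t
    by (cases s rule: symalg_cases, cases t rule: symalg_cases)
      (simp add: plus_symalg.abs_eq sym_act_abs clinear_add[OF clinear_free_der])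
  show "sym_act D (c *\<^sub>C s) = c *\<^sub>C sym_act D s" for c s
    by (cases s rule: symalg_cases)
      (simp add: cscale_symalg.abs_eq sym_act_abs clinear_scale[OF clinear_free_der])
qed


section \<open>Invariants of the periplectic Lie superalgebra\<close>

datatype idx = Unbarred nat | Barred nat

definition idx_set :: "nat \<Rightarrow> nat \<Rightarrow> idx set"
  where "idx_set p q = Unbarred ` {1..p} \<union> Barred ` {1..q}"

primrec idx_parity :: "idx \<Rightarrow> nat"
  where "idx_parity (Unbarred i) = 0" | "idx_parity (Barred i) = 1"

text \<open>
  A superspace has dimension \<open>(p, q)\<close> iff it has a homogeneous basis indexed by \<open>idx_set p q\<close>.
\<close>
definition homogeneous_basis :: "idx set \<Rightarrow> (idx \<Rightarrow> 'v::superspace) \<Rightarrow> bool"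
  where "homogeneous_basis I e \<longleftrightarrow> inj_on e I \<and> cvec.independent (e ` I) \<and> cvec.span (e ` I) = UNIV
    \<and> (\<forall>i\<in>I. has_parity (idx_parity i) (e i))"

definition dual_basis :: "idx set \<Rightarrow> (idx \<Rightarrow> 'v::superspace) \<Rightarrow> (idx \<Rightarrow> 'v sdual) \<Rightarrow> bool"
  where "dual_basis I e e' \<longleftrightarrow> (\<forall>i\<in>I. \<forall>j\<in>I. dual_apply (e' i) (e j) = (if i = j then 1 else 0))"

definition pe_tensor :: "nat \<Rightarrow> (idx \<Rightarrow> 'v::superspace sdual) \<Rightarrow> ('v sdual, 'v sdual) stensor"
  where "pe_tensor n e' = (\<Sum>i=1..n. e' (Unbarred i) \<otimes>\<^sub>s e' (Barred i) + e' (Barred i) \<otimes>\<^sub>s e' (Unbarred i))"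

definition pe :: "nat \<Rightarrow> (idx \<Rightarrow> 'v::superspace sdual) \<Rightarrow> 'v gl set"
  where "pe n e' = {D. gl_apply (leibniz (dual_act D) (dual_act D)) (pe_tensor n e') = 0}"

text \<open>\<open>W\<close> carries the trivial action of \<open>gl(V)\<close>, hence the \<open>0\<close>.\<close>
definition invariants :: "'v::superspace gl set \<Rightarrow> ('v sdual, 'w::superspace) stensor symalg set"
  where "invariants L = {a. \<forall>D\<in>L. sym_act (leibniz (dual_act D) 0) a = 0}"

definition xstar ::
  "(idx \<Rightarrow> 'v::superspace sdual) \<Rightarrow> (idx \<Rightarrow> 'w::superspace) \<Rightarrow> idx \<Rightarrow> idx
    \<Rightarrow> ('v sdual, 'w) stensor symalg"
  where "xstar e' w i s = sym_gen (e' i \<otimes>\<^sub>s w s)"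

definition inner_product ::
  "nat \<Rightarrow> (idx \<Rightarrow> 'v::superspace sdual) \<Rightarrow> (idx \<Rightarrow> 'w::superspace) \<Rightarrow> idx \<Rightarrow> idx
    \<Rightarrow> ('v sdual, 'w) stensor symalg"
  where "inner_product n e' w s t = (\<Sum>i=1..n.
    (-1) ^ idx_parity s *\<^sub>C (xstar e' w (Unbarred i) s * xstar e' w (Barred i) t)
      + xstar e' w (Barred i) s * xstar e' w (Unbarred i) t)"

definition subalgebra :: "'u::superspace symalg set \<Rightarrow> bool"
  where "subalgebra A \<longleftrightarrow> cvec.subspace A \<and> 1 \<in> A \<and> (\<forall>a\<in>A. \<forall>b\<in>A. a * b \<in> A)"

end

theory Submission
  imports Defs "HOL-Library.Nat_Bijection"
begin

text \<open>
  The symmetric algebra is identified with a space of superpolynomials in the variables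
  \<open>x\<^sub>i\<^sub>s\<close>, on which multiplications and superderivations generate a super Weyl algebra. Polarization
  with fresh even vectors removes all odd vectors \<open>w\<^sub>s\<close>, so \<open>W\<close> may be taken to be even of dimension
  \<open>N\<close>. There the polarization operators \<open>E\<^sub>s\<^sub>t\<close> satisfy, on invariants and modulo products of inner
  products with invariants of lower degree, the quadratic identity
  \<open>\<Sum>\<^sub>u E\<^sub>s\<^sub>u E\<^sub>u\<^sub>t = (N + 1) E\<^sub>s\<^sub>t\<close>. Hence a highest weight of the invariants modulo the algebra
  of inner products is \<open>(l + 1, \<dots>, l + 1, 0, \<dots>, 0)\<close> with \<open>l\<close> nonzero entries. For this weight, the
  terms of an invariant of highest degree in the diagonal variables show that it vanishes for
  \<open>l > n\<close> and is a multiple of the product of all \<open>(v\<^sub>s, v\<^sub>t)\<close>, \<open>s \<le> t \<le> l\<close>, otherwise.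
\<close>

section \<open>Parity of operators and the easy inclusion\<close>

text \<open>Complete reducibility fails for modules over \<open>pe\<close> in general, so no
  Reynolds operator is at hand. The argument relies instead on the supercommuting action of gl(W),
  whose weights are column degrees. The quadratic identity arises by contracting \<open>gram\<close>
  with \<open>lap\<close>, an invariant operator of second order: on invariants this product is a
  polynomial in polarizations. The contributions of n from even and odd rows cancel, N comes from
  contractions within one row, summed over the N columns, and the extra 1 from the reordering that
  exposes the row operators. The identity is stated for even columns, which is why odd ones are
  removed beforehand.

  For s = t the identity gives a quadratic equation for each entry of a highest weight. Working down
  from the last nonzero position l, its roots at position s are l + 1 and s - l, and the second is
  never admissible. The rectangular weight does occur: it is the weight of the product of all (v_s,
  v_t) with s \<le> t \<le> l, where v_s enters once for each t \<noteq> s and twice for t =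
  s.\<close>

lemma gl_eqI: "(\<And>x. gl_apply A x = gl_apply B x) \<Longrightarrow> A = B"
  by (metis gl_apply_inject ext)

lemma gl_apply_minus: "gl_apply (A - A') u = gl_apply A u - gl_apply A' u"
  by transfer simp

lemma gl_apply_diff: "gl_apply A (x - y) = gl_apply A x - gl_apply A y"
  by (rule clinear_diff[OF clinear_gl_apply])

lemma even_part_gl_even: "even_part (gl_apply (even_part A) x) = gl_apply (even_part A) (even_part x)"
  and even_part_gl_odd: "even_part (gl_apply (odd_part A) x) = gl_apply (odd_part A) (odd_part x)"
  by (simp_all add: gl_apply_even_part gl_apply_odd_part even_part_add)

lemma even_part_uminus: "even_part (- x) = - even_part x"
  using even_part_diff[of 0 x] by simp

lemma odd_part_diff: "odd_part (x - y) = odd_part x - odd_part y"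
  and odd_part_uminus: "odd_part (- x) = - odd_part x"
  by (simp_all add: odd_part_def even_part_diff even_part_uminus)

lemma odd_part_gl_even: "odd_part (gl_apply (even_part A) x) = gl_apply (even_part A) (odd_part x)"
  and odd_part_gl_odd: "odd_part (gl_apply (odd_part A) x) = gl_apply (odd_part A) (even_part x)"
proof -
  show "odd_part (gl_apply (even_part A) x) = gl_apply (even_part A) (odd_part x)"
    by (simp add: odd_part_def[of "gl_apply _ _"] odd_part_def[of x] even_part_gl_even gl_apply_diff)
  have "gl_apply (odd_part A) x = gl_apply (odd_part A) (even_part x) + gl_apply (odd_part A) (odd_part x)"
    by (simp flip: gl_apply_add)
  then show "odd_part (gl_apply (odd_part A) x) = gl_apply (odd_part A) (even_part x)"
    unfolding odd_part_def[of "gl_apply (odd_part A) x"] even_part_gl_odd by simp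
qed

lemma grade_inv_gl_even: "grade_inv (gl_apply (even_part A) x) = gl_apply (even_part A) (grade_inv x)"
  and grade_inv_gl_odd: "grade_inv (gl_apply (odd_part A) x) = - gl_apply (odd_part A) (grade_inv x)"
  by (simp_all add: grade_inv_def even_part_gl_even even_part_gl_odd odd_part_gl_even odd_part_gl_odd gl_apply_diff)

text \<open>Homogeneous components are unique: a summand commuting with \<open>even_part\<close> is
  even, and one that intertwines \<open>even_part\<close> with \<open>odd_part\<close> is odd. The
  components of \<open>leibniz\<close> and \<open>dual_act\<close> are read off in this way.\<close>

lemma gl_parts:
  assumes "A = A0 + A1" "\<And>x. even_part (gl_apply A0 x) = gl_apply A0 (even_part x)"
    "\<And>x. even_part (gl_apply A1 x) = gl_apply A1 (odd_part x)"
  shows "even_part A = A0" "odd_part A = A1"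
proof -
  have o: "odd_part (gl_apply A0 x) = gl_apply A0 (odd_part x)" "odd_part (gl_apply A1 x) = gl_apply A1 (even_part x)" for x
    by (simp_all add: odd_part_def[of "gl_apply _ _"] assms(2,3)) (simp_all add: odd_part_def gl_apply_diff)
  show "even_part A = A0"
  proof (rule gl_eqI)
    fix x
    have "gl_apply (even_part A) x = gl_apply A0 (even_part x) + gl_apply A0 (odd_part x)"
      by (simp add: gl_apply_even_part assms gl_apply_plus even_part_add odd_part_add o)
    also have "\<dots> = gl_apply A0 x" by (simp flip: gl_apply_add)
    finally show "gl_apply (even_part A) x = gl_apply A0 x" .
  qed
  then show "odd_part A = A1" using assms(1) by (simp add: odd_part_def)
qed

lemma odd_part_tensor: "odd_part (x \<otimes>\<^sub>s y) = even_part x \<otimes>\<^sub>s odd_part y + odd_part x \<otimes>\<^sub>s even_part y"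
proof -
  have "x \<otimes>\<^sub>s y = (even_part x + odd_part x) \<otimes>\<^sub>s (even_part y + odd_part y)" by simp
  then show ?thesis
    unfolding odd_part_def[of "x \<otimes>\<^sub>s y"] even_part_tensor
    by (simp only: tensor_add_left tensor_add_right) simp
qed

lemma tensor_diff_left: "(x - y) \<otimes>\<^sub>s z = x \<otimes>\<^sub>s z - y \<otimes>\<^sub>s z"
  using tensor_add_left[of "x - y" y z] by simp

lemma tensor_diff_right: "x \<otimes>\<^sub>s (y - z) = x \<otimes>\<^sub>s y - x \<otimes>\<^sub>s z"
  using tensor_add_right[of x "y - z" z] by simp

lemma tensor_uminus: "(- x) \<otimes>\<^sub>s z = - (x \<otimes>\<^sub>s z)" "x \<otimes>\<^sub>s (- z) = - (x \<otimes>\<^sub>s z)"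
  using tensor_diff_left[of 0 x z] tensor_diff_right[of x 0 z] by simp_all

lemma grade_inv_tensor: "grade_inv (x \<otimes>\<^sub>s y) = grade_inv x \<otimes>\<^sub>s grade_inv y"
  by (simp add: grade_inv_def even_part_tensor odd_part_tensor tensor_diff_left tensor_diff_right)

lemma clinear_comp: "clinear f \<Longrightarrow> clinear g \<Longrightarrow> clinear (\<lambda>x. f (g x))"
  by (rule clinearI) (simp_all add: clinear_add clinear_scale)

lemma clinear_odd_part: "clinear odd_part"
  by (intro clinearI odd_part_add odd_part_scale)

lemma leibniz_parts:
  "even_part (leibniz A B) = leibniz (even_part A) (even_part B)"
  "odd_part (leibniz A B) = leibniz (odd_part A) (odd_part B)"
proof -
  have 1: "leibniz A B = leibniz (even_part A) (even_part B) + leibniz (odd_part A) (odd_part B)"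
  proof (rule gl_eqI)
    show "gl_apply (leibniz A B) t = gl_apply (leibniz (even_part A) (even_part B) + leibniz (odd_part A) (odd_part B)) t" for t
    proof (rule tensor_clinear_eqI[OF clinear_gl_apply clinear_gl_apply])
      fix x y
      have "gl_apply A x = gl_apply (even_part A) x + gl_apply (odd_part A) x"
        by (simp flip: gl_apply_plus)
      then show "gl_apply (leibniz A B) (x \<otimes>\<^sub>s y) = gl_apply (leibniz (even_part A) (even_part B) + leibniz (odd_part A) (odd_part B)) (x \<otimes>\<^sub>s y)"
        by (simp add: gl_apply_plus gl_apply_leibniz tensor_add_left)
    qed
  qed
  have 2: "even_part (gl_apply (leibniz (even_part A) (even_part B)) t) = gl_apply (leibniz (even_part A) (even_part B)) (even_part t)" for t
    by (rule tensor_clinear_eqI[where G = "\<lambda>t. even_part (gl_apply (leibniz (even_part A) (even_part B)) t)"])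
      (simp_all add: clinear_comp clinear_even_part clinear_gl_apply gl_apply_leibniz even_part_add even_part_tensor
        gl_apply_add even_part_gl_even odd_part_gl_even)
  have 3: "even_part (gl_apply (leibniz (odd_part A) (odd_part B)) t) = gl_apply (leibniz (odd_part A) (odd_part B)) (odd_part t)" for t
    by (rule tensor_clinear_eqI[where G = "\<lambda>t. even_part (gl_apply (leibniz (odd_part A) (odd_part B)) t)"])
      (simp_all add: clinear_comp clinear_even_part clinear_odd_part clinear_gl_apply gl_apply_leibniz even_part_add even_part_tensor odd_part_tensor
        gl_apply_add even_part_gl_odd odd_part_gl_odd grade_inv_def even_part_diff odd_part_diff tensor_uminus tensor_diff_left)
  from gl_parts[OF 1 2 3] show "even_part (leibniz A B) = leibniz (even_part A) (even_part B)"
    "odd_part (leibniz A B) = leibniz (odd_part A) (odd_part B)" .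
qed

lemma dual_apply_even_part: "dual_apply (even_part f) v = dual_apply f (even_part v)"
  by transfer simp

lemma dual_apply_add: "dual_apply f (x + y) = dual_apply f x + dual_apply f y"
  and dual_apply_scale: "dual_apply f (c *\<^sub>C x) = c * dual_apply f x"
  and dual_apply_diff: "dual_apply f (x - y) = dual_apply f x - dual_apply f y"
  using clinear_add[OF clinear_dual_apply] clinear_scale[OF clinear_dual_apply] clinear_diff[OF clinear_dual_apply]
  by auto

lemma dual_apply_0 [simp]: "dual_apply f 0 = 0"
  using dual_apply_scale[of f 0 0] by simp

lemma dual_apply_odd_part: "dual_apply (odd_part f) v = dual_apply f (odd_part v)"
  by (simp add: odd_part_def dual_apply_even_part dual_apply_diff)

lemma dual_act_parts:
  "even_part (dual_act D) = dual_act (even_part D)" "odd_part (dual_act D) = dual_act (odd_part D)"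
proof -
  have 1: "dual_act D = dual_act (even_part D) + dual_act (odd_part D)"
    by (rule gl_eqI, rule dual_eqI) (simp add: gl_apply_plus gl_apply_dual_act)
  have 2: "even_part (gl_apply (dual_act (even_part D)) f) = gl_apply (dual_act (even_part D)) (even_part f)" for f
    by (rule dual_eqI) (simp add: gl_apply_dual_act dual_apply_even_part even_part_gl_even)
  have 3: "even_part (gl_apply (dual_act (odd_part D)) f) = gl_apply (dual_act (odd_part D)) (odd_part f)" for f
    by (rule dual_eqI) (simp add: gl_apply_dual_act dual_apply_even_part dual_apply_odd_part grade_inv_def 
        odd_part_gl_odd[symmetric] even_part_gl_odd[symmetric])
  from gl_parts[OF 1 2 3] show "even_part (dual_act D) = dual_act (even_part D)" "odd_part (dual_act D) = dual_act (odd_part D)" .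
qed

lemma idx_set_iff [simp]: "Unbarred i \<in> idx_set p q \<longleftrightarrow> i \<in> {1..p}" "Barred i \<in> idx_set p q \<longleftrightarrow> i \<in> {1..q}"
  by (auto simp: idx_set_def)

lemma subalgebra_hull: "subalgebra (subalgebra hull X)"
proof (rule hull_in)
  fix T :: "'a symalg set set" assume "Ball T subalgebra"
  then show "subalgebra (\<Inter> T)"
    by (auto simp: subalgebra_def intro: cvec.subspace_Inter)
qed

lemma sym_grade_inv_gen: "sym_grade_inv (sym_gen u) = sym_gen (grade_inv u)"
  by (simp add: sym_gen.abs_eq sym_grade_inv_abs free_inv_gen)

lemma sym_gen_uminus: "sym_gen (- u) = - sym_gen u"
  using clinear_diff[OF clinear_sym_gen, of 0 u] by simp

lemma sym_act_1: "sym_act D 1 = 0"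
proof -
  have 1: "(1 :: 'a symalg) = abs_symalg (Poly_Mapping.single (FWord []) 1)"
    by (simp add: abs_symalg_word sym_word_def)
  show ?thesis unfolding 1 sym_act_abs free_der_def by simp
qed

text \<open>The Leibniz rule \<open>sym_act_mult\<close> involves \<open>even_part D\<close> and
  \<open>odd_part D\<close> separately, so closure under products uses that \<open>L\<close>
  contains the homogeneous components of its elements.\<close>

lemma subalgebra_invariants:
  assumes "\<And>D. D \<in> L \<Longrightarrow> even_part D \<in> L \<and> odd_part D \<in> L"
  shows "subalgebra (invariants L :: ('v::superspace sdual, 'w::superspace) stensor symalg set)"
  unfolding subalgebra_def
proof (intro conjI ballI)
  show "cvec.subspace (invariants L :: ('v sdual, 'w) stensor symalg set)"
    by (auto simp: cvec.subspace_def invariants_def clinear_0[OF clinear_sym_act] clinear_add[OF clinear_sym_act]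
        clinear_scale[OF clinear_sym_act])
  show "(1 :: ('v sdual, 'w) stensor symalg) \<in> invariants L" by (simp add: invariants_def sym_act_1)
  fix a b :: "('v sdual, 'w) stensor symalg" assume "a \<in> invariants L" "b \<in> invariants L"
  then show "a * b \<in> invariants L"
    using assms by (auto simp: invariants_def sym_act_mult leibniz_parts dual_act_parts)
qed

lemma dual_basis_parity:
  assumes e: "homogeneous_basis I e" and e': "dual_basis I e e'" and i: "i \<in> I"
  shows "has_parity (idx_parity i) (e' i)"
proof -
  have eq: "f = g" if "\<And>j. j \<in> I \<Longrightarrow> dual_apply f (e j) = dual_apply g (e j)" for f g :: "'a sdual"
  proof (rule dual_eqI)
    fix v
    have "v \<in> cvec.span (e ` I)" using e by (simp add: homogeneous_basis_def)
    then show "dual_apply f v = dual_apply g v"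
      by (induction rule: cvec.span_induct_alt) (auto simp: dual_apply_add dual_apply_scale that clinear_0[OF clinear_dual_apply])
  qed
  have p: "even_part (e j) = (if odd (idx_parity j) then 0 else e j)" if "j \<in> I" for j
    using e that by (auto simp: homogeneous_basis_def has_parity_def)
  have "even_part (e' i) = (if odd (idx_parity i) then 0 else e' i)"
    by (rule eq) (use i e' in \<open>auto simp: dual_apply_even_part p dual_basis_def clinear_0[OF clinear_dual_apply]\<close>)
  then show ?thesis by (simp add: has_parity_def)
qed

text \<open>The invariant tensor is odd. Hence the even component of \<open>D\<close> sends it to an
  odd tensor and the odd component to an even one, and the sum of these vanishes only if both
  do.\<close>

lemma pe_graded:
  assumes e: "homogeneous_basis (idx_set n n) e" and e': "dual_basis (idx_set n n) e e'" and D: "D \<in> pe n e'"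
  shows "even_part D \<in> pe n e' \<and> odd_part D \<in> pe n e'"
proof -
  let ?L = "leibniz (dual_act D) (dual_act D)"
  let ?t = "pe_tensor n e'"
  have par: "even_part (e' (Unbarred i)) = e' (Unbarred i)" "even_part (e' (Barred i)) = 0" if "i \<in> {1..n}" for i
    using dual_basis_parity[OF e e', of "Unbarred i"] dual_basis_parity[OF e e', of "Barred i"] that
    by (auto simp: has_parity_def)
  have sum: "even_part (sum f A) = (\<Sum>i\<in>A. even_part (f i))" for f :: "nat \<Rightarrow> ('a sdual, 'a sdual) stensor" and A
    by (induction A rule: infinite_finite_induct) (simp_all add: even_part_add)
  have "even_part ?t = 0"
    unfolding pe_tensor_def sum by (intro sum.neutral ballI) (simp add: even_part_add even_part_tensor par odd_part_def)
  then have odd: "odd_part ?t = ?t" by (simp add: odd_part_def)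
  have 0: "gl_apply (even_part ?L) ?t + gl_apply (odd_part ?L) ?t = 0"
    using D by (simp add: pe_def flip: gl_apply_plus)
  have "even_part (gl_apply (even_part ?L) ?t) = 0"
    unfolding even_part_gl_even \<open>even_part ?t = 0\<close> by simp
  moreover have "even_part (gl_apply (odd_part ?L) ?t) = gl_apply (odd_part ?L) ?t"
    unfolding even_part_gl_odd odd ..
  ultimately have "gl_apply (odd_part ?L) ?t = 0"
    using arg_cong[OF 0, of even_part] by (simp add: even_part_add)
  with 0 show ?thesis by (simp add: pe_def leibniz_parts dual_act_parts)
qed

text \<open>The inner product is the image of \<open>pe_tensor\<close> under a linear map that
  intertwines the action of \<open>D\<close> on the tensor square with its action on the symmetric
  algebra.\<close>

lemma inner_product_invariant:
  fixes D :: "'v::superspace gl" and e' :: "idx \<Rightarrow> 'v sdual" and w :: "idx \<Rightarrow> 'w::superspace"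
  assumes w: "has_parity (idx_parity s) (w s)" and D: "D \<in> pe n e'"
    and e: "homogeneous_basis (idx_set n n) e" and e': "dual_basis (idx_set n n) e e'"
  shows "sym_act (leibniz (dual_act D) 0) (inner_product n e' w s t) = 0"
proof -
  \<comment> \<open>\<tau> carries the sign of moving \<open>w s\<close> past \<open>g\<close>. It
    is the origin of the factor (-1)^p(s) in the inner product.\<close>
  define \<tau> :: "'v sdual \<Rightarrow> 'v sdual" where "\<tau> g = (if odd (idx_parity s) then grade_inv g else g)" for g
  define F where "F f g = sym_gen (f \<otimes>\<^sub>s w s) * sym_gen (\<tau> g \<otimes>\<^sub>s w t)" for f g
  have bil: "bilin F"
    unfolding F_def
  proof (rule bilin_mult_comp)
    show "clinear (\<lambda>f. sym_gen (f \<otimes>\<^sub>s w s))"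
      by (rule clinearI) (simp_all add: tensor_add_left tensor_scale_left sym_gen_add sym_gen_scale)
    show "clinear (\<lambda>g. sym_gen (\<tau> g \<otimes>\<^sub>s w t))"
      by (rule clinearI)
        (simp_all add: \<tau>_def tensor_add_left tensor_scale_left sym_gen_add sym_gen_scale grade_inv_add grade_inv_scale)
  qed
  have gw: "grade_inv (w s) = (-1) ^ idx_parity s *\<^sub>C w s"
    by (rule grade_inv_parity[OF w])
  have act: "sym_act (leibniz (dual_act D) 0) (tensor_ext F T) = tensor_ext F (gl_apply (leibniz (dual_act D) (dual_act D)) T)" for T
  proof (rule tensor_clinear_eqI[where G = "\<lambda>T. sym_act (leibniz (dual_act D) 0) (tensor_ext F T)"])
    show "clinear (\<lambda>T. sym_act (leibniz (dual_act D) 0) (tensor_ext F T))"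
      by (rule clinear_comp[OF clinear_sym_act clinear_tensor_ext[OF bil]])
    show "clinear (\<lambda>T. tensor_ext F (gl_apply (leibniz (dual_act D) (dual_act D)) T))"
      by (rule clinear_comp[OF clinear_tensor_ext[OF bil] clinear_gl_apply])
    fix f g
    show "sym_act (leibniz (dual_act D) 0) (tensor_ext F (f \<otimes>\<^sub>s g)) = tensor_ext F (gl_apply (leibniz (dual_act D) (dual_act D)) (f \<otimes>\<^sub>s g))"
      unfolding tensor_ext_tensor[OF bil] gl_apply_leibniz clinear_add[OF clinear_tensor_ext[OF bil]]
      by (cases "odd (idx_parity s)")
        (simp_all add: F_def \<tau>_def sym_act_mult sym_act_gen gl_apply_leibniz leibniz_parts sym_grade_inv_gen grade_inv_tensor gw
          grade_inv_gl_even grade_inv_gl_odd tensor_uminus tensor_scale_right sym_gen_scale sym_cscale_mult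
          sym_gen_uminus)
  qed
  have par: "grade_inv (e' (Unbarred i)) = e' (Unbarred i)" "grade_inv (e' (Barred i)) = - e' (Barred i)" if "i \<in> {1..n}" for i
    using grade_inv_parity[OF dual_basis_parity[OF e e', of "Unbarred i"]] grade_inv_parity[OF dual_basis_parity[OF e e', of "Barred i"]] that
    by auto
  have sum: "tensor_ext F (sum f A) = (\<Sum>i\<in>A. tensor_ext F (f i))" for f :: "nat \<Rightarrow> _" and A
    by (induction A rule: infinite_finite_induct) (simp_all add: clinear_add[OF clinear_tensor_ext[OF bil]] clinear_0[OF clinear_tensor_ext[OF bil]])
  have "inner_product n e' w s t = tensor_ext F (pe_tensor n e')"
    unfolding inner_product_def pe_tensor_def sum
    by (rule sum.cong[OF refl], cases "odd (idx_parity s)")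
      (simp_all add: clinear_add[OF clinear_tensor_ext[OF bil]] tensor_ext_tensor[OF bil] F_def \<tau>_def par xstar_def tensor_uminus
         sym_gen_uminus)
  then have "sym_act (leibniz (dual_act D) 0) (inner_product n e' w s t) = tensor_ext F 0"
    using D act[of "pe_tensor n e'"] by (simp add: pe_def)
  then show ?thesis by (simp add: clinear_0[OF clinear_tensor_ext[OF bil]])
qed

section \<open>The super Weyl algebra\<close>

abbreviation "lookup \<equiv> Poly_Mapping.lookup"
abbreviation "keys \<equiv> Poly_Mapping.keys"
abbreviation "single \<equiv> Poly_Mapping.single"

type_synonym var = "idx \<times> idx"
type_synonym mono = "var \<Rightarrow> nat"
type_synonym fock = "mono \<Rightarrow>\<^sub>0 complex"

typedef linop = "{f :: fock \<Rightarrow> fock. clinear f}"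
  morphisms app Abs_linop
  by (rule exI[of _ "\<lambda>_. 0"]) (simp add: clinearI)

setup_lifting type_definition_linop

lemma clinear_app: "clinear (app P)"
  using app[of P] by simp

lemmas app_add = clinear_add[OF clinear_app]
  and app_scale = clinear_scale[OF clinear_app]
  and app_diff = clinear_diff[OF clinear_app]
  and app_0 [simp] = clinear_0[OF clinear_app]

instantiation linop :: "{ring_1, cvector}"
begin
lift_definition zero_linop :: linop is "\<lambda>_. 0" by (rule clinearI) simp_all
lift_definition one_linop :: linop is "\<lambda>f. f" by (rule clinearI) simp_all
lift_definition plus_linop :: "linop \<Rightarrow> linop \<Rightarrow> linop" is "\<lambda>f g x. f x + g x"
  by (rule clinearI) (simp_all add: clinear_add clinear_scale cscale_add_right)
lift_definition minus_linop :: "linop \<Rightarrow> linop \<Rightarrow> linop" is "\<lambda>f g x. f x - g x"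
  by (rule clinearI) (simp_all add: clinear_add clinear_scale cvec.scale_right_diff_distrib)
lift_definition uminus_linop :: "linop \<Rightarrow> linop" is "\<lambda>f x. - f x"
  by (rule clinearI) (simp_all add: clinear_add clinear_scale)
lift_definition times_linop :: "linop \<Rightarrow> linop \<Rightarrow> linop" is "\<lambda>f g x. f (g x)"
  by (rule clinearI) (simp_all add: clinear_add clinear_scale)
lift_definition cscale_linop :: "complex \<Rightarrow> linop \<Rightarrow> linop" is "\<lambda>c f x. c *\<^sub>C f x"
  by (rule clinearI) (simp_all add: clinear_add clinear_scale cscale_add_right mult.commute)
instance
proof
  show "(0 :: linop) \<noteq> 1"
  proof (transfer, rule notI)
    assume "(\<lambda>_. 0) = (\<lambda>f :: fock. f)"
    then have "(single (\<lambda>_. 0) 1 :: fock) = 0" by metis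
    then show False by (metis lookup_single_eq lookup_zero zero_neq_one)
  qed
qed (transfer; simp add: fun_eq_iff clinear_add clinear_scale algebra_simps cscale_add_right cscale_add_left)+
end

lemma app_simps [simp]:
  "app (P + Q) f = app P f + app Q f"
  "app (P - Q) f = app P f - app Q f"
  "app (- P) f = - app P f"
  "app (P * Q) f = app P (app Q f)"
  "app (c *\<^sub>C P) f = c *\<^sub>C app P f"
  "app 0 f = 0"
  "app 1 f = f"
  by (transfer; simp)+

lemma linop_eqI: "(\<And>\<alpha>. app P (single \<alpha> 1) = app Q (single \<alpha> 1)) \<Longrightarrow> P = Q"
  by (metis app_inject ext free_clinear_eqI clinear_app)

lemma app_sum: "app (sum P A) f = (\<Sum>x\<in>A. app (P x) f)"
  by (induction A rule: infinite_finite_induct) simp_all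

lemma app_sum_right: "app P (sum g A) = (\<Sum>x\<in>A. app P (g x))"
  by (induction A rule: infinite_finite_induct) (simp_all add: app_add)

lemma app_of_nat: "app (of_nat k) f = of_nat k *\<^sub>C f"
  by (induction k) (simp_all add: cscale_add_left)

lemma app_uminus_right: "app P (- f) = - app P f"
  using app_diff[of P 0 f] by simp

lemma linop_cscale_mult: "(c *\<^sub>C P) * Q = c *\<^sub>C (P * Q)" "P * (c *\<^sub>C Q) = c *\<^sub>C (P * Q)" for P Q :: linop
  by (transfer, simp add: fun_eq_iff clinear_scale)+

definition odv :: "var \<Rightarrow> bool"
  where "odv v \<longleftrightarrow> odd (idx_parity (fst v) + idx_parity (snd v))"

primrec idx_code :: "idx \<Rightarrow> nat"
  where "idx_code (Unbarred i) = 2 * i" | "idx_code (Barred i) = 2 * i + 1"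

lemma idx_code_inject: "idx_code i = idx_code j \<longleftrightarrow> i = j"
  by (cases i; cases j) (simp_all, presburger+)

text \<open>An order on the variables in which each has only finitely many predecessors, so that
  \<open>koszul_sign\<close> is a finite product.\<close>

definition key :: "var \<Rightarrow> nat"
  where "key v = prod_encode (idx_code (fst v), idx_code (snd v))"

lemma key_inject: "key a = key b \<longleftrightarrow> a = b"
  by (auto simp: key_def idx_code_inject prod_eq_iff)

lemma inj_key: "inj key"
  by (rule injI) (simp add: key_inject)

text \<open>The sign of moving an odd variable \<open>a\<close> past the smaller variables of a monomial.\<close>
definition koszul_sign :: "var \<Rightarrow> mono \<Rightarrow> complex"
  where "koszul_sign a \<alpha> = (if odv a then \<Prod>v | key v < key a \<and> odv v. (- 1) ^ \<alpha> v else 1)"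

lemma finite_below: "finite {v. key v < key a \<and> P v}"
proof (rule finite_subset)
  show "finite (key -` {..<key a})" by (intro finite_vimageI inj_key) simp
qed auto

lemma koszul_sign_sq [simp]: "koszul_sign a \<alpha> * koszul_sign a \<alpha> = 1"
  by (simp add: koszul_sign_def flip: prod.distrib power_mult_distrib)

lemma koszul_sign_nz [simp]: "koszul_sign a \<alpha> \<noteq> 0"
  using koszul_sign_sq[of a \<alpha>] by (metis mult_zero_left zero_neq_one)

lemma koszul_sign_upd: "koszul_sign a (\<alpha>(b := k)) =
  (if odv a \<and> odv b \<and> key b < key a \<and> odd (\<alpha> b + k) then - koszul_sign a \<alpha> else koszul_sign a \<alpha>)"
proof (cases "odv a \<and> odv b \<and> key b < key a")
  case True
  let ?B = "{v. key v < key a \<and> odv v}"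
  have B: "b \<in> ?B" "finite ?B" using True finite_below by auto
  have "(\<Prod>v\<in>?B - {b}. (- 1 :: complex) ^ (\<alpha>(b := k)) v) = (\<Prod>v\<in>?B - {b}. (- 1) ^ \<alpha> v)"
    by (rule prod.cong) auto
  moreover have "(- 1 :: complex) ^ k = (if odd (\<alpha> b + k) then - ((- 1) ^ \<alpha> b) else (- 1) ^ \<alpha> b)"
    by (cases "even k"; cases "even (\<alpha> b)") (simp_all add: uminus_power_if)
  ultimately show ?thesis
    using True unfolding koszul_sign_def by (simp add: prod.remove[OF B(2,1)])
next
  case False
  then have "(\<Prod>v | key v < key a \<and> odv v. (- 1 :: complex) ^ (\<alpha>(b := k)) v) = (\<Prod>v | key v < key a \<and> odv v. (- 1) ^ \<alpha> v)" if "odv a"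
    using that by (intro prod.cong) auto
  with False show ?thesis by (auto simp: koszul_sign_def)
qed

text \<open>
  Only the parity of the exponent of an odd variable matters here; this way the relations of the
  super Weyl algebra hold on all of \<open>fock\<close>, including the spurious monomials with odd exponents
  larger than 1.
\<close>
definition mul :: "var \<Rightarrow> linop"
  where "mul a = Abs_linop (lin_ext (\<lambda>\<alpha>. if odv a \<and> odd (\<alpha> a) then 0
    else koszul_sign a \<alpha> *\<^sub>C single (\<alpha>(a := Suc (\<alpha> a))) 1))"

definition der :: "var \<Rightarrow> linop"
  where "der a = Abs_linop (lin_ext (\<lambda>\<alpha>. (if odv a then of_bool (odd (\<alpha> a)) * koszul_sign a \<alpha> else of_nat (\<alpha> a))
    *\<^sub>C single (\<alpha>(a := \<alpha> a - 1)) 1))"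

lemma app_mul_single: "app (mul a) (single \<alpha> c) = (if odv a \<and> odd (\<alpha> a) then 0
    else single (\<alpha>(a := Suc (\<alpha> a))) (koszul_sign a \<alpha> * c))"
  by (simp add: mul_def Abs_linop_inverse clinear_lin_ext mult.commute)

lemma app_der_single: "app (der a) (single \<alpha> c) =
    single (\<alpha>(a := \<alpha> a - 1)) ((if odv a then of_bool (odd (\<alpha> a)) * koszul_sign a \<alpha> else of_nat (\<alpha> a)) * c)"
  by (simp add: der_def Abs_linop_inverse clinear_lin_ext mult.commute)

lemma mul_mul: "mul a * mul b = (if odv a \<and> odv b then - (mul b * mul a) else mul b * mul a)"
proof (rule linop_eqI)
  fix \<alpha> :: mono
  show "app (mul a * mul b) (single \<alpha> 1) = app (if odv a \<and> odv b then - (mul b * mul a) else mul b * mul a) (single \<alpha> 1)"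
  proof (cases "a = b")
    case False
    then have "key a < key b \<or> key b < key a" using key_inject[of a b] by linarith
    with False show ?thesis
      by (auto simp: app_mul_single koszul_sign_upd fun_upd_twist single_uminus[symmetric] mult.commute)
  qed (simp add: app_mul_single)
qed

lemma der_der: "der a * der b = (if odv a \<and> odv b then - (der b * der a) else der b * der a)"
proof (rule linop_eqI)
  fix \<alpha> :: mono
  show "app (der a * der b) (single \<alpha> 1) = app (if odv a \<and> odv b then - (der b * der a) else der b * der a) (single \<alpha> 1)"
  proof (cases "a = b")
    case False
    then have "key a < key b \<or> key b < key a" using key_inject[of a b] by linarith
    with False show ?thesis
      by (auto simp: app_der_single koszul_sign_upd fun_upd_twist single_uminus[symmetric] mult.commute)
  next
    case True then show ?thesis by (auto simp: app_der_single)
  qed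
qed

text \<open>For a = b odd this is the Clifford relation: on each monomial exactly one of
  \<open>der a * mul a\<close> and \<open>mul a * der a\<close> survives, depending on the parity of
  the exponent, and it acts as 1 because the Koszul sign enters twice.\<close>

lemma der_mul: "der a * mul b = (if odv a \<and> odv b then - (mul b * der a) else mul b * der a) + (if a = b then 1 else 0)"
proof (rule linop_eqI)
  fix \<alpha> :: mono
  show "app (der a * mul b) (single \<alpha> 1) = app ((if odv a \<and> odv b then - (mul b * der a) else mul b * der a) + (if a = b then 1 else 0)) (single \<alpha> 1)"
  proof (cases "a = b")
    case False
    then have "key a < key b \<or> key b < key a" using key_inject[of a b] by linarith
    with False show ?thesis
      by (auto simp: app_der_single app_mul_single koszul_sign_upd fun_upd_twist single_uminus[symmetric] mult.commute)
  next
    case True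
    have e: "\<not> odv b \<Longrightarrow> koszul_sign b \<alpha> = 1" by (simp add: koszul_sign_def)
    from True show ?thesis
    proof (cases "\<alpha> b")
      case 0
      then have "\<alpha>(b := 0) = \<alpha>" by auto
      with 0 True e show ?thesis
        by (auto simp: app_der_single app_mul_single koszul_sign_upd)
    next
      case (Suc k)
      then have "\<alpha>(b := Suc k) = \<alpha>" by auto
      with Suc True e show ?thesis
        by (auto simp: app_der_single app_mul_single koszul_sign_upd algebra_simps single_add[symmetric])
    qed
  qed
qed

lemma lookup_mul: "lookup (app (mul a) f) \<gamma> = (if \<gamma> a = 0 \<or> (odv a \<and> even (\<gamma> a)) then 0
    else koszul_sign a \<gamma> * lookup f (\<gamma>(a := \<gamma> a - 1)))"
proof -
  define L where "L f = (if \<gamma> a = 0 \<or> (odv a \<and> even (\<gamma> a)) then 0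
    else koszul_sign a \<gamma> * lookup f (\<gamma>(a := \<gamma> a - 1)))" for f :: fock
  have "(\<lambda>f. lookup (app (mul a) f) \<gamma>) f = L f"
  proof (rule free_clinear_eqI)
    show "clinear (\<lambda>f. lookup (app (mul a) f) \<gamma>)"
      by (rule clinearI) (simp_all add: app_add app_scale lookup_add lookup_cscale)
    show "clinear L" unfolding L_def
      by (rule clinearI) (simp_all add: lookup_add lookup_cscale algebra_simps)
    fix \<alpha>
    have "\<gamma> = \<alpha>(a := Suc (\<alpha> a)) \<longleftrightarrow> \<gamma> a \<noteq> 0 \<and> \<alpha> = \<gamma>(a := \<gamma> a - 1)"
      by (metis Suc_pred' diff_Suc_1 fun_upd_same fun_upd_triv fun_upd_upd nat.distinct(1) not_gr_zero)
    then show "lookup (app (mul a) (single \<alpha> 1)) \<gamma> = L (single \<alpha> 1)"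
      by (auto simp: L_def app_mul_single lookup_single when_def koszul_sign_upd)
  qed
  then show ?thesis by (simp add: L_def)
qed

lemma lookup_der: "lookup (app (der a) f) \<gamma> =
   (if odv a then of_bool (even (\<gamma> a)) * koszul_sign a \<gamma> else of_nat (Suc (\<gamma> a)))
     * lookup f (\<gamma>(a := Suc (\<gamma> a)))"
proof -
  define L where "L f = (if odv a then of_bool (even (\<gamma> a)) * koszul_sign a \<gamma> else of_nat (Suc (\<gamma> a)))
     * lookup f (\<gamma>(a := Suc (\<gamma> a)))" for f :: fock
  have "(\<lambda>f. lookup (app (der a) f) \<gamma>) f = L f"
  proof (rule free_clinear_eqI)
    show "clinear (\<lambda>f. lookup (app (der a) f) \<gamma>)"
      by (rule clinearI) (simp_all add: app_add app_scale lookup_add lookup_cscale)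
    show "clinear L" unfolding L_def
      by (rule clinearI) (simp_all add: lookup_add lookup_cscale algebra_simps)
    fix \<alpha> :: mono
    have "\<alpha> = \<gamma>(a := Suc (\<gamma> a)) \<longleftrightarrow> \<alpha> a \<noteq> 0 \<and> \<gamma> = \<alpha>(a := \<alpha> a - 1)"
      by (metis Suc_pred' diff_Suc_1 fun_upd_same fun_upd_triv fun_upd_upd nat.distinct(1) not_gr_zero)
    then show "lookup (app (der a) (single \<alpha> 1)) \<gamma> = L (single \<alpha> 1)"
      by (cases "\<alpha> a = 0") (auto simp: L_def app_der_single lookup_single when_def koszul_sign_upd)
  qed
  then show ?thesis by (simp add: L_def)
qed

section \<open>Inner products and polarizations\<close>

definition signed :: "bool \<Rightarrow> 'a::uminus \<Rightarrow> 'a"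
  where "signed b x = (if b then - x else x)"

text \<open>The operators \<open>mul a * der b\<close> span a copy of the general linear Lie
  superalgebra of the space of variables, and the two extra terms are its structure constants. Row
  and column operators inherit their commutators from here.\<close>

lemma mul_der_commute:
  "mul a * der b * (mul c * der d) = signed ((odv a \<noteq> odv b) \<and> (odv c \<noteq> odv d)) (mul c * der d * (mul a * der b))
    + (if b = c then mul a * der d else 0)
    - signed ((odv a \<noteq> odv b) \<and> (odv c \<noteq> odv d)) (if a = d then mul c * der b else 0)"
proof -
  define bc where "bc = (b = c)"
  define ad where "ad = (a = d)"
  have 1: "mul a * der b * (mul c * der d) = mul a * ((der b * mul c) * der d)"
    and 2: "mul c * der d * (mul a * der b) = mul c * ((der d * mul a) * der b)"
    by (simp_all add: mult.assoc)
  have der: "der b * mul c = signed (odv b \<and> odv c) (mul c * der b) + (if bc then 1 else 0)"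
    "der d * mul a = signed (odv d \<and> odv a) (mul a * der d) + (if ad then 1 else 0)"
    using der_mul[of b c] der_mul[of d a] by (auto simp: signed_def bc_def ad_def)
  have 3: "mul a * (mul c * X) = signed (odv a \<and> odv c) (mul c * (mul a * X))" for X
    using mul_mul[of a c] by (simp add: signed_def flip: mult.assoc)
  have 4: "mul c * (mul a * (der b * der d)) = signed (odv b \<and> odv d) (mul c * (mul a * (der d * der b)))"
    using der_der[of b d] by (simp add: signed_def)
  show ?thesis
    unfolding 1 2 der bc_def[symmetric] ad_def[symmetric]
    by (cases "odv a"; cases "odv b"; cases "odv c"; cases "odv d"; cases bc; cases ad)
      (simp_all add: distrib_left distrib_right left_diff_distrib right_diff_distrib signed_def mult.assoc 3 4)
qed

lemma mul_der_mul_mul: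
  "mul a * der b * (mul c * mul d) = signed ((odv a \<noteq> odv b) \<and> (odv c \<noteq> odv d)) (mul c * mul d * (mul a * der b))
    + (if b = c then mul a * mul d else 0)
    + signed ((odv a \<noteq> odv b) \<and> odv c) (if b = d then mul c * mul a else 0)"
proof -
  define bc where "bc = (b = c)"
  define bd where "bd = (b = d)"
  have der: "der b * mul c = signed (odv b \<and> odv c) (mul c * der b) + (if bc then 1 else 0)"
    "der b * mul d = signed (odv b \<and> odv d) (mul d * der b) + (if bd then 1 else 0)"
    using der_mul[of b c] der_mul[of b d] by (auto simp: signed_def bc_def bd_def)
  have "mul a * der b * (mul c * mul d) = mul a * ((der b * mul c) * mul d)"
    by (simp add: mult.assoc)
  also have "\<dots> = signed (odv b \<and> odv c) (mul a * mul c * (der b * mul d)) + (if bc then mul a * mul d else 0)"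
    unfolding der(1) by (cases bc) (simp_all add: distrib_left distrib_right left_diff_distrib right_diff_distrib signed_def mult.assoc)
  also have "\<dots> = signed ((odv b \<and> odv c) \<noteq> (odv b \<and> odv d)) (mul a * (mul c * mul d) * der b) + 
      signed (odv b \<and> odv c) (if bd then mul a * mul c else 0) + (if bc then mul a * mul d else 0)"
    unfolding der(2) by (cases bd; cases "odv b"; cases "odv c"; cases "odv d") (simp_all add: distrib_left distrib_right left_diff_distrib right_diff_distrib signed_def mult.assoc)
  also have "mul a * (mul c * mul d) = (mul a * mul c) * mul d" by (simp add: mult.assoc)
  also have "\<dots> = signed (odv a \<and> odv c) (mul c * (mul a * mul d))"
    unfolding mul_mul[of a c] by (simp add: signed_def mult.assoc)
  also have "\<dots> = signed ((odv a \<and> odv c) \<noteq> (odv a \<and> odv d)) (mul c * (mul d * mul a))"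
    unfolding mul_mul[of a d] by (auto simp add: signed_def mult.assoc)
  also have "mul a * mul c = signed (odv a \<and> odv c) (mul c * mul a)"
    unfolding mul_mul[of a c] by (simp add: signed_def)
  finally show ?thesis
    unfolding bc_def[symmetric] bd_def[symmetric]
    by (cases "odv a"; cases "odv b"; cases "odv c"; cases "odv d"; cases bc; cases bd)
      (simp_all add: signed_def mult.assoc)
qed

abbreviation U where "U \<equiv> Unbarred"
abbreviation B where "B \<equiv> Barred"

abbreviation oi :: "idx \<Rightarrow> bool" where "oi s \<equiv> odd (idx_parity s)"

lemma odv_iff: "odv (i, s) \<longleftrightarrow> oi i \<noteq> oi s"
  by (simp add: odv_def)

text \<open>The action of a matrix unit of gl(V), in the normalization of \<open>elem_gl\<close>;
  see \<open>matches_elem_gl\<close>.\<close>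

definition row_op :: "idx set \<Rightarrow> idx \<Rightarrow> idx \<Rightarrow> linop"
  where "row_op C i j = (\<Sum>s\<in>C. mul (i, s) * der (j, s))"

definition gram :: "nat \<Rightarrow> idx \<Rightarrow> idx \<Rightarrow> linop"
  where "gram n s t = (\<Sum>i=1..n. signed (oi s) (mul (U i, s) * mul (B i, t)) + mul (B i, s) * mul (U i, t))"

text \<open>The polarization of v_s into v_t, a matrix unit of gl(W). If its parity is odd, it
  acquires a sign in passing the row index, hence the minus on odd rows.\<close>

definition col_op :: "nat \<Rightarrow> idx \<Rightarrow> idx \<Rightarrow> linop"
  where "col_op n t s = (\<Sum>i=1..n. mul (U i, t) * der (U i, s) + signed (oi s \<noteq> oi t) (mul (B i, t) * der (B i, s)))"

text \<open>Generators of the periplectic Lie superalgebra, each with its parity.\<close>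
definition pe_ops :: "nat \<Rightarrow> idx set \<Rightarrow> (bool \<times> linop) set"
  where "pe_ops n C = (\<lambda>(i, j). (False, row_op C (U i) (U j) - row_op C (B j) (B i))) ` ({1..n} \<times> {1..n})
     \<union> (\<lambda>(i, j). (True, row_op C (U i) (B j) - row_op C (U j) (B i))) ` ({1..n} \<times> {1..n})
     \<union> (\<lambda>(i, j). (True, row_op C (B i) (U j) + row_op C (B j) (U i))) ` ({1..n} \<times> {1..n})"

definition pinv :: "nat \<Rightarrow> idx set \<Rightarrow> fock \<Rightarrow> bool"
  where "pinv n C f \<longleftrightarrow> (\<forall>(b, T)\<in>pe_ops n C. app T f = 0)"

lemma pinv_iff: "pinv n C f \<longleftrightarrow> (\<forall>i\<in>{1..n}. \<forall>j\<in>{1..n}.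
   app (row_op C (U i) (U j)) f = app (row_op C (B j) (B i)) f \<and>
   app (row_op C (U i) (B j)) f = app (row_op C (U j) (B i)) f \<and>
   app (row_op C (B i) (U j)) f = - app (row_op C (B j) (U i)) f)"
  unfolding pinv_def pe_ops_def
  by (simp add: ball_Un split_def eq_neg_iff_add_eq_0) blast

lemma signed_sum: "signed b (sum f A) = (\<Sum>x\<in>A. signed b (f x))" for f :: "'b \<Rightarrow> 'a::ab_group_add"
  by (simp add: signed_def sum_negf)

lemma signed_mult: "signed b x * y = signed b (x * y)" "x * signed b y = signed b (x * y)" for x y :: "'a::ring"
  by (simp_all add: signed_def)

lemma signed_signed [simp]: "signed a (signed b x) = signed (a \<noteq> b) x" for x :: "'a::group_add"
  by (simp add: signed_def)

lemma signed_add: "signed b (x + y) = signed b x + signed b y"  and signed_diff: "signed b (x - y) = signed b x - signed b y"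
  and signed_0 [simp]: "signed b 0 = (0 :: 'a)" and signed_False [simp]: "signed False x = x"
  and signed_True [simp]: "signed True x = - x"
  for x y :: "'a::ab_group_add"
  by (simp_all add: signed_def)

lemma signed_cong_sum: "signed b (if c then x else 0) = (if c then signed b x else 0)" for x :: "'a::group_add"
  by (simp add: signed_def)

lemma row_op_mul_mul:
  assumes "finite C" "s \<in> C" "t \<in> C"
  shows "row_op C k j * (mul (a, s) * mul (b, t)) =
    signed ((oi k \<noteq> oi j) \<and> (odv (a, s) \<noteq> odv (b, t))) (mul (a, s) * mul (b, t) * row_op C k j)
    + (if j = a then mul (k, s) * mul (b, t) else 0)
    + signed ((oi k \<noteq> oi j) \<and> odv (a, s)) (if j = b then mul (a, s) * mul (k, t) else 0)"
proof -
  have P: "(odv (k, c) \<noteq> odv (j, c)) = (oi k \<noteq> oi j)" for c by (auto simp: odv_iff)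
  have "row_op C k j * (mul (a, s) * mul (b, t)) = (\<Sum>c\<in>C. mul (k, c) * der (j, c) * (mul (a, s) * mul (b, t)))"
    by (simp add: row_op_def sum_distrib_right)
  also have "\<dots> = (\<Sum>c\<in>C. signed ((oi k \<noteq> oi j) \<and> (odv (a, s) \<noteq> odv (b, t))) (mul (a, s) * mul (b, t) * (mul (k, c) * der (j, c)))
     + (if c = s then (if j = a then mul (k, s) * mul (b, t) else 0) else 0)
     + (if c = t then signed ((oi k \<noteq> oi j) \<and> odv (a, s)) (if j = b then mul (a, s) * mul (k, t) else 0) else 0))"
    unfolding mul_der_mul_mul P by (intro sum.cong refl arg_cong2[of _ _ _ _ "(+)"]) (auto simp: signed_def)
  also have "\<dots> = signed ((oi k \<noteq> oi j) \<and> (odv (a, s) \<noteq> odv (b, t))) (mul (a, s) * mul (b, t) * row_op C k j)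
    + (if j = a then mul (k, s) * mul (b, t) else 0)
    + signed ((oi k \<noteq> oi j) \<and> odv (a, s)) (if j = b then mul (a, s) * mul (k, t) else 0)"
    using assms by (simp add: sum.distrib row_op_def sum_distrib_left flip: signed_sum)
  finally show ?thesis .
qed

lemma oddG: "odv (U i, s) \<noteq> odv (B i, t) \<longleftrightarrow> oi s = oi t" "odv (B i, s) \<noteq> odv (U i, t) \<longleftrightarrow> oi s = oi t"
  by (auto simp: odv_iff)

lemma row_op_gram:
  assumes "finite C" "s \<in> C" "t \<in> C"
  shows "row_op C k j * gram n s t = signed ((oi k \<noteq> oi j) \<and> oi s = oi t) (gram n s t * row_op C k j)
    + (\<Sum>i=1..n. (if j = U i then signed (oi s) (mul (k, s) * mul (B i, t)) 
                     + signed ((oi k \<noteq> oi j) \<and> odv (B i, s)) (mul (B i, s) * mul (k, t)) else 0)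
              + (if j = B i then mul (k, s) * mul (U i, t)
                     + signed (oi s \<noteq> ((oi k \<noteq> oi j) \<and> odv (U i, s))) (mul (U i, s) * mul (k, t)) else 0))"
    (is "_ = ?L + ?gram_span")
proof -
  have "row_op C k j * gram n s t = (\<Sum>i=1..n. signed (oi s) (row_op C k j * (mul (U i, s) * mul (B i, t))) + row_op C k j * (mul (B i, s) * mul (U i, t)))"
    by (simp add: gram_def sum_distrib_left distrib_left signed_mult)
  also have "\<dots> = ?L + ?gram_span"
    unfolding row_op_mul_mul[OF assms] oddG
    by (auto simp add: gram_def sum_distrib_left sum_distrib_right signed_mult signed_sum signed_add sum.distrib[symmetric] distrib_right signed_cong_sum intro!: sum.cong) (auto simp: signed_def)
  finally show ?thesis .
qed

text \<open>Infinitesimal invariance of the form: a single \<open>row_op\<close> leaves the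
  correction terms of \<open>row_op_gram\<close>, and the two halves of each generator are paired so
  that these cancel. The sign treats \<open>gram n s t\<close> as an operator of parity 1 + p(s) +
  p(t).\<close>

lemma pe_ops_gram:
  assumes "finite C" "s \<in> C" "t \<in> C" "(b, T) \<in> pe_ops n C"
  shows "T * gram n s t = signed (b \<and> oi s = oi t) (gram n s t * T)"
proof -
  have d: "(\<Sum>i=1..n. if (j::nat) = i then f i else 0) = f j" if "j \<in> {1..n}" for j and f :: "nat \<Rightarrow> linop"
    using that by (simp add: sum.delta')
  from assms(4) show ?thesis unfolding pe_ops_def
  proof (elim UnE imageE, goal_cases)
    case (1 x)
    then show ?thesis
      by (auto simp: row_op_gram[OF assms(1-3)] left_diff_distrib right_diff_distrib d signed_def)
  next
    case (2 x)
    then show ?thesis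
      by (auto simp: row_op_gram[OF assms(1-3)] left_diff_distrib right_diff_distrib d signed_def odv_iff)
  next
    case (3 x)
    then show ?thesis
      by (auto simp: row_op_gram[OF assms(1-3)] distrib_left distrib_right d signed_def odv_iff)
  qed
qed

lemma mul_der_mul_der_col_op:
  assumes "finite C" "s \<in> C" "t \<in> C"
  shows "row_op C k j * (mul (i, t) * der (i, s)) =
     signed ((oi k \<noteq> oi j) \<and> (oi s \<noteq> oi t)) (mul (i, t) * der (i, s) * row_op C k j)
     + (if i = j then mul (k, t) * der (i, s) else 0)
     - signed ((oi k \<noteq> oi j) \<and> (oi s \<noteq> oi t)) (if i = k then mul (k, t) * der (j, s) else 0)"
proof -
  have P: "(odv (k, c) \<noteq> odv (j, c)) = (oi k \<noteq> oi j)" "odv (i, t) \<noteq> odv (i, s) \<longleftrightarrow> oi s \<noteq> oi t" for c by (auto simp: odv_iff)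
  have "row_op C k j * (mul (i, t) * der (i, s)) = (\<Sum>c\<in>C. mul (k, c) * der (j, c) * (mul (i, t) * der (i, s)))"
    by (simp add: row_op_def sum_distrib_right)
  also have "\<dots> = (\<Sum>c\<in>C. signed ((oi k \<noteq> oi j) \<and> (oi s \<noteq> oi t)) (mul (i, t) * der (i, s) * (mul (k, c) * der (j, c)))
     + (if c = t then if i = j then mul (k, t) * der (i, s) else 0 else 0)
     - (if c = s then signed ((oi k \<noteq> oi j) \<and> (oi s \<noteq> oi t)) (if i = k then mul (k, t) * der (j, s) else 0) else 0))"
    by (rule sum.cong[OF refl], subst mul_der_commute, unfold P,
        intro arg_cong2[of _ _ _ _ "(-)"] arg_cong2[of _ _ _ _ "(+)"]) (auto simp: signed_def)
  also have "\<dots> = signed ((oi k \<noteq> oi j) \<and> (oi s \<noteq> oi t)) (mul (i, t) * der (i, s) * row_op C k j)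
     + (if i = j then mul (k, t) * der (i, s) else 0)
     - signed ((oi k \<noteq> oi j) \<and> (oi s \<noteq> oi t)) (if i = k then mul (k, t) * der (j, s) else 0)"
    using assms by (simp add: sum.distrib sum_subtractf row_op_def sum_distrib_left flip: signed_sum)
  finally show ?thesis .
qed

lemma sum_delta_idx:
  fixes f :: "idx \<Rightarrow> 'a::comm_monoid_add"
  assumes "k \<in> idx_set n n"
  shows "(\<Sum>i=1..n. (if U i = k then f (U i) else 0) + (if B i = k then f (B i) else 0)) = f k"
  using assms by (cases k) (auto simp: idx_set_def)

text \<open>gl(V) and gl(W) act on different tensor factors, so they supercommute. In the
  computation the contraction at i = j and the one at i = k leave the same term with opposite
  signs.\<close>

lemma row_op_col_op:
  assumes "finite C" "s \<in> C" "t \<in> C" "k \<in> idx_set n n" "j \<in> idx_set n n"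
  shows "row_op C k j * col_op n t s = signed ((oi k \<noteq> oi j) \<and> (oi s \<noteq> oi t)) (col_op n t s * row_op C k j)"
proof -
  define e where "e i = (oi s \<noteq> oi t \<and> oi i)" for i
  have col_op: "col_op n t s = (\<Sum>i=1..n. signed (e (U i)) (mul (U i, t) * der (U i, s)) + signed (e (B i)) (mul (B i, t) * der (B i, s)))"
    by (simp add: col_op_def e_def)
  define x where "x i = (if i = j then mul (k, t) * der (i, s) else 0)
     - signed ((oi k \<noteq> oi j) \<and> (oi s \<noteq> oi t)) (if i = k then mul (k, t) * der (j, s) else 0)" for i
  have x: "row_op C k j * (mul (i, t) * der (i, s)) = signed ((oi k \<noteq> oi j) \<and> (oi s \<noteq> oi t)) (mul (i, t) * der (i, s) * row_op C k j) + x i" for i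
    unfolding x_def using mul_der_mul_der_col_op[OF assms(1-3), of k j i] by (simp add: algebra_simps)
  have "(\<Sum>i=1..n. signed (e (U i)) (x (U i)) + signed (e (B i)) (x (B i))) = 
    (\<Sum>i=1..n. (if U i = j then signed (e (U i)) (mul (k, t) * der (U i, s)) else 0) + (if B i = j then signed (e (B i)) (mul (k, t) * der (B i, s)) else 0))
   - (\<Sum>i=1..n. (if U i = k then signed (e (U i)) (signed ((oi k \<noteq> oi j) \<and> (oi s \<noteq> oi t)) (mul (k, t) * der (j, s))) else 0) 
        + (if B i = k then signed (e (B i)) (signed ((oi k \<noteq> oi j) \<and> (oi s \<noteq> oi t)) (mul (k, t) * der (j, s))) else 0))"
    unfolding sum_subtractf[symmetric] x_def
    by (intro sum.cong refl) (auto simp: signed_def)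
  also have "\<dots> = 0"
    unfolding sum_delta_idx[OF assms(5), of "\<lambda>i. signed (e i) (mul (k, t) * der (i, s))"]
      sum_delta_idx[OF assms(4), of "\<lambda>i. signed (e i) (signed ((oi k \<noteq> oi j) \<and> (oi s \<noteq> oi t)) (mul (k, t) * der (j, s)))"]
    by (auto simp: e_def signed_def)
  finally have "(\<Sum>i=1..n. signed (e (U i)) (x (U i)) + signed (e (B i)) (x (B i))) = 0" .
  moreover have "row_op C k j * col_op n t s = (\<Sum>i=1..n. signed (e (U i)) (row_op C k j * (mul (U i, t) * der (U i, s))) + signed (e (B i)) (row_op C k j * (mul (B i, t) * der (B i, s))))"
    unfolding col_op by (simp add: sum_distrib_left distrib_left signed_mult)
  moreover have "\<dots> = signed ((oi k \<noteq> oi j) \<and> (oi s \<noteq> oi t)) (col_op n t s * row_op C k j) + (\<Sum>i=1..n. signed (e (U i)) (x (U i)) + signed (e (B i)) (x (B i)))"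
    unfolding col_op x sum_distrib_right signed_sum sum.distrib[symmetric]
    by (rule sum.cong[OF refl], simp add: distrib_right signed_mult signed_add) (auto simp: signed_def)
  ultimately show ?thesis by simp
qed

lemma app_signed: "app (signed b P) f = signed b (app P f)"
  by (simp add: signed_def)

lemma pe_ops_col_op:
  assumes "finite C" "s \<in> C" "t \<in> C" "(b, T) \<in> pe_ops n C"
  shows "T * col_op n t s = signed (b \<and> oi s \<noteq> oi t) (col_op n t s * T)"
  using assms(4) unfolding pe_ops_def
  by (auto simp: row_op_col_op[OF assms(1-3)] left_diff_distrib right_diff_distrib distrib_left distrib_right signed_def)

lemma pinv_col_op:
  assumes "finite C" "s \<in> C" "t \<in> C" "pinv n C f"
  shows "pinv n C (app (col_op n t s) f)"
proof -
  have "app T (app (col_op n t s) f) = 0" if "(b, T) \<in> pe_ops n C" for b T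
  proof -
    have "app T f = 0" using that assms(4) by (auto simp: pinv_def)
    then show ?thesis
      using arg_cong[OF pe_ops_col_op[OF assms(1-3) that], of "\<lambda>P. app P f"] by (simp add: app_signed)
  qed
  then show ?thesis by (auto simp: pinv_def)
qed

lemma pinv_gram:
  assumes "finite C" "s \<in> C" "t \<in> C" "pinv n C f"
  shows "pinv n C (app (gram n s t) f)"
proof -
  have "app T (app (gram n s t) f) = 0" if "(b, T) \<in> pe_ops n C" for b T
  proof -
    have "app T f = 0" using that assms(4) by (auto simp: pinv_def)
    then show ?thesis
      using arg_cong[OF pe_ops_gram[OF assms(1-3) that], of "\<lambda>P. app P f"] by (simp add: app_signed)
  qed
  then show ?thesis by (auto simp: pinv_def)
qed

lemma pinv_add: "pinv n C f \<Longrightarrow> pinv n C g \<Longrightarrow> pinv n C (f + g)"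
  and pinv_scale: "pinv n C f \<Longrightarrow> pinv n C (c *\<^sub>C f)"
  and pinv_diff: "pinv n C f \<Longrightarrow> pinv n C g \<Longrightarrow> pinv n C (f - g)"
  by (fastforce simp: pinv_def app_add app_scale app_diff)+

section \<open>The span of the products of inner products\<close>

definition vac :: fock
  where "vac = single (\<lambda>_. 0) 1"

lemma der_vac [simp]: "app (der a) vac = 0"
  by (simp add: vac_def app_der_single)

lemma row_op_vac [simp]: "app (row_op C i j) vac = 0"
  by (simp add: row_op_def app_sum)

lemma col_op_vac [simp]: "app (col_op n s t) vac = 0"
  by (simp add: col_op_def app_sum app_signed)

lemma pinv_vac: "pinv n C vac"
  by (simp add: pinv_iff)

text \<open>The counterpart among superpolynomials of the subalgebra generated by the inner
  products; \<open>Psi_gram\<close> makes the correspondence precise.\<close>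

inductive_set gram_span :: "nat \<Rightarrow> idx set \<Rightarrow> fock set" for n C
  where gram_span_vac: "vac \<in> gram_span n C"
  | gram_span_add: "f \<in> gram_span n C \<Longrightarrow> g \<in> gram_span n C \<Longrightarrow> f + g \<in> gram_span n C"
  | gram_span_scale: "f \<in> gram_span n C \<Longrightarrow> c *\<^sub>C f \<in> gram_span n C"
  | gram_span_gram: "f \<in> gram_span n C \<Longrightarrow> s \<in> C \<Longrightarrow> t \<in> C \<Longrightarrow> app (gram n s t) f \<in> gram_span n C"

lemma gram_span_0: "0 \<in> gram_span n C"
  using gram_span_scale[OF gram_span_vac, of 0] by simp

lemma gram_span_uminus: "f \<in> gram_span n C \<Longrightarrow> - f \<in> gram_span n C"
  using gram_span_scale[of f n C "-1"] by simp

lemma gram_span_signed: "f \<in> gram_span n C \<Longrightarrow> signed b f \<in> gram_span n C"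
  by (simp add: signed_def gram_span_uminus)

lemma gram_span_sum: "(\<And>x. x \<in> A \<Longrightarrow> g x \<in> gram_span n C) \<Longrightarrow> sum g A \<in> gram_span n C"
  by (induction A rule: infinite_finite_induct) (auto intro: gram_span_0 gram_span_add)

lemma gram_span_pinv: "f \<in> gram_span n C \<Longrightarrow> finite C \<Longrightarrow> pinv n C f"
  by (induction rule: gram_span.induct) (auto intro: pinv_vac pinv_add pinv_scale pinv_gram)

lemma gram_span_mono: "f \<in> gram_span n C \<Longrightarrow> C \<subseteq> C' \<Longrightarrow> f \<in> gram_span n C'"
  by (induction rule: gram_span.induct) (auto intro: gram_span.intros)

text \<open>A polarization is a superderivation that replaces v_s by v_t in either slot of the form.
  Consequently \<open>gram_span\<close> is stable under gl(W) and one can argue modulo it.\<close>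

lemma col_op_gram:
  "col_op n t s * gram n u v = signed (oi s \<noteq> oi t \<and> oi u = oi v) (gram n u v * col_op n t s)
    + (if s = u then signed (oi s \<noteq> oi t) (gram n t v) else 0)
    + (if s = v then signed (oi s \<noteq> oi t \<and> \<not> oi u) (gram n u t) else 0)"
proof -
  define e where "e = (oi s \<noteq> oi t)"
  have P: "odv (U i, t) \<noteq> odv (U i, s) \<longleftrightarrow> e" "odv (B i, t) \<noteq> odv (B i, s) \<longleftrightarrow> e" for i
    by (auto simp: e_def odv_iff)
  have inner: "(\<Sum>j=1..n. (mul (U j, t) * der (U j, s) + signed e (mul (B j, t) * der (B j, s))) * 
       (signed (oi u) (mul (U i, u) * mul (B i, v)) + mul (B i, u) * mul (U i, v)))
    = signed (e \<and> oi u = oi v) ((signed (oi u) (mul (U i, u) * mul (B i, v)) + mul (B i, u) * mul (U i, v)) * col_op n t s)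
     + (if s = u then signed (oi u) (mul (U i, t) * mul (B i, v)) + signed e (mul (B i, t) * mul (U i, v)) else 0)
     + (if s = v then signed (oi u \<noteq> (e \<noteq> (e \<and> oi u))) (mul (U i, u) * mul (B i, t)) + signed (e \<and> \<not> oi u) (mul (B i, u) * mul (U i, t)) else 0)"
    if "i \<in> {1..n}" for i
  proof -
    have "(\<Sum>j=1..n. (mul (U j, t) * der (U j, s) + signed e (mul (B j, t) * der (B j, s))) * 
       (signed (oi u) (mul (U i, u) * mul (B i, v)) + mul (B i, u) * mul (U i, v)))
      = (\<Sum>j=1..n. signed (e \<and> oi u = oi v) ((signed (oi u) (mul (U i, u) * mul (B i, v)) + mul (B i, u) * mul (U i, v)) * 
            (mul (U j, t) * der (U j, s) + signed e (mul (B j, t) * der (B j, s))))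
          + (if j = i then (if s = u then signed (oi u) (mul (U i, t) * mul (B i, v)) + signed e (mul (B i, t) * mul (U i, v)) else 0)
     + (if s = v then signed (oi u \<noteq> (e \<noteq> (e \<and> oi u))) (mul (U i, u) * mul (B i, t)) + signed (e \<and> \<not> oi u) (mul (B i, u) * mul (U i, t)) else 0) else 0))"
      by (intro sum.cong refl, unfold distrib_left distrib_right signed_mult mul_der_mul_mul P oddG)
        (auto simp: signed_add signed_diff odv_iff, auto simp: signed_def)
    also have "\<dots> = signed (e \<and> oi u = oi v) ((signed (oi u) (mul (U i, u) * mul (B i, v)) + mul (B i, u) * mul (U i, v)) * col_op n t s)
     + (if s = u then signed (oi u) (mul (U i, t) * mul (B i, v)) + signed e (mul (B i, t) * mul (U i, v)) else 0)
     + (if s = v then signed (oi u \<noteq> (e \<noteq> (e \<and> oi u))) (mul (U i, u) * mul (B i, t)) + signed (e \<and> \<not> oi u) (mul (B i, u) * mul (U i, t)) else 0)"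
      using that by (simp add: sum.distrib signed_sum[symmetric] col_op_def sum_distrib_left[symmetric] e_def add.assoc)
    finally show ?thesis .
  qed
  have "col_op n t s * gram n u v = (\<Sum>i=1..n. (\<Sum>j=1..n. (mul (U j, t) * der (U j, s) + signed e (mul (B j, t) * der (B j, s))) * 
       (signed (oi u) (mul (U i, u) * mul (B i, v)) + mul (B i, u) * mul (U i, v))))"
    unfolding col_op_def gram_def e_def[symmetric] sum_product by (rule sum.swap)
  also have "\<dots> = (\<Sum>i=1..n. signed (e \<and> oi u = oi v) ((signed (oi u) (mul (U i, u) * mul (B i, v)) + mul (B i, u) * mul (U i, v)) * col_op n t s)
     + (if s = u then signed (oi u) (mul (U i, t) * mul (B i, v)) + signed e (mul (B i, t) * mul (U i, v)) else 0)
     + (if s = v then signed (oi u \<noteq> (e \<noteq> (e \<and> oi u))) (mul (U i, u) * mul (B i, t)) + signed (e \<and> \<not> oi u) (mul (B i, u) * mul (U i, t)) else 0))"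
    by (rule sum.cong[OF refl inner])
  also have "\<dots> = signed (e \<and> oi u = oi v) (gram n u v * col_op n t s)
    + (if s = u then signed e (gram n t v) else 0)
    + (if s = v then signed (e \<and> \<not> oi u) (gram n u t) else 0)"
  proof -
    have 1: "(\<Sum>i=1..n. signed p (g i * col_op n t s)) = signed p ((\<Sum>i=1..n. g i) * col_op n t s)" for p g
      by (simp add: sum_distrib_right signed_sum)
    have 2: "(\<Sum>i=1..n. if c then g i else 0) = (if c then sum g {1..n} else 0)" for c and g :: "nat \<Rightarrow> linop"
      by simp
    show ?thesis
      unfolding sum.distrib[of "\<lambda>i. _ i + (if _ then _ i else 0)"] sum.distrib[of "\<lambda>i. signed _ (_ i * col_op n t s)"] 1 2
      by (intro arg_cong2[of _ _ _ _ "(+)"]) (auto simp: gram_def signed_sum signed_add e_def intro!: sum.cong, auto simp: signed_def)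
  qed
  finally show ?thesis by (simp add: e_def)
qed

lemma gram_span_col_op:
  assumes "f \<in> gram_span n C" "s \<in> C" "t \<in> C"
  shows "app (col_op n t s) f \<in> gram_span n C"
  using assms(1)
proof induction
  case (gram_span_gram f u v)
  have "app (col_op n t s) (app (gram n u v) f) = app (col_op n t s * gram n u v) f" by simp
  also have "\<dots> = signed (oi s \<noteq> oi t \<and> oi u = oi v) (app (gram n u v) (app (col_op n t s) f))
    + (if s = u then signed (oi s \<noteq> oi t) (app (gram n t v) f) else 0)
    + (if s = v then signed (oi s \<noteq> oi t \<and> \<not> oi u) (app (gram n u t) f) else 0)"
    unfolding col_op_gram by (simp add: app_signed)
  also have "\<dots> \<in> gram_span n C"
    using gram_span_gram assms by (intro gram_span.gram_span_add gram_span_signed) (auto intro!: gram_span.gram_span_gram gram_span_signed gram_span_0)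
  finally show ?case .
qed (auto simp: app_add app_scale intro: gram_span_0 gram_span.gram_span_add gram_span.gram_span_scale)

section \<open>The characteristic identity\<close>

lemma der_der_mul_der:
  "der c * der d * (mul a * der b) = signed ((odv a \<noteq> odv b) \<and> (odv c \<noteq> odv d)) (mul a * der b * (der c * der d))
    + (if d = a then der c * der b else 0)
    + signed (odv a \<and> odv d) (if c = a then der d * der b else 0)"
proof -
  define da where "da = (d = a)"
  define ca where "ca = (c = a)"
  have DZ: "der d * mul a = signed (odv a \<and> odv d) (mul a * der d) + (if da then 1 else 0)"
    "der c * mul a = signed (odv a \<and> odv c) (mul a * der c) + (if ca then 1 else 0)"
    using der_mul[of d a] der_mul[of c a] by (auto simp: signed_def da_def ca_def)
  have "der c * der d * (mul a * der b) = der c * ((der d * mul a) * der b)"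
    by (simp add: mult.assoc)
  also have "\<dots> = signed (odv a \<and> odv d) ((der c * mul a) * (der d * der b)) + (if da then der c * der b else 0)"
    unfolding DZ(1) by (cases da) (simp_all add: distrib_left distrib_right signed_def mult.assoc)
  also have "\<dots> = signed ((odv a \<and> odv d) \<noteq> (odv a \<and> odv c)) (mul a * (der c * der d * der b))
     + signed (odv a \<and> odv d) (if ca then der d * der b else 0) + (if da then der c * der b else 0)"
    unfolding DZ(2)
    by (cases ca; cases "odv a"; cases "odv c"; cases "odv d")
      (simp_all add: distrib_left distrib_right left_diff_distrib right_diff_distrib signed_def mult.assoc)
  also have "der c * der d * der b = signed ((odv d \<and> odv b) \<noteq> (odv c \<and> odv b)) (der b * (der c * der d))"
  proof -
    have "der c * der d * der b = signed (odv d \<and> odv b) (der c * der b * der d)"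
      using der_der[of d b] by (auto simp: mult.assoc signed_def)
    also have "der c * der b = signed (odv c \<and> odv b) (der b * der c)"
      using der_der[of c b] by (auto simp: signed_def)
    finally show ?thesis by (auto simp: signed_def mult.assoc)
  qed
  finally show ?thesis
    unfolding da_def[symmetric] ca_def[symmetric]
    by (cases "odv a"; cases "odv b"; cases "odv c"; cases "odv d"; cases da; cases ca)
      (simp_all add: signed_def mult.assoc)
qed

text \<open>The counterpart of \<open>gram\<close> with derivatives in place of variables, for even
  columns. Derivatives transform like vectors of V instead of V*, where the invariant tensor is
  antisymmetric; hence the minus sign where \<open>gram\<close> has a plus.\<close>

definition lap :: "nat \<Rightarrow> nat \<Rightarrow> nat \<Rightarrow> linop"
  where "lap n s t = (\<Sum>i=1..n. der (U i, U s) * der (B i, U t) - der (U i, U t) * der (B i, U s))"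

lemma der_der_row_op:
  assumes "finite C" "s \<in> C" "t \<in> C"
  shows "der (a, s) * der (b, t) * row_op C k j =
    signed ((oi k \<noteq> oi j) \<and> (odv (a, s) \<noteq> odv (b, t))) (row_op C k j * (der (a, s) * der (b, t)))
    + (if b = k then der (a, s) * der (j, t) else 0)
    + signed (odv (a, s) \<and> odv (b, t)) (if a = k then der (b, t) * der (j, s) else 0)"
proof -
  have P: "(odv (k, c) \<noteq> odv (j, c)) = (oi k \<noteq> oi j)" for c by (auto simp: odv_iff)
  have "der (a, s) * der (b, t) * row_op C k j = (\<Sum>c\<in>C. der (a, s) * der (b, t) * (mul (k, c) * der (j, c)))"
    by (simp add: row_op_def sum_distrib_left)
  also have "\<dots> = (\<Sum>c\<in>C. signed ((oi k \<noteq> oi j) \<and> (odv (a, s) \<noteq> odv (b, t))) (mul (k, c) * der (j, c) * (der (a, s) * der (b, t)))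
     + (if c = t then (if b = k then der (a, s) * der (j, t) else 0) else 0)
     + (if c = s then signed (odv (a, s) \<and> odv (b, t)) (if a = k then der (b, t) * der (j, s) else 0) else 0))"
    unfolding der_der_mul_der P by (intro sum.cong refl arg_cong2[of _ _ _ _ "(+)"]) (auto simp: signed_def)
  also have "\<dots> = signed ((oi k \<noteq> oi j) \<and> (odv (a, s) \<noteq> odv (b, t))) (row_op C k j * (der (a, s) * der (b, t)))
    + (if b = k then der (a, s) * der (j, t) else 0)
    + signed (odv (a, s) \<and> odv (b, t)) (if a = k then der (b, t) * der (j, s) else 0)"
    using assms by (simp add: sum.distrib row_op_def sum_distrib_right flip: signed_sum)
  finally show ?thesis .
qed

lemma lap_row_op:
  assumes "finite C" "U s \<in> C" "U t \<in> C"
  shows "lap n s t * row_op C k j = signed (oi k \<noteq> oi j) (row_op C k j * lap n s t)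
    + (\<Sum>i=1..n. (if k = B i then der (U i, U s) * der (j, U t) - der (U i, U t) * der (j, U s) else 0)
              + (if k = U i then der (B i, U t) * der (j, U s) - der (B i, U s) * der (j, U t) else 0))"
    (is "_ = ?lap + ?gram_span")
proof -
  have "lap n s t * row_op C k j = (\<Sum>i=1..n. der (U i, U s) * der (B i, U t) * row_op C k j - der (U i, U t) * der (B i, U s) * row_op C k j)"
    by (simp add: lap_def sum_distrib_right left_diff_distrib)
  also have "\<dots> = ?lap + ?gram_span"
    unfolding der_der_row_op[OF assms] der_der_row_op[OF assms(1,3,2)]
      lap_def sum_distrib_left signed_sum sum.distrib[symmetric]
    by (rule sum.cong[OF refl]) (auto simp: odv_iff signed_def algebra_simps)
  finally show ?thesis .
qed

text \<open>The same cancellation as for \<open>gram\<close>, with the leftover terms matched by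
  supercommuting the two derivatives. It makes \<open>lap\<close> a source of invariants of lower
  degree.\<close>

lemma pe_ops_lap:
  assumes "finite C" "U s \<in> C" "U t \<in> C" "(b, T) \<in> pe_ops n C"
  shows "lap n s t * T = signed b (T * lap n s t)"
proof -
  have d: "(\<Sum>i=1..n. if (j::nat) = i then f i else 0) = f j" if "j \<in> {1..n}" for j and f :: "nat \<Rightarrow> linop"
    using that by (simp add: sum.delta')
  have DD: "der (B i, U a) * der (U j, U b) = der (U j, U b) * der (B i, U a)"
     "der (U i, U a) * der (U j, U b) = der (U j, U b) * der (U i, U a)"
     "der (B i, U a) * der (B j, U b) = - (der (B j, U b) * der (B i, U a))" for i j a b
    using der_der[of "(B i, U a)" "(U j, U b)"] der_der[of "(U i, U a)" "(U j, U b)"] der_der[of "(B i, U a)" "(B j, U b)"]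
    by (simp_all add: odv_iff)
  from assms(4) show ?thesis unfolding pe_ops_def
  proof (elim UnE imageE, goal_cases)
    case (1 x)
    then show ?thesis
      by (auto simp: lap_row_op[OF assms(1-3)] left_diff_distrib right_diff_distrib d DD(1))
  next
    case (2 x)
    then show ?thesis
      using DD(1)[of _ t _ s] DD(1)[of _ s _ t]
      by (auto simp: lap_row_op[OF assms(1-3)] left_diff_distrib right_diff_distrib d)
        (use DD(3)[of "fst x" t "snd x" s]  DD(3)[of "fst x" s "snd x" t] in \<open>simp add: algebra_simps\<close>)
  next
    case (3 x)
    then show ?thesis
      by (auto simp: lap_row_op[OF assms(1-3)] distrib_left distrib_right d)
        (use DD(2)[of "fst x" s "snd x" t]  DD(2)[of "fst x" t "snd x" s] in \<open>simp add: algebra_simps\<close>)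
  qed
qed

lemma pinv_lap:
  assumes "finite C" "U s \<in> C" "U t \<in> C" "pinv n C f"
  shows "pinv n C (app (lap n s t) f)"
proof -
  have "app T (app (lap n s t) f) = 0" if "(b, T) \<in> pe_ops n C" for b T
  proof -
    have "app T f = 0" using that assms(4) by (auto simp: pinv_def)
    then show ?thesis
      using arg_cong[OF pe_ops_lap[OF assms(1-3) that], of "\<lambda>P. app P f"] by (simp add: app_signed signed_def split: if_splits)
  qed
  then show ?thesis by (auto simp: pinv_def)
qed

lemma sum_rot3: "(\<Sum>u\<in>S. \<Sum>i\<in>I. \<Sum>j\<in>J. f u i j) = (\<Sum>i\<in>I. \<Sum>j\<in>J. \<Sum>u\<in>S. f u i j)"
  by (subst sum.swap) (auto intro!: sum.cong sum.swap)

context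
  fixes n N :: nat
begin

private abbreviation "x i s \<equiv> mul (U i, U s)"
private abbreviation "y i s \<equiv> mul (B i, U s)"
private abbreviation "p i s \<equiv> der (U i, U s)"
private abbreviation "h i s \<equiv> der (B i, U s)"
private abbreviation "C \<equiv> U ` {1..N}"
private abbreviation "Px s t \<equiv> \<Sum>i=1..n. x i s * p i t"
private abbreviation "Py s t \<equiv> \<Sum>i=1..n. y i s * h i t"

private lemma row_op_C: "row_op C i j = (\<Sum>u=1..N. mul (i, U u) * der (j, U u))"
  unfolding row_op_def by (subst sum.reindex) (auto simp: inj_on_def)

private lemma col_op_elem_gl: "col_op n (U s) (U t) = Px s t + Py s t"
  by (simp add: col_op_def sum.distrib)

private lemma rels:
  "h j t * y i u = (if i = j \<and> t = u then 1 else 0) - y i u * h j t"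
  "p j t * x i u = (if i = j \<and> t = u then 1 else 0) + x i u * p j t"
  "p j t * y i u = y i u * p j t"
  "h j t * x i u = x i u * h j t"
  "p j t * p i u = p i u * p j t"
  "p j t * h i u = h i u * p j t"
  "x j t * x i u = x i u * x j t"
  "x j t * y i u = y i u * x j t"
  "y j t * y i u = - (y i u * y j t)"
  "h j t * h i u = - (h i u * h j t)"
  using der_mul[of "(B j, U t)" "(B i, U u)"] der_mul[of "(U j, U t)" "(U i, U u)"]
    der_mul[of "(U j, U t)" "(B i, U u)"] der_mul[of "(B j, U t)" "(U i, U u)"]
    der_der[of "(U j, U t)" "(U i, U u)"] der_der[of "(U j, U t)" "(B i, U u)"]
    mul_mul[of "(U j, U t)" "(U i, U u)"] mul_mul[of "(U j, U t)" "(B i, U u)"]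
    mul_mul[of "(B j, U t)" "(B i, U u)"] der_der[of "(B j, U t)" "(B i, U u)"]
  by (auto simp: odv_iff)

private lemma EE: "(\<Sum>u=1..N. (\<Sum>i=1..n. a i u) * (\<Sum>j=1..n. b j u))
   = (\<Sum>i=1..n. \<Sum>j=1..n. \<Sum>u=1..N. a i u * b j u)" for a b :: "nat \<Rightarrow> nat \<Rightarrow> linop"
  unfolding sum_product by (rule sum_rot3)

text \<open>The two factors with column u are brought together, so that the sum over u becomes a
  \<open>row_op\<close>, to which the equations of invariance apply. The term
  \<open>Px s t + Py s t\<close> is left by moving \<open>h j t\<close> past \<open>y i u\<close>
  and \<open>x i u\<close> past \<open>p j t\<close>, for i = j and u = t.\<close>

private lemma GL:
  assumes "t \<in> {1..N}"
  shows "(\<Sum>u=1..N. gram n (U s) (U u) * lap n u t) =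
     (\<Sum>i=1..n. \<Sum>j=1..n. y i s * h j t * row_op C (U i) (U j) - x i s * h j t * row_op C (B i) (U j)
        - x i s * p j t * row_op C (B i) (B j) - y i s * p j t * row_op C (U i) (B j)) + (Px s t + Py s t)"
proof -
  have tm: "(x i s * y i u + y i s * x i u) * (p j u * h j t - p j t * h j u) =
     (y i s * h j t * (x i u * p j u) - x i s * h j t * (y i u * p j u)
     - x i s * p j t * (y i u * h j u) - y i s * p j t * (x i u * h j u))
     + (if i = j then if u = t then x i s * p j t + y i s * h j t else 0 else 0)" for i j u
  proof -
    have "x i s * y i u * (p j u * h j t) = (if i = j \<and> t = u then x i s * p j u else 0) - x i s * h j t * (y i u * p j u)"
    proof -
      have "x i s * y i u * (p j u * h j t) = x i s * (y i u * h j t) * p j u"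
        by (simp add: mult.assoc rels(6))
      also have "y i u * h j t = (if i = j \<and> t = u then 1 else 0) - h j t * y i u"
        by (simp add: rels(1))
      finally show ?thesis by (simp add: right_diff_distrib left_diff_distrib mult.assoc)
    qed
    moreover have "x i s * y i u * (p j t * h j u) = x i s * p j t * (y i u * h j u)"
      by (simp add: mult.assoc rels(3) flip: mult.assoc[of "p _ _" "y _ _"])
    moreover have "y i s * x i u * (p j u * h j t) = y i s * h j t * (x i u * p j u)"
      by (simp add: mult.assoc rels(6) rels(4) flip: mult.assoc[of "h _ _" "x _ _"])
    moreover have "y i s * x i u * (p j t * h j u) = y i s * p j t * (x i u * h j u) - (if i = j \<and> t = u then y i s * h j u else 0)"
    proof -
      have "y i s * x i u * (p j t * h j u) = y i s * (x i u * p j t) * h j u"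
        by (simp add: mult.assoc)
      also have "x i u * p j t = p j t * x i u - (if i = j \<and> t = u then 1 else 0)"
        by (simp add: rels(2))
      finally show ?thesis by (simp add: right_diff_distrib left_diff_distrib mult.assoc)
    qed
    ultimately show ?thesis
      by (auto simp: distrib_right right_diff_distrib)
  qed
  have "(\<Sum>u=1..N. gram n (U s) (U u) * lap n u t) = (\<Sum>u=1..N. (\<Sum>i=1..n. x i s * y i u + y i s * x i u) * (\<Sum>j=1..n. p j u * h j t - p j t * h j u))"
    by (simp add: gram_def lap_def)
  also have "\<dots> = (\<Sum>i=1..n. \<Sum>j=1..n. \<Sum>u=1..N. 
     (y i s * h j t * (x i u * p j u) - x i s * h j t * (y i u * p j u)
     - x i s * p j t * (y i u * h j u) - y i s * p j t * (x i u * h j u))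
     + (if i = j then if u = t then x i s * p j t + y i s * h j t else 0 else 0))"
    unfolding EE tm ..
  also have "\<dots> = (\<Sum>i=1..n. \<Sum>j=1..n. y i s * h j t * row_op C (U i) (U j) - x i s * h j t * row_op C (B i) (U j)
        - x i s * p j t * row_op C (B i) (B j) - y i s * p j t * row_op C (U i) (B j)) 
    + (\<Sum>i=1..n. \<Sum>j=1..n. if i = j then x i s * p j t + y i s * h j t else 0)"
    unfolding row_op_C sum_distrib_left sum.distrib[symmetric] sum_subtractf[symmetric]
  proof (intro sum.cong refl, goal_cases)
    case (1 i j)
    have "(\<Sum>u=1..N. if i = j then if u = t then x i s * p j t + y i s * h j t else 0 else 0)
       = (if i = j then x i s * p j t + y i s * h j t else 0)"
      using assms by simp
    then show ?case by (simp add: sum.distrib sum_subtractf)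
  qed
  also have "(\<Sum>i=1..n. \<Sum>j=1..n. if i = j then x i s * p j t + y i s * h j t else 0) = Px s t + Py s t"
    by (simp add: sum.distrib)
  finally show ?thesis .
qed

text \<open>This and the next three lemmas turn the sums back into products of polarizations after
  invariance has exchanged the rows. The contraction at u = t leaves a row index free and yields the
  factor n; in \<open>S2\<close> and \<open>S3\<close> the contraction at i = j leaves a column
  index free and yields N.\<close>

private lemma S1:
  assumes "t \<in> {1..N}"
  shows "(\<Sum>i=1..n. \<Sum>j=1..n. x i s * h j t * row_op C (B j) (U i)) = of_nat n * Px s t - (\<Sum>u=1..N. Px s u * Py u t)"
proof -
  have tm: "x i s * h j t * (y j u * p i u) = (if u = t then x i s * p i t else 0) - x i s * p i u * (y j u * h j t)" for i j u
  proof -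
    have "x i s * h j t * (y j u * p i u) = x i s * (h j t * y j u) * p i u" by (simp add: mult.assoc)
    also have "\<dots> = (if u = t then x i s * p i t else 0) - x i s * (y j u * h j t * p i u)"
      unfolding rels(1) by (auto simp: right_diff_distrib left_diff_distrib mult.assoc)
    also have "y j u * h j t * p i u = p i u * (y j u * h j t)"
      by (simp add: rels(3) rels(6)[symmetric] mult.assoc flip: mult.assoc[of "p _ _"])
    finally show ?thesis by (simp add: mult.assoc)
  qed
  show ?thesis
    using assms unfolding EE unfolding row_op_C sum_distrib_left tm
    by (simp add: sum_subtractf sum_distrib_left if_distrib[of "(*) _"] cong: if_cong)
qed

private lemma S2:
  assumes "t \<in> {1..N}"
  shows "(\<Sum>i=1..n. \<Sum>j=1..n. x i s * p j t * row_op C (U j) (U i)) = 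
     of_nat n * Px s t - of_nat N * Px s t + (\<Sum>u=1..N. Px s u * Px u t)"
proof -
  have tm: "x i s * p j t * (x j u * p i u) = (if u = t then x i s * p i t else 0) 
     + x i s * p i u * (x j u * p j t) - (if i = j then x i s * p j t else 0)" for i j u
  proof -
    have "x i s * p j t * (x j u * p i u) = x i s * (p j t * x j u) * p i u" by (simp add: mult.assoc)
    also have "\<dots> = (if u = t then x i s * p i t else 0) + x i s * (x j u * p j t * p i u)"
      unfolding rels(2) by (auto simp: distrib_left distrib_right mult.assoc)
    also have "x j u * p j t * p i u = p i u * (x j u * p j t) - (if i = j then p j t else 0)"
    proof -
      have "x j u * p j t * p i u = (x j u * p i u) * p j t"
        using rels(5)[of j t i u] by (simp add: mult.assoc)
      also have "x j u * p i u = p i u * x j u - (if i = j then 1 else 0)"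
        using rels(2)[of i u j u] by auto
      finally show ?thesis by (simp add: left_diff_distrib mult.assoc)
    qed
    finally show ?thesis by (auto simp add: mult.assoc left_diff_distrib right_diff_distrib)
  qed
  show ?thesis
    using assms unfolding EE unfolding row_op_C sum_distrib_left tm
    by (simp add: sum_subtractf sum.distrib sum_distrib_left if_distrib[of "(*) _"] cong: if_cong)
qed

private lemma S3:
  assumes "t \<in> {1..N}"
  shows "(\<Sum>i=1..n. \<Sum>j=1..n. y i s * h j t * row_op C (B j) (B i)) = 
     of_nat n * Py s t + of_nat N * Py s t - (\<Sum>u=1..N. Py s u * Py u t)"
proof -
  have tm: "y i s * h j t * (y j u * h i u) = (if u = t then y i s * h i t else 0) 
     - y i s * h i u * (y j u * h j t) + (if i = j then y i s * h j t else 0)" for i j u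
  proof -
    have "y i s * h j t * (y j u * h i u) = y i s * (h j t * y j u) * h i u" by (simp add: mult.assoc)
    also have "\<dots> = (if u = t then y i s * h i t else 0) - y i s * (y j u * (h j t * h i u))"
      unfolding rels(1) by (auto simp: left_diff_distrib right_diff_distrib mult.assoc)
    also have "y j u * (h j t * h i u) = h i u * (y j u * h j t) - (if i = j then h j t else 0)"
    proof -
      have "y j u * (h j t * h i u) = - ((y j u * h i u) * h j t)"
        using rels(10)[of j t i u] by (simp add: mult.assoc)
      also have "y j u * h i u = (if i = j then 1 else 0) - h i u * y j u"
        using rels(1)[of i u j u] by auto
      finally show ?thesis by (simp add: left_diff_distrib mult.assoc)
    qed
    finally show ?thesis by (auto simp add: mult.assoc left_diff_distrib right_diff_distrib)
  qed
  show ?thesis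
    using assms unfolding EE unfolding row_op_C sum_distrib_left tm
    by (simp add: sum_subtractf sum.distrib sum_distrib_left if_distrib[of "(*) _"] cong: if_cong)
qed

private lemma S4:
  assumes "t \<in> {1..N}"
  shows "(\<Sum>i=1..n. \<Sum>j=1..n. y i s * p j t * row_op C (U j) (B i)) = of_nat n * Py s t + (\<Sum>u=1..N. Py s u * Px u t)"
proof -
  have tm: "y i s * p j t * (x j u * h i u) = (if u = t then y i s * h i t else 0) + y i s * h i u * (x j u * p j t)" for i j u
  proof -
    have "y i s * p j t * (x j u * h i u) = y i s * (p j t * x j u) * h i u" by (simp add: mult.assoc)
    also have "\<dots> = (if u = t then y i s * h i t else 0) + y i s * (x j u * p j t * h i u)"
      unfolding rels(2) by (auto simp: distrib_left distrib_right mult.assoc)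
    also have "x j u * p j t * h i u = h i u * (x j u * p j t)"
      by (simp add: rels(4) rels(6) mult.assoc flip: mult.assoc[of "h _ _"])
    finally show ?thesis by (simp add: mult.assoc)
  qed
  show ?thesis
    using assms unfolding EE unfolding row_op_C sum_distrib_left tm
    by (simp add: sum.distrib sum_distrib_left if_distrib[of "(*) _"] cong: if_cong)
qed

text \<open>
  An analogue of the Capelli identity. The last sum has lower-degree invariants \<open>lap n u t f\<close> as
  cofactors, so it is negligible in an induction on the degree.
\<close>
lemma characteristic_identity:
  assumes f: "pinv n C f" and t: "t \<in> {1..N}"
  shows "(\<Sum>u=1..N. app (col_op n (U s) (U u)) (app (col_op n (U u) (U t)) f)) =
     of_nat (N + 1) *\<^sub>C app (col_op n (U s) (U t)) f - (\<Sum>u=1..N. app (gram n (U s) (U u)) (app (lap n u t) f))"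
proof -
  have "(\<Sum>u=1..N. app (gram n (U s) (U u)) (app (lap n u t) f)) = app (\<Sum>u=1..N. gram n (U s) (U u) * lap n u t) f"
    by (simp add: app_sum)
  also have "\<dots> = (\<Sum>i=1..n. \<Sum>j=1..n. app (y i s * h j t) (app (row_op C (U i) (U j)) f) - app (x i s * h j t) (app (row_op C (B i) (U j)) f)
        - app (x i s * p j t) (app (row_op C (B i) (B j)) f) - app (y i s * p j t) (app (row_op C (U i) (B j)) f)) + app (Px s t + Py s t) f"
    unfolding GL[OF t] by (simp add: app_sum)
  \<comment> \<open>Invariance of \<open>f\<close> enters here: each row operator is traded for the
    other half of its generator in \<open>pe_ops\<close>.\<close>
  also have "\<dots> = (\<Sum>i=1..n. \<Sum>j=1..n. app (y i s * h j t) (app (row_op C (B j) (B i)) f) + app (x i s * h j t) (app (row_op C (B j) (U i)) f)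
        - app (x i s * p j t) (app (row_op C (U j) (U i)) f) - app (y i s * p j t) (app (row_op C (U j) (B i)) f)) + app (Px s t + Py s t) f"
  proof (intro arg_cong2[of _ _ _ _ "(+)"] sum.cong refl, goal_cases)
    case (1 i j)
    with f have "app (row_op C (U i) (U j)) f = app (row_op C (B j) (B i)) f" "app (row_op C (U j) (U i)) f = app (row_op C (B i) (B j)) f"
      "app (row_op C (U i) (B j)) f = app (row_op C (U j) (B i)) f" "app (row_op C (B i) (U j)) f = - app (row_op C (B j) (U i)) f"
      unfolding pinv_iff by blast+
    then show ?case by (simp add: app_uminus_right)
  qed
  also have "\<dots> = app ((\<Sum>i=1..n. \<Sum>j=1..n. y i s * h j t * row_op C (B j) (B i)) + (\<Sum>i=1..n. \<Sum>j=1..n. x i s * h j t * row_op C (B j) (U i))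
     - (\<Sum>i=1..n. \<Sum>j=1..n. x i s * p j t * row_op C (U j) (U i)) - (\<Sum>i=1..n. \<Sum>j=1..n. y i s * p j t * row_op C (U j) (B i)) + (Px s t + Py s t)) f"
    by (simp add: app_sum sum.distrib sum_subtractf)
  \<comment> \<open>The multiples of n cancel between \<open>S1\<close> and \<open>S2\<close> and
    between \<open>S3\<close> and \<open>S4\<close>. What remains is N from \<open>S2\<close> and
    \<open>S3\<close>, and 1 from \<open>GL\<close>.\<close>
  also have "\<dots> = app (of_nat (N + 1) * (Px s t + Py s t) - (\<Sum>u=1..N. (Px s u + Py s u) * (Px u t + Py u t))) f"
    unfolding S1[OF t] S2[OF t] S3[OF t] S4[OF t]
    by (rule arg_cong[of _ _ "\<lambda>P. app P f"]) (simp add: distrib_left distrib_right sum.distrib algebra_simps)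
  finally show ?thesis
    unfolding col_op_elem_gl[symmetric] by (simp add: app_sum app_of_nat cscale_add_left)
qed

end

section \<open>Weights\<close>

definition legal :: "nat \<Rightarrow> mono \<Rightarrow> bool"
  where "legal n \<alpha> \<longleftrightarrow> (\<forall>v. odv v \<longrightarrow> \<alpha> v \<le> 1) \<and> (\<forall>v. fst v \<notin> idx_set n n \<longrightarrow> \<alpha> v = 0)"

definition col :: "nat \<Rightarrow> mono \<Rightarrow> idx \<Rightarrow> nat"
  where "col n \<alpha> s = (\<Sum>i\<in>idx_set n n. \<alpha> (i, s))"

text \<open>Legality is part of the notion because \<open>mul a * der a\<close> does not return the
  exponent of an odd variable once it exceeds 1, so that \<open>col_op_diag\<close> would fail. The
  zero vector has every weight.\<close>

definition has_wt :: "nat \<Rightarrow> (idx \<Rightarrow> nat) \<Rightarrow> fock \<Rightarrow> bool"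
  where "has_wt n \<mu> f \<longleftrightarrow> (\<forall>\<alpha>\<in>keys f. legal n \<alpha> \<and> col n \<alpha> = \<mu>)"

definition inc :: "idx \<Rightarrow> (idx \<Rightarrow> nat) \<Rightarrow> idx \<Rightarrow> nat" where "inc s \<mu> = \<mu>(s := Suc (\<mu> s))"
text \<open>At \<open>\<mu> s = 0\<close> the truncated subtraction does no harm: the derivative is
  then zero by \<open>der_wt_0\<close>, and zero has every weight.\<close>

definition dec :: "idx \<Rightarrow> (idx \<Rightarrow> nat) \<Rightarrow> idx \<Rightarrow> nat" where "dec s \<mu> = \<mu>(s := \<mu> s - 1)"

lemma finite_idx_set [simp]: "finite (idx_set p q)"
  by (simp add: idx_set_def)

lemma sum_idx_set: "(\<Sum>i\<in>idx_set p q. f i) = (\<Sum>i=1..p. f (U i)) + (\<Sum>i=1..q. f (B i))"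
  unfolding idx_set_def
  by (subst sum.union_disjoint) (auto simp: sum.reindex inj_on_def)

lemma col_upd:
  assumes "i \<in> idx_set n n"
  shows "col n (\<alpha>((i, s) := k)) = (col n \<alpha>)(s := col n \<alpha> s - \<alpha> (i, s) + k)"
proof
  fix t
  show "col n (\<alpha>((i, s) := k)) t = ((col n \<alpha>)(s := col n \<alpha> s - \<alpha> (i, s) + k)) t"
  proof (cases "t = s")
    case True
    have "(\<Sum>j\<in>idx_set n n - {i}. (\<alpha>((i, s) := k)) (j, s)) = (\<Sum>j\<in>idx_set n n - {i}. \<alpha> (j, s))"
      by (rule sum.cong) auto
    with True assms show ?thesis
      by (simp add: col_def sum.remove[of "idx_set n n" i])
  qed (simp add: col_def)
qed

lemma col_ge: "i \<in> idx_set n n \<Longrightarrow> \<alpha> (i, s) \<le> col n \<alpha> s"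
  unfolding col_def by (rule member_le_sum) auto

lemma keys_mul:
  assumes "\<gamma> \<in> keys (app (mul a) f)"
  shows "\<gamma> a > 0" "odv a \<longrightarrow> odd (\<gamma> a)" "\<gamma>(a := \<gamma> a - 1) \<in> keys f"
  using assms by (auto simp: in_keys_iff lookup_mul split: if_splits)

lemma keys_der:
  assumes "\<gamma> \<in> keys (app (der a) f)"
  shows "odv a \<longrightarrow> even (\<gamma> a)" "\<gamma>(a := Suc (\<gamma> a)) \<in> keys f"
  using assms by (auto simp: in_keys_iff lookup_der split: if_splits)

lemma legal_upd: "legal n \<alpha> \<Longrightarrow> (fst v \<notin> idx_set n n \<longrightarrow> k = 0) \<Longrightarrow> (odv v \<longrightarrow> k \<le> 1) \<Longrightarrow> legal n (\<alpha>(v := k))"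
  by (auto simp: legal_def)

lemma legal_of_upd:
  assumes "legal n (\<alpha>(v := k))" "fst v \<notin> idx_set n n \<longrightarrow> \<alpha> v = 0" "odv v \<longrightarrow> \<alpha> v \<le> 1"
  shows "legal n \<alpha>"
  using legal_upd[OF assms] by simp

lemma wt_mul:
  assumes "has_wt n \<mu> f" "i \<in> idx_set n n"
  shows "has_wt n (inc s \<mu>) (app (mul (i, s)) f)"
  unfolding has_wt_def
proof
  fix \<gamma> assume "\<gamma> \<in> keys (app (mul (i, s)) f)"
  note k = keys_mul[OF this]
  let ?\<alpha> = "\<gamma>((i, s) := \<gamma> (i, s) - 1)"
  have \<alpha>: "legal n ?\<alpha>" "col n ?\<alpha> = \<mu>" using assms(1) k(3) by (auto simp: has_wt_def)
  have "odv (i, s) \<longrightarrow> \<gamma> (i, s) \<le> 1"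
  proof
    assume "odv (i, s)"
    then have "?\<alpha> (i, s) \<le> 1" using \<alpha>(1) unfolding legal_def by blast
    then have "\<gamma> (i, s) \<le> 2" by simp
    moreover have "odd (\<gamma> (i, s))" using k(2) \<open>odv (i, s)\<close> by blast
    then have "\<gamma> (i, s) \<noteq> 2" by (metis even_numeral)
    ultimately show "\<gamma> (i, s) \<le> 1" by linarith
  qed
  moreover have "col n \<gamma> = inc s \<mu>"
    using col_ge[OF assms(2), of \<gamma> s] k(1)
    by (simp add: col_upd[OF assms(2)] inc_def fun_eq_iff flip: \<alpha>(2))
  ultimately show "legal n \<gamma> \<and> col n \<gamma> = inc s \<mu>"
    using legal_of_upd[OF \<alpha>(1)] assms(2) by simp
qed

lemma wt_der:
  assumes "has_wt n \<mu> f" "i \<in> idx_set n n"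
  shows "has_wt n (dec s \<mu>) (app (der (i, s)) f)"
  unfolding has_wt_def
proof
  fix \<gamma> assume "\<gamma> \<in> keys (app (der (i, s)) f)"
  note k = keys_der[OF this]
  let ?\<alpha> = "\<gamma>((i, s) := Suc (\<gamma> (i, s)))"
  have \<alpha>: "legal n ?\<alpha>" "col n ?\<alpha> = \<mu>" using assms(1) k(2) by (auto simp: has_wt_def)
  have "odv (i, s) \<longrightarrow> \<gamma> (i, s) \<le> 1"
    using \<alpha>(1) unfolding legal_def by (metis Suc_leD fun_upd_same)
  moreover have "col n \<gamma> = dec s \<mu>"
    using col_ge[OF assms(2), of \<gamma> s]
    by (simp add: col_upd[OF assms(2)] dec_def fun_eq_iff flip: \<alpha>(2))
  ultimately show "legal n \<gamma> \<and> col n \<gamma> = dec s \<mu>"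
    using legal_of_upd[OF \<alpha>(1)] assms(2) by simp
qed

lemma wt_0 [simp]: "has_wt n \<mu> 0"
  by (simp add: has_wt_def)

lemma wt_add: "has_wt n \<mu> f \<Longrightarrow> has_wt n \<mu> g \<Longrightarrow> has_wt n \<mu> (f + g)"
  using Poly_Mapping.keys_add[of f g] by (auto simp: has_wt_def)

lemma wt_scale: "has_wt n \<mu> f \<Longrightarrow> has_wt n \<mu> (c *\<^sub>C f)"
  by (auto simp: has_wt_def in_keys_iff lookup_cscale)

lemma wt_uminus: "has_wt n \<mu> f \<Longrightarrow> has_wt n \<mu> (- f)"
  by (auto simp: has_wt_def in_keys_iff)

lemma wt_diff: "has_wt n \<mu> f \<Longrightarrow> has_wt n \<mu> g \<Longrightarrow> has_wt n \<mu> (f - g)"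
  using wt_add[OF _ wt_uminus, of n \<mu> f g] by simp

lemma wt_signed: "has_wt n \<mu> f \<Longrightarrow> has_wt n \<mu> (signed b f)"
  by (simp add: signed_def wt_uminus)

lemma wt_sum: "(\<And>x. x \<in> A \<Longrightarrow> has_wt n \<mu> (g x)) \<Longrightarrow> has_wt n \<mu> (sum g A)"
  by (induction A rule: infinite_finite_induct) (auto intro: wt_add)

lemma wt_col_op:
  assumes "has_wt n \<mu> f"
  shows "has_wt n (inc t (dec s \<mu>)) (app (col_op n t s) f)"
  unfolding col_op_def by (auto simp: app_sum app_signed intro!: wt_sum wt_add wt_signed wt_mul wt_der assms)

lemma wt_gram:
  assumes "has_wt n \<mu> f"
  shows "has_wt n (inc s (inc t \<mu>)) (app (gram n s t) f)"
  unfolding gram_def by (auto simp: app_sum app_signed intro!: wt_sum wt_add wt_signed wt_mul assms)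

lemma dec_commute: "dec s (dec t \<mu>) = dec t (dec s \<mu>)"
  by (auto simp: dec_def fun_eq_iff)

lemma wt_lap:
  assumes "has_wt n \<mu> f"
  shows "has_wt n (dec (U s) (dec (U t) \<mu>)) (app (lap n s t) f)"
proof -
  have "has_wt n (dec (U s) (dec (U t) \<mu>)) (app (der (U i, U s) * der (B i, U t)) f)"
    "has_wt n (dec (U s) (dec (U t) \<mu>)) (app (der (U i, U t) * der (B i, U s)) f)" if "i \<in> {1..n}" for i
    using that assms by (auto intro!: wt_der) (subst dec_commute, auto intro!: wt_der)
  then show ?thesis
    unfolding lap_def by (auto simp: app_sum intro!: wt_sum wt_diff)
qed

lemma der_wt_0:
  assumes "has_wt n \<mu> f" "\<mu> s = 0" "i \<in> idx_set n n"
  shows "app (der (i, s)) f = 0"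
proof (rule poly_mapping_eqI)
  fix \<gamma>
  have "\<gamma>((i, s) := Suc (\<gamma> (i, s))) \<notin> keys f"
    using col_ge[OF assms(3), of "\<gamma>((i, s) := Suc (\<gamma> (i, s)))" s] assms(1,2)
    unfolding has_wt_def by fastforce
  then show "lookup (app (der (i, s)) f) \<gamma> = lookup 0 \<gamma>"
    by (simp add: lookup_der in_keys_iff)
qed

lemma col_op_wt_0:
  assumes "has_wt n \<mu> f" "\<mu> s = 0"
  shows "app (col_op n t s) f = 0"
  using der_wt_0[OF assms] by (simp add: col_op_def app_sum app_signed)

lemma lap_wt_0:
  assumes "has_wt n \<mu> f" "\<mu> (U s) = 0" "\<mu> (U t) = 0"
  shows "app (lap n s t) f = 0"
  using der_wt_0[OF assms(1,2)] der_wt_0[OF assms(1,3)] by (simp add: lap_def app_sum)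

lemma lookup_mul_der_diag:
  "lookup (app (mul a) (app (der a) f)) \<gamma> =
    (if odv a then of_bool (odd (\<gamma> a)) else of_nat (\<gamma> a)) * lookup f \<gamma>"
proof (cases "\<gamma> a")
  case 0
  then show ?thesis by (simp add: lookup_mul)
next
  case (Suc k)
  then have "\<gamma>(a := Suc k) = \<gamma>" by auto
  with Suc show ?thesis
    by (simp add: lookup_mul lookup_der koszul_sign_upd mult.assoc[symmetric] del: of_nat_Suc) (simp add: koszul_sign_def)
qed

lemma lookup_mul_der_diag_legal:
  assumes "legal n \<gamma>"
  shows "lookup (app (mul a) (app (der a) f)) \<gamma> = of_nat (\<gamma> a) * lookup f \<gamma>"
proof -
  have "odv a \<Longrightarrow> \<gamma> a = 0 \<or> \<gamma> a = 1" using assms unfolding legal_def by (metis le_zero_eq le_Suc_eq One_nat_def)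
  then show ?thesis by (auto simp: lookup_mul_der_diag)
qed

text \<open>Euler's identity for a single column: the diagonal polarizations form the torus whose
  weights are the column degrees.\<close>

lemma col_op_diag:
  assumes "has_wt n \<mu> f"
  shows "app (col_op n s s) f = of_nat (\<mu> s) *\<^sub>C f"
proof (rule poly_mapping_eqI)
  fix \<gamma>
  have e: "app (col_op n s s) f = (\<Sum>i\<in>idx_set n n. app (mul (i, s)) (app (der (i, s)) f))"
    by (simp add: col_op_def sum_idx_set app_sum sum.distrib)
  show "lookup (app (col_op n s s) f) \<gamma> = lookup (of_nat (\<mu> s) *\<^sub>C f) \<gamma>"
  proof (cases "\<gamma> \<in> keys f")
    case True
    with assms have "legal n \<gamma>" "\<mu> s = col n \<gamma> s" by (auto simp: has_wt_def)
    then show ?thesis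
      by (simp add: e lookup_sum lookup_mul_der_diag_legal lookup_cscale col_def sum_distrib_right)
  next
    case False
    then show ?thesis
      by (simp add: e lookup_sum lookup_mul_der_diag lookup_cscale in_keys_iff)
  qed
qed

lemma col_op_col_op:
  "col_op n a b * col_op n c d = signed ((oi a \<noteq> oi b) \<and> (oi c \<noteq> oi d)) (col_op n c d * col_op n a b)
    + (if b = c then col_op n a d else 0) - signed ((oi a \<noteq> oi b) \<and> (oi c \<noteq> oi d)) (if a = d then col_op n c b else 0)"
proof -
  define e where "e i s t = (oi i \<and> oi s \<noteq> oi t)" for i s t
  define T where "T i s t = signed (e i s t) (mul (i, s) * der (i, t))" for i s t
  have col_op: "col_op n s t = (\<Sum>i\<in>idx_set n n. T i s t)" for s t
    by (auto simp: col_op_def T_def e_def sum_idx_set sum.distrib signed_def intro!: sum.cong)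
  have T: "T i a b * T j c d = signed ((oi a \<noteq> oi b) \<and> (oi c \<noteq> oi d)) (T j c d * T i a b)
    + (if i = j then (if b = c then T i a d else 0) - signed ((oi a \<noteq> oi b) \<and> (oi c \<noteq> oi d)) (if a = d then T i c b else 0) else 0)" for i j
    unfolding T_def signed_mult
    by (subst mul_der_commute, cases "b = c"; cases "a = d"; cases "i = j"; cases "oi i"; cases "oi j"; cases "oi a"; cases "oi b"; cases "oi c"; cases "oi d")
      (simp_all add: odv_iff signed_def e_def)
  have "col_op n a b * col_op n c d = (\<Sum>i\<in>idx_set n n. \<Sum>j\<in>idx_set n n. signed ((oi a \<noteq> oi b) \<and> (oi c \<noteq> oi d)) (T j c d * T i a b))
   + (\<Sum>i\<in>idx_set n n. (if b = c then T i a d else 0) - signed ((oi a \<noteq> oi b) \<and> (oi c \<noteq> oi d)) (if a = d then T i c b else 0))"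
    unfolding col_op sum_product by (subst T) (simp add: sum.distrib)
  also have "(\<Sum>i\<in>idx_set n n. \<Sum>j\<in>idx_set n n. signed ((oi a \<noteq> oi b) \<and> (oi c \<noteq> oi d)) (T j c d * T i a b))
    = signed ((oi a \<noteq> oi b) \<and> (oi c \<noteq> oi d)) (col_op n c d * col_op n a b)"
    unfolding col_op sum_product by (subst sum.swap) (simp add: signed_sum)
  finally show ?thesis
    unfolding col_op by (auto simp: sum_subtractf signed_sum)
qed

lemma row_op_mono:
  assumes "C \<subseteq> C'" "finite C'" "has_wt n \<mu> f" "\<And>s. s \<in> C' - C \<Longrightarrow> \<mu> s = 0" "j \<in> idx_set n n"
  shows "app (row_op C' i j) f = app (row_op C i j) f"
  unfolding row_op_def app_sum
  by (rule sum.mono_neutral_right) (use assms der_wt_0[OF assms(3)] in auto)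

text \<open>Derivatives with respect to an absent column vanish, so invariance may be tested over
  any finite set of columns containing those that occur.\<close>

lemma pinv_mono:
  assumes "C \<subseteq> C'" "finite C'" "has_wt n \<mu> f" "\<And>s. s \<in> C' - C \<Longrightarrow> \<mu> s = 0"
  shows "pinv n C' f \<longleftrightarrow> pinv n C f"
proof -
  have "app (row_op C' i j) f = app (row_op C i j) f" if "j \<in> idx_set n n" for i j
    by (rule row_op_mono[OF assms that])
  then show ?thesis
    unfolding pinv_iff by (intro ball_cong refl) (simp only: idx_set_iff)
qed

section \<open>Invariants of rectangular weight\<close>

definition diag_deg :: "nat \<Rightarrow> mono \<Rightarrow> nat"
  where "diag_deg r \<alpha> = (\<Sum>i=1..r. \<alpha> (U i, U i))"

definition diag :: "nat \<Rightarrow> var \<Rightarrow> bool"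
  where "diag r v \<longleftrightarrow> (\<exists>i\<in>{1..r}. v = (U i, U i))"

lemma diag_deg_upd: "diag_deg r (\<alpha>(v := k)) + (if diag r v then \<alpha> v else 0) = diag_deg r \<alpha> + (if diag r v then k else 0)"
proof (cases "diag r v")
  case True
  then obtain i where i: "i \<in> {1..r}" "v = (U i, U i)" by (auto simp: diag_def)
  have "(\<Sum>j\<in>{1..r} - {i}. (\<alpha>(v := k)) (U j, U j)) = (\<Sum>j\<in>{1..r} - {i}. \<alpha> (U j, U j))"
    by (rule sum.cong) (auto simp: i)
  then show ?thesis
    using True i(2) unfolding diag_deg_def sum.remove[OF finite_atLeastAtMost i(1)] by simp
next
  case False
  then show ?thesis unfolding diag_deg_def by (auto simp: diag_def intro!: sum.cong)
qed

text \<open>The target monomial determines its source under \<open>mul a * der b\<close>, so nothing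
  can cancel: the coefficient is a nonzero multiple of that of \<beta>.\<close>

lemma lookup_mul_der_src:
  assumes "legal n \<beta>" "\<beta> \<in> keys f" "\<beta> b > 0" "a \<noteq> b" "\<not> odv a"
  shows "lookup (app (mul a) (app (der b) f)) (\<beta>(b := \<beta> b - 1, a := Suc (\<beta> a))) \<noteq> 0"
proof -
  have 1: "(\<beta>(b := \<beta> b - 1, a := Suc (\<beta> a)))(a := \<beta> a) = \<beta>(b := \<beta> b - 1)"
    and 2: "(\<beta>(b := \<beta> b - 1))(b := \<beta> b) = \<beta>" using assms(4) by (auto simp: fun_eq_iff)
  have "odv b \<Longrightarrow> \<beta> b = 1" using assms(1,3) unfolding legal_def by (metis One_nat_def Suc_leI le_antisym)
  then show ?thesis
    using assms(2-5) by (simp add: lookup_mul lookup_der 1 2 in_keys_iff)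
qed

lemma lookup_mul_der_nz:
  assumes "lookup (app (mul a) (app (der b) f)) \<gamma> \<noteq> 0"
  shows "\<gamma> a > 0" "\<gamma>(a := \<gamma> a - 1, b := Suc ((\<gamma>(a := \<gamma> a - 1)) b)) \<in> keys f"
proof -
  have "\<gamma> \<in> keys (app (mul a) (app (der b) f))" using assms by (simp add: in_keys_iff)
  note k = keys_mul[OF this]
  from k(1) show "\<gamma> a > 0" .
  from keys_der(2)[OF k(3)] show "\<gamma>(a := \<gamma> a - 1, b := Suc ((\<gamma>(a := \<gamma> a - 1)) b)) \<in> keys f" .
qed

lemma diag_deg_step:
  assumes "\<gamma> a > 0"
  shows "diag_deg r (\<gamma>(a := \<gamma> a - 1, b := Suc ((\<gamma>(a := \<gamma> a - 1)) b))) + (if diag r a then 1 else 0) = diag_deg r \<gamma> + (if diag r b then 1 else 0)"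
  using assms diag_deg_upd[of r "\<gamma>(a := \<gamma> a - 1)" b "Suc ((\<gamma>(a := \<gamma> a - 1)) b)"] diag_deg_upd[of r \<gamma> a "\<gamma> a - 1"]
  by (auto split: if_splits)

text \<open>
  In the terms of highest degree in the diagonal variables \<open>x\<^sub>i\<^sub>i\<close>, the even part of the algebra
  excludes the other variables \<open>x\<^sub>j\<^sub>i\<close>, and the odd operators make the odd variables occur through
  symmetric combinations of \<open>y\<^sub>i\<^sub>j\<close> and \<open>y\<^sub>j\<^sub>i\<close> only; counting degrees then leaves no freedom.
\<close>
locale top_degree =
  fixes n l :: nat and f :: fock
  assumes wt: "has_wt n (\<lambda>s. if s \<in> U ` {1..l} then l + 1 else 0) f"
    and inv: "pinv n (U ` {1..l}) f"
    and nz: "f \<noteq> 0"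
begin

text \<open>Diagonal variables exist only for rows up to n and columns up to l. Once
  \<open>l_le\<close> is proved, this is l itself.\<close>

definition r where "r = min n l"
definition d where "d = Max (diag_deg r ` keys f)"
definition "tops = {\<beta> \<in> keys f. diag_deg r \<beta> = d}"

lemma keys_ne: "keys f \<noteq> {}"
  using nz by simp

lemma diag_deg_le: "\<beta> \<in> keys f \<Longrightarrow> diag_deg r \<beta> \<le> d"
  unfolding d_def by (rule Max_ge) auto

lemma top_ne: "tops \<noteq> {}"
proof -
  have "d \<in> diag_deg r ` keys f" unfolding d_def by (rule Max_in) (use keys_ne in auto)
  then show ?thesis by (auto simp: tops_def)
qed

lemma top_legal: "\<beta> \<in> tops \<Longrightarrow> legal n \<beta>"
  using wt by (auto simp: tops_def has_wt_def)

lemma row_op_lookup: "lookup (app (row_op (U ` {1..l}) i j) f) \<gamma>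
   = (\<Sum>u=1..l. lookup (app (mul (i, U u)) (app (der (j, U u)) f)) \<gamma>)"
  by (simp add: row_op_def sum.reindex inj_on_def app_sum lookup_sum)

lemma lookup_above:
  assumes "diag_deg r \<gamma> = d + 1" "\<not> diag r a \<or> diag r b"
  shows "lookup (app (mul a) (app (der b) f)) \<gamma> = 0"
proof (rule ccontr)
  assume "lookup (app (mul a) (app (der b) f)) \<gamma> \<noteq> 0"
  note k = lookup_mul_der_nz[OF this]
  from diag_deg_le[OF k(2)] diag_deg_step[of \<gamma> a r b, OF k(1)] assms show False by (auto split: if_splits)
qed

text \<open>At a monomial of diagonal degree d + 1 only a term that raises this degree contributes,
  and among the multiplications by variables of row \<open>U i\<close> only the one by
  \<open>(U i, U i)\<close> does so.\<close>

lemma row_op_lookup_above: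
  assumes "diag_deg r \<gamma> = d + 1" "i \<in> {1..r}" "j \<noteq> U i"
  shows "lookup (app (row_op (U ` {1..l}) (U i) j) f) \<gamma> =
     lookup (app (mul (U i, U i)) (app (der (j, U i)) f)) \<gamma>"
proof -
  have i: "i \<in> {1..l}" using assms(2) by (auto simp: r_def)
  have "lookup (app (mul (U i, U u)) (app (der (j, U u)) f)) \<gamma> = 0" if "u \<noteq> i" for u
    by (rule lookup_above[OF assms(1)]) (use that in \<open>auto simp: diag_def\<close>)
  then show ?thesis
    unfolding row_op_lookup by (subst sum.remove[OF _ i]) (auto intro!: sum.neutral)
qed

lemma diag_deg_raise:
  assumes "\<beta> \<in> tops" "i \<in> {1..r}" "\<not> diag r b" "b \<noteq> (U i, U i)" "\<beta> b > 0"
  shows "diag_deg r (\<beta>(b := \<beta> b - 1, (U i, U i) := Suc (\<beta> (U i, U i)))) = d + 1"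
  using diag_deg_upd[of r \<beta> b "\<beta> b - 1"] diag_deg_upd[of r "\<beta>(b := \<beta> b - 1)" "(U i, U i)" "Suc (\<beta> (U i, U i))"] assms
  by (auto simp: tops_def diag_def split: if_splits)

text \<open>Trading x_ji for x_ii raises the diagonal degree beyond the maximum. The other side of
  the invariance equation, \<open>row_op (B j) (B i)\<close>, multiplies by odd variables only and
  has nothing in that degree to match it.\<close>

lemma no_offdiag:
  assumes \<beta>: "\<beta> \<in> tops" and ij: "i \<in> {1..r}" "j \<in> {1..n}" "j \<noteq> i"
  shows "\<beta> (U j, U i) = 0"
proof (rule ccontr)
  assume nz: "\<beta> (U j, U i) \<noteq> 0"
  let ?\<gamma> = "\<beta>((U j, U i) := \<beta> (U j, U i) - 1, (U i, U i) := Suc (\<beta> (U i, U i)))"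
  have diag_deg: "diag_deg r ?\<gamma> = d + 1"
    by (rule diag_deg_raise[OF \<beta> ij(1)]) (use ij nz in \<open>auto simp: diag_def\<close>)
  have "lookup (app (row_op (U ` {1..l}) (U i) (U j)) f) ?\<gamma> \<noteq> 0"
    unfolding row_op_lookup_above[OF diag_deg ij(1), of "U j"]
    using row_op_lookup_above[OF diag_deg ij(1), of "U j"] ij
      lookup_mul_der_src[OF top_legal[OF \<beta>], of f "(U j, U i)" "(U i, U i)"] \<beta> nz
    by (simp add: tops_def odv_iff)
  moreover have "i \<in> {1..n}" using ij(1) by (auto simp: r_def)
  then have "app (row_op (U ` {1..l}) (U i) (U j)) f = app (row_op (U ` {1..l}) (B j) (B i)) f"
    using inv ij(2) unfolding pinv_iff by blast
  moreover have "lookup (app (row_op (U ` {1..l}) (B j) (B i)) f) ?\<gamma> = 0"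
    unfolding row_op_lookup by (intro sum.neutral ballI lookup_above[OF diag_deg]) (auto simp: diag_def)
  ultimately show False by simp
qed

text \<open>Invariance under the diagonal elements of \<open>pe\<close>: they measure the difference
  of the degrees in row \<open>U i\<close> and row \<open>B i\<close>.\<close>

lemma row_balance:
  assumes \<beta>: "\<beta> \<in> keys f" and i: "i \<in> {1..n}"
  shows "(\<Sum>u=1..l. \<beta> (U i, U u)) = (\<Sum>u=1..l. \<beta> (B i, U u))"
proof -
  have leg: "legal n \<beta>" using wt \<beta> by (auto simp: has_wt_def)
  have "app (row_op (U ` {1..l}) (U i) (U i)) f = app (row_op (U ` {1..l}) (B i) (B i)) f"
    using inv i unfolding pinv_iff by blast
  from arg_cong[OF this, of "\<lambda>g. lookup g \<beta>"]
  have "of_nat (\<Sum>u=1..l. \<beta> (U i, U u)) * lookup f \<beta> = of_nat (\<Sum>u=1..l. \<beta> (B i, U u)) * lookup f \<beta>"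
    unfolding row_op_lookup lookup_mul_der_diag_legal[OF leg] by (simp add: sum_distrib_right)
  with \<beta> show ?thesis by (simp add: in_keys_iff del: of_nat_sum)
qed

lemma odv_BU: "odv (B i, U j)"
  by (simp add: odv_iff)

text \<open>In degree d + 1 the odd generator with rows i and j reduces to the equation x_ii d/dy_ji
  = x_jj d/dy_ij. So a top monomial containing y_ji has a partner in which y_ij has one power more;
  as y_ij is odd, it cannot have been present already.\<close>

lemma swap:
  assumes \<beta>: "\<beta> \<in> tops" and ij: "i \<in> {1..r}" "j \<in> {1..r}" "j \<noteq> i" and nz: "\<beta> (B j, U i) > 0"
  shows "\<beta> (B i, U j) = 0"
    "\<exists>\<beta>'\<in>tops. \<forall>v. \<not> diag r v \<longrightarrow> \<beta>' v = (\<beta>((B j, U i) := 0, (B i, U j) := 1)) v"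
proof -
  let ?\<gamma> = "\<beta>((B j, U i) := \<beta> (B j, U i) - 1, (U i, U i) := Suc (\<beta> (U i, U i)))"
  let ?\<delta> = "?\<gamma>((U j, U j) := ?\<gamma> (U j, U j) - 1, (B i, U j) := Suc ((?\<gamma>((U j, U j) := ?\<gamma> (U j, U j) - 1)) (B i, U j)))"
  have n: "i \<in> {1..n}" "j \<in> {1..n}" using ij by (auto simp: r_def)
  have leg: "legal n \<beta>" by (rule top_legal[OF \<beta>])
  have "\<beta> (B j, U i) \<le> 1" using leg by (auto simp: legal_def odv_iff)
  with nz have one: "\<beta> (B j, U i) = 1" by simp
  have diag_deg: "diag_deg r ?\<gamma> = d + 1"
    by (rule diag_deg_raise[OF \<beta> ij(1)]) (use ij nz in \<open>auto simp: diag_def\<close>)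
  have "lookup (app (row_op (U ` {1..l}) (U i) (B j)) f) ?\<gamma> \<noteq> 0"
    using row_op_lookup_above[OF diag_deg ij(1), of "B j"]
      lookup_mul_der_src[OF leg, of f "(B j, U i)" "(U i, U i)"] \<beta> nz
    by (simp add: tops_def odv_iff)
  moreover have "app (row_op (U ` {1..l}) (U i) (B j)) f = app (row_op (U ` {1..l}) (U j) (B i)) f"
    using inv n unfolding pinv_iff by blast
  ultimately have "lookup (app (mul (U j, U j)) (app (der (B i, U j)) f)) ?\<gamma> \<noteq> 0"
    using row_op_lookup_above[OF diag_deg ij(2), of "B i"] by simp
  note k = lookup_mul_der_nz[OF this]
  have "legal n ?\<delta>" using k(2) wt by (auto simp: has_wt_def)
  then have "?\<delta> (B i, U j) \<le> 1" unfolding legal_def by (metis (no_types) odv_BU)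
  then show 0: "\<beta> (B i, U j) = 0" using ij by auto
  have "diag_deg r ?\<delta> = d"
    using diag_deg_step[of ?\<gamma> "(U j, U j)" r "(B i, U j)", OF k(1)] diag_deg ij(2) by (auto simp: diag_def)
  with k(2) have "?\<delta> \<in> tops" by (simp add: tops_def)
  moreover have "\<forall>v. \<not> diag r v \<longrightarrow> ?\<delta> v = (\<beta>((B j, U i) := 0, (B i, U j) := 1)) v"
    using ij one 0 by (auto simp: diag_def)
  ultimately show "\<exists>\<beta>'\<in>tops. \<forall>v. \<not> diag r v \<longrightarrow> \<beta>' v = (\<beta>((B j, U i) := 0, (B i, U j) := 1)) v"
    by blast
qed

text \<open>Summing all column degrees gives l(l + 1), and by \<open>row_balance\<close> exactly
  half of this is carried by odd variables.\<close>

lemma total: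
  assumes \<beta>: "\<beta> \<in> keys f"
  shows "2 * (\<Sum>i=1..n. \<Sum>u=1..l. \<beta> (B i, U u)) = l * (l + 1)"
proof -
  have "col n \<beta> (U u) = l + 1" if "u \<in> {1..l}" for u
    using wt \<beta> that by (auto simp: has_wt_def)
  then have "(\<Sum>u=1..l. col n \<beta> (U u)) = l * (l + 1)" by simp
  also have "(\<Sum>u=1..l. col n \<beta> (U u)) = (\<Sum>u=1..l. \<Sum>i=1..n. \<beta> (U i, U u)) + (\<Sum>u=1..l. \<Sum>i=1..n. \<beta> (B i, U u))"
    by (simp add: col_def sum_idx_set sum.distrib)
  also have "(\<Sum>u=1..l. \<Sum>i=1..n. \<beta> (U i, U u)) = (\<Sum>i=1..n. \<Sum>u=1..l. \<beta> (U i, U u))"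
    by (rule sum.swap)
  also have "\<dots> = (\<Sum>i=1..n. \<Sum>u=1..l. \<beta> (B i, U u))"
    by (rule sum.cong[OF refl row_balance[OF \<beta>]])
  also have "(\<Sum>u=1..l. \<Sum>i=1..n. \<beta> (B i, U u)) = (\<Sum>i=1..n. \<Sum>u=1..l. \<beta> (B i, U u))"
    by (rule sum.swap)
  finally show ?thesis by simp
qed

lemma le_1: "\<beta> \<in> tops \<Longrightarrow> \<beta> (B i, U u) \<le> 1"
  using top_legal by (auto simp: legal_def odv_iff)

lemma pair_le:
  assumes \<beta>: "\<beta> \<in> tops" and ij: "i \<in> {1..r}" "j \<in> {1..r}"
  shows "\<beta> (B i, U j) + \<beta> (B j, U i) \<le> (if i = j then 2 else 1)"
proof (cases "i = j \<or> \<beta> (B j, U i) = 0")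
  case False
  then show ?thesis using swap(1)[OF \<beta> ij] le_1[OF \<beta>, of j i] by auto
qed (use le_1[OF \<beta>, of i j] in auto)

lemma pairs_sum:
  "(\<Sum>i=1..r. \<Sum>j=1..r. \<beta> (B i, U j) + \<beta> (B j, U i)) = 2 * (\<Sum>i=1..r. \<Sum>j=1..r. \<beta> (B i, U j))" for \<beta> :: mono
  unfolding sum.distrib by (subst (2) sum.swap) simp

lemma pairs_bound: "(\<Sum>i=1..r. \<Sum>j=1..r. if i = j then 2 else 1) = r * (r + 1)" for r :: nat
proof -
  have "(\<Sum>i=1..r. \<Sum>j=1..r. if i = j then 2 else 1 :: nat) = (\<Sum>i=1..r. \<Sum>j=1..r. 1 + (if i = j then 1 else 0))"
    by (intro sum.cong refl) auto
  also have "\<dots> = r * (r + 1)" unfolding sum.distrib by simp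
  finally show ?thesis .
qed

text \<open>A monomial contains l(l + 1)/2 odd variables. For l > n the columns up to n hold at most
  n(n + 1)/2 of them by \<open>pair_le\<close>, the other columns at most n(l - n), and this falls
  short by k(k + 1)/2 with k = l - n.\<close>

lemma l_le: "l \<le> n"
proof (rule ccontr)
  assume "\<not> l \<le> n"
  then have ln: "n < l" and r: "r = n" by (auto simp: r_def)
  from top_ne obtain \<beta> where \<beta>: "\<beta> \<in> tops" by blast
  have "2 * (\<Sum>i=1..n. \<Sum>u=1..n. \<beta> (B i, U u)) \<le> n * (n + 1)"
    unfolding pairs_sum[symmetric, unfolded r] pairs_bound[symmetric]
    by (intro sum_mono pair_le[OF \<beta>]) (auto simp: r)
  moreover have "(\<Sum>i=1..n. \<Sum>u\<in>{n<..l}. \<beta> (B i, U u)) \<le> (\<Sum>i=1..n. \<Sum>u\<in>{n<..l}. 1)"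
    by (intro sum_mono le_1[OF \<beta>])
  moreover have "(\<Sum>u=1..l. \<beta> (B i, U u)) = (\<Sum>u=1..n. \<beta> (B i, U u)) + (\<Sum>u\<in>{n<..l}. \<beta> (B i, U u))" for i
    by (subst sum.union_disjoint[symmetric]) (use ln in \<open>auto intro!: sum.cong\<close>)
  then have "(\<Sum>i=1..n. \<Sum>u=1..l. \<beta> (B i, U u)) = (\<Sum>i=1..n. \<Sum>u=1..n. \<beta> (B i, U u)) + (\<Sum>i=1..n. \<Sum>u\<in>{n<..l}. \<beta> (B i, U u))"
    by (simp add: sum.distrib)
  ultimately have "l * (l + 1) \<le> n * (n + 1) + 2 * (n * (l - n))"
    using total[of \<beta>] \<beta> by (simp add: tops_def)
  moreover obtain k where k: "l = n + Suc k" using ln less_imp_Suc_add by auto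
  ultimately show False by (simp add: algebra_simps)
qed

lemma r_eq: "r = l"
  using l_le by (simp add: r_def)

lemma rows_above: "\<beta> \<in> tops \<Longrightarrow> i \<in> {1..n} \<Longrightarrow> i > l \<Longrightarrow> u \<in> {1..l} \<Longrightarrow> \<beta> (B i, U u) = 0"
  using row_balance[of \<beta> i] no_offdiag[of \<beta> _ i] by (auto simp: tops_def r_eq)

text \<open>Summed over all i and j, the upper bounds of \<open>pair_le\<close> equal the number
  prescribed by \<open>total\<close>, so each of them is attained.\<close>

lemma pair_eq:
  assumes \<beta>: "\<beta> \<in> tops" and ij: "i \<in> {1..l}" "j \<in> {1..l}"
  shows "\<beta> (B i, U j) + \<beta> (B j, U i) = (if i = j then 2 else 1)"
proof (rule ccontr)
  assume "\<not> ?thesis"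
  with pair_le[OF \<beta>, of i j] ij have lt: "\<beta> (B i, U j) + \<beta> (B j, U i) < (if i = j then 2 else 1)"
    by (simp add: r_eq)
  have "(\<Sum>i=1..n. \<Sum>u=1..l. \<beta> (B i, U u)) = (\<Sum>i=1..l. \<Sum>u=1..l. \<beta> (B i, U u))"
    by (rule sum.mono_neutral_right) (use l_le rows_above[OF \<beta>] in auto)
  with total[of \<beta>] \<beta> have "l * (l + 1) = (\<Sum>i=1..l. \<Sum>j=1..l. \<beta> (B i, U j) + \<beta> (B j, U i))"
    unfolding pairs_sum[unfolded r_eq] by (simp add: tops_def)
  also have "\<dots> < (\<Sum>i=1..l. \<Sum>j=1..l. if i = j then 2 else 1)"
  proof (rule sum_strict_mono_ex1)
    show "\<forall>i\<in>{1..l}. (\<Sum>j=1..l. \<beta> (B i, U j) + \<beta> (B j, U i)) \<le> (\<Sum>j=1..l. if i = j then 2 else 1)"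
      by (intro ballI sum_mono pair_le[OF \<beta>]) (auto simp: r_eq)
    show "\<exists>i\<in>{1..l}. (\<Sum>j=1..l. \<beta> (B i, U j) + \<beta> (B j, U i)) < (\<Sum>j=1..l. if i = j then 2 else 1)"
    proof (rule bexI[OF _ ij(1)], rule sum_strict_mono_ex1)
      show "\<forall>j\<in>{1..l}. \<beta> (B i, U j) + \<beta> (B j, U i) \<le> (if i = j then 2 else 1)"
        using pair_le[OF \<beta>] ij by (auto simp: r_eq)
      show "\<exists>j\<in>{1..l}. \<beta> (B i, U j) + \<beta> (B j, U i) < (if i = j then 2 else 1)"
        using lt ij(2) by blast
    qed auto
  qed simp
  finally show False unfolding pairs_bound by simp
qed

text \<open>The product of x_ss y_st over s \<le> t \<le> l. It depends on l alone, so that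
  different invariants of this weight can be compared at the same monomial.\<close>

definition \<beta>0 :: mono
  where "\<beta>0 v = (case v of (U i, U u) \<Rightarrow> if i = u \<and> i \<in> {1..l} then l + 1 - i else 0
    | (B i, U u) \<Rightarrow> of_bool (1 \<le> i \<and> i \<le> u \<and> u \<le> l) | _ \<Rightarrow> 0)"

text \<open>Among the top monomials one with the fewest y_ji, i < j, has none at all, since
  \<open>swap\<close> would lower their number. Then \<open>pair_eq\<close> fixes the odd exponents
  and \<open>row_balance\<close> the diagonal ones. As a consequence an invariant of this weight is
  determined by its coefficient at \<open>\<beta>0\<close>.\<close>

lemma extremal_monomial: "\<beta>0 \<in> keys f"
proof -
  define inv' where "inv' \<beta> = (\<Sum>(i, j)\<in>{(i, j). i \<in> {1..l} \<and> j \<in> {1..l} \<and> i < j}. \<beta> (B j, U i))" for \<beta> :: mono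
  have fin: "finite {(i, j). i \<in> {1..l} \<and> j \<in> {1..l} \<and> i < j}"
    by (rule finite_subset[of _ "{1..l} \<times> {1..l}"]) auto
  obtain \<beta> where \<beta>: "\<beta> \<in> tops" and min: "\<And>\<beta>'. \<beta>' \<in> tops \<Longrightarrow> inv' \<beta> \<le> inv' \<beta>'"
    using top_ne ex_has_least_nat[of "\<lambda>\<beta>. \<beta> \<in> tops" _ inv'] by blast
  have no: "\<beta> (B j, U i) = 0" if ij: "i \<in> {1..l}" "j \<in> {1..l}" "i < j" for i j
  proof (rule ccontr)
    assume "\<beta> (B j, U i) \<noteq> 0"
    then have "\<beta> (B j, U i) > 0" by simp
    from swap(2)[OF \<beta> _ _ _ this] ij obtain \<beta>' where \<beta>': "\<beta>' \<in> tops"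
      "\<And>v. \<not> diag r v \<Longrightarrow> \<beta>' v = (\<beta>((B j, U i) := 0, (B i, U j) := 1)) v" by (auto simp: r_eq)
    have e: "\<beta>' (B b, U a) = (if a = i \<and> b = j then 0 else \<beta> (B b, U a))" if "a < b" for a b
      using that ij(3) by (subst \<beta>'(2)) (auto simp: diag_def)
    have "inv' \<beta>' < inv' \<beta>"
      unfolding inv'_def
    proof (rule sum_strict_mono_ex1[OF fin])
      show "\<exists>x\<in>{(i, j). i \<in> {1..l} \<and> j \<in> {1..l} \<and> i < j}.
       (case x of (i, j) \<Rightarrow> \<beta>' (B j, U i)) < (case x of (i, j) \<Rightarrow> \<beta> (B j, U i))"
        by (rule bexI[of _ "(i, j)"]) (use e[of i j] ij \<open>\<beta> (B j, U i) > 0\<close> in auto)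
    qed (auto simp: e)
    with min[OF \<beta>'(1)] show False by simp
  qed
  have y: "\<beta> (B i, U u) = of_bool (i \<le> u)" if "i \<in> {1..l}" "u \<in> {1..l}" for i u
  proof -
    consider "i = u" | "i < u" | "u < i" by linarith
    then show ?thesis
      using pair_eq[OF \<beta> that] no[of u i] no[of i u] that by cases auto
  qed
  have x: "\<beta> (U i, U i) = l + 1 - i" if i: "i \<in> {1..l}" for i
  proof -
    have "\<beta> (U i, U i) = (\<Sum>u=1..l. \<beta> (U i, U u))"
      using i no_offdiag[OF \<beta>, of _ i] l_le by (subst sum.remove[of _ i]) (auto simp: r_eq)
    also have "\<dots> = (\<Sum>u=1..l. \<beta> (B i, U u))"
      using row_balance[of \<beta> i] \<beta> i l_le by (auto simp: tops_def)
    also have "\<dots> = (\<Sum>u=1..l. of_bool (i \<le> u))"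
      using y[OF i] by (intro sum.cong) auto
    also have "\<dots> = card ({1..l} \<inter> {u. i \<le> u})" by simp
    also have "{1..l} \<inter> {u. i \<le> u} = {i..l}" using i by auto
    finally show ?thesis by simp
  qed
  have z: "\<beta> v = 0" if "fst v \<notin> idx_set n n \<or> snd v \<notin> U ` {1..l}" for v
  proof (cases "fst v \<in> idx_set n n")
    case True
    with that have "col n \<beta> (snd v) = 0" using wt \<beta> by (auto simp: tops_def has_wt_def)
    with col_ge[OF True, of \<beta> "snd v"] show ?thesis by simp
  next
    case False
    then show ?thesis using top_legal[OF \<beta>] unfolding legal_def by blast
  qed
  have "\<beta> v = \<beta>0 v" for v
  proof (cases "fst v \<in> idx_set n n \<and> snd v \<in> U ` {1..l}")
    case True
    then obtain u where u: "snd v = U u" "u \<in> {1..l}" by auto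
    show ?thesis
    proof (cases "fst v")
      case (Unbarred i)
      then have v: "v = (U i, U u)" "i \<in> {1..n}" using u True by (cases v; auto)+
      then show ?thesis using x[of i] no_offdiag[OF \<beta>, of u i] u(2) by (auto simp: \<beta>0_def r_eq)
    next
      case (Barred i)
      then have v: "v = (B i, U u)" "i \<in> {1..n}" using u True by (cases v; auto)+
      then show ?thesis using y[of i u] rows_above[OF \<beta>, of i u] u(2) by (cases "i \<le> l") (auto simp: \<beta>0_def)
    qed
  next
    case False
    then have "\<beta>0 v = 0" using l_le by (cases v; cases "fst v"; cases "snd v") (auto simp: \<beta>0_def)
    with z[of v] False show ?thesis by auto
  qed
  then have "\<beta> = \<beta>0" by auto
  with \<beta> show ?thesis by (simp add: tops_def)
qed

end

section \<open>Products of distinct inner products do not vanish\<close>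

definition gram_prod :: "nat \<Rightarrow> (nat \<times> nat) list \<Rightarrow> fock"
  where "gram_prod n ps = foldr (\<lambda>(s, t). app (gram n (U s) (U t))) ps vac"

text \<open>The monomial obtained by choosing the summand x_ss y_st in the factor (v_s, v_t), for
  each pair in the list.\<close>

definition gram_mono :: "(nat \<times> nat) list \<Rightarrow> mono"
  where "gram_mono ps v = (case v of (U i, U u) \<Rightarrow> if i = u then length (filter (\<lambda>q. fst q = i) ps) else 0
    | (B i, U u) \<Rightarrow> of_bool ((i, u) \<in> set ps) | _ \<Rightarrow> 0)"

text \<open>There is only one way to reach this monomial. Its even variables are all diagonal, so in
  the factor for (s, t) a summand x_is y_it forces i = s, while y_is x_it forces i = t and then t =
  s by the order of the indices. For s = t the two summands agree, and the factor 2 is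
  harmless.\<close>

lemma gram_prod_nonzero:
  assumes "distinct ps" "\<And>s t. (s, t) \<in> set ps \<Longrightarrow> 1 \<le> s \<and> s \<le> t \<and> t \<le> n"
  shows "lookup (gram_prod n ps) (gram_mono ps) \<noteq> 0"
  using assms
proof (induction ps)
  case Nil
  have "gram_mono [] = (\<lambda>_. 0)" by (auto simp: gram_mono_def fun_eq_iff split: idx.splits)
  then show ?case by (simp add: gram_prod_def vac_def)
next
  case (Cons p qs)
  obtain s t where p: "p = (s, t)" by (cases p)
  have st: "1 \<le> s" "s \<le> t" "t \<le> n" using Cons.prems(2)[of s t] by (auto simp: p)
  let ?\<gamma> = "gram_mono (p # qs)"
  define h where "h = gram_prod n qs"
  define c where "c = lookup (app (mul (U s, U s)) (app (mul (B s, U t)) h)) ?\<gamma>"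
  have nq: "(s, t) \<notin> set qs" using Cons.prems(1) p by simp
  have "c \<noteq> 0"
  proof -
    have "?\<gamma>((U s, U s) := ?\<gamma> (U s, U s) - 1, (B s, U t) := 0) = gram_mono qs"
      using nq by (auto simp: gram_mono_def p fun_eq_iff split: idx.splits)
    moreover have "lookup h (gram_mono qs) \<noteq> 0"
      unfolding h_def by (rule Cons.IH) (use Cons.prems in auto)
    ultimately show ?thesis
      by (simp add: c_def lookup_mul odv_iff) (simp add: gram_mono_def p)
  qed
  have 1: "lookup (app (mul (U i, U s)) (app (mul (B i, U t)) h)) ?\<gamma> = (if i = s then c else 0)" for i
    by (simp add: c_def) (simp add: lookup_mul gram_mono_def)
  have 2: "lookup (app (mul (B i, U s)) (app (mul (U i, U t)) h)) ?\<gamma> = (if i = s then if s = t then c else 0 else 0)" for i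
  proof (cases "i = s \<and> s = t")
    case True
    have "mul (B s, U s) * mul (U s, U s) = mul (U s, U s) * mul (B s, U s)"
      using mul_mul[of "(B s, U s)" "(U s, U s)"] by (simp add: odv_iff)
    from arg_cong[OF this, of "\<lambda>P. lookup (app P h) ?\<gamma>"] True show ?thesis
      by (simp add: c_def)
  next
    case False
    have "lookup (app (mul (B i, U s)) (app (mul (U i, U t)) h)) ?\<gamma> = 0"
    proof (cases "(i, s) \<in> set (p # qs) \<and> i = t")
      case True
      then have "t = s" using Cons.prems(2)[of i s] st by auto
      with False True show ?thesis by simp
    qed (auto simp: lookup_mul gram_mono_def)
    with False show ?thesis by auto
  qed
  have "lookup (gram_prod n (p # qs)) ?\<gamma> = (\<Sum>i=1..n. if i = s then c else 0) + (\<Sum>i=1..n. if i = s then if s = t then c else 0 else 0)"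
  proof -
    have "gram_prod n (p # qs) = app (gram n (U s) (U t)) h" by (simp add: gram_prod_def h_def p)
    then show ?thesis
      by (simp only: gram_def app_sum app_simps app_signed idx_parity.simps even_zero not_True_eq_False signed_False
          lookup_sum lookup_add 1 2 sum.distrib)
  qed
  also have "\<dots> = (if s = t then 2 * c else c)" using st by simp
  finally show ?case using \<open>c \<noteq> 0\<close> by auto
qed

lemma gram_prod_wt: "\<exists>\<mu>. has_wt n \<mu> (gram_prod n ps)"
proof (induction ps)
  case Nil
  have "has_wt n (\<lambda>_. 0) vac" by (auto simp: has_wt_def vac_def legal_def col_def)
  then show ?case by (auto simp: gram_prod_def)
next
  case (Cons p ps)
  then show ?case using wt_gram by (fastforce simp: gram_prod_def split: prod.splits)
qed

lemma gram_prod_gram_span: "set ps \<subseteq> {1..l} \<times> {1..l} \<Longrightarrow> gram_prod n ps \<in> gram_span n (U ` {1..l})"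
  by (induction ps) (auto simp: gram_prod_def intro!: gram_span.intros)

lemma rectangular_weight:
  assumes wt: "has_wt n (\<lambda>s. if s \<in> U ` {1..l} then l + 1 else 0) f" and inv: "pinv n (U ` {1..l}) f"
  shows "f \<in> gram_span n (U ` {1..l})"
proof (cases "f = 0")
  case False
  interpret top_degree n l f by (unfold_locales, fact wt, fact inv, fact False)
  have "finite {(s, t). 1 \<le> s \<and> s \<le> t \<and> t \<le> l}"
    by (rule finite_subset[of _ "{1..l} \<times> {1..l}"]) auto
  then obtain ps where ps: "set ps = {(s, t). 1 \<le> s \<and> s \<le> t \<and> t \<le> l}" "distinct ps"
    using finite_distinct_list by blast
  have "length (filter (\<lambda>q. fst q = i) ps) = l + 1 - i" if "i \<in> {1..l}" for i
  proof -
    have "length (filter (\<lambda>q. fst q = i) ps) = card (set (filter (\<lambda>q. fst q = i) ps))"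
      by (rule distinct_card[OF distinct_filter[OF ps(2)], symmetric])
    also have "set (filter (\<lambda>q. fst q = i) ps) = Pair i ` {i..l}"
      using that ps(1) by auto
    finally show ?thesis by (simp add: card_image inj_on_def)
  qed
  moreover have "length (filter (\<lambda>q. fst q = i) ps) = 0" if "i \<notin> {1..l}" for i
    using that ps(1) by auto
  ultimately have gram_mono: "gram_mono ps = \<beta>0"
    by (auto simp: gram_mono_def \<beta>0_def ps(1) fun_eq_iff split: idx.splits)
  define g where "g = gram_prod n ps"
  have g: "lookup g \<beta>0 \<noteq> 0"
    unfolding g_def gram_mono[symmetric] by (rule gram_prod_nonzero) (use ps l_le in auto)
  obtain \<mu> where \<mu>: "has_wt n \<mu> g" using gram_prod_wt g_def by blast
  have "\<mu> = col n \<beta>0" using \<mu> g by (auto simp: has_wt_def in_keys_iff)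
  also have "col n \<beta>0 = (\<lambda>s. if s \<in> U ` {1..l} then l + 1 else 0)"
    using wt extremal_monomial by (auto simp: has_wt_def)
  finally have wg: "has_wt n (\<lambda>s. if s \<in> U ` {1..l} then l + 1 else 0) g" using \<mu> by simp
  have gR: "g \<in> gram_span n (U ` {1..l})" unfolding g_def by (rule gram_prod_gram_span) (use ps in auto)
  \<comment> \<open>With this constant the coefficient of \<open>f - c *\<^sub>C g\<close> at
    \<open>\<beta>0\<close> is zero, whereas a nonzero invariant of this weight would contain
    \<open>\<beta>0\<close>.\<close>
  define c where "c = lookup f \<beta>0 / lookup g \<beta>0"
  have "f - c *\<^sub>C g = 0"
  proof (rule ccontr)
    assume nz: "f - c *\<^sub>C g \<noteq> 0"
    have "pinv n (U ` {1..l}) g" by (rule gram_span_pinv[OF gR]) simp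
    then interpret f': top_degree n l "f - c *\<^sub>C g"
      by unfold_locales (use wt wg inv nz in \<open>auto intro!: wt_diff wt_scale pinv_diff pinv_scale\<close>)
    have "\<beta>0 = f'.\<beta>0" by (simp add: fun_eq_iff \<beta>0_def f'.\<beta>0_def)
    with f'.extremal_monomial show False
      using g by (simp add: in_keys_iff lookup_minus lookup_cscale c_def)
  qed
  then have "f = c *\<^sub>C g" by simp
  then show ?thesis using gR by (simp add: gram_span_scale)
qed (simp add: gram_span_0)

section \<open>Highest weights modulo the span\<close>

lemma weight_equation:
  fixes \<mu> :: "nat \<Rightarrow> nat" and N :: nat
  assumes eq: "\<And>s. s \<in> {1..N} \<Longrightarrow> (int (\<mu> s))\<^sup>2 + (\<Sum>u\<in>{s<..N}. int (\<mu> s) - int (\<mu> u)) = (int N + 1) * int (\<mu> s)"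
  obtains l where "l \<le> N" "\<And>s. s \<in> {1..N} \<Longrightarrow> \<mu> s = (if s \<le> l then l + 1 else 0)"
proof -
  \<comment> \<open>The inserted 0 yields l = 0 when all entries vanish.\<close>
  define l where "l = Max (insert 0 {s\<in>{1..N}. \<mu> s \<noteq> 0})"
  have l_in: "l \<in> insert 0 {s\<in>{1..N}. \<mu> s \<noteq> 0}"
    unfolding l_def by (rule Max_in) auto
  then have lN: "l \<le> N" by auto
  have above: "\<mu> s = 0" if "s \<in> {1..N}" "s > l" for s
  proof (rule ccontr)
    assume "\<mu> s \<noteq> 0"
    then have "s \<le> l" unfolding l_def using that by (intro Max_ge) auto
    with that show False by simp
  qed
  have below: "\<mu> s = l + 1" if "s \<in> {1..l}" for s
    using that
  proof (induction "l - s" arbitrary: s rule: less_induct)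
    case less
    have IH: "\<mu> u = l + 1" if "s < u" "u \<le> l" for u
      using less.hyps[of u] that less.prems by auto
    have "(\<Sum>u\<in>{s<..N}. int (\<mu> u)) = (\<Sum>u\<in>{s<..l}. int (\<mu> u))"
      by (rule sum.mono_neutral_right) (use less.prems lN above in auto)
    also have "\<dots> = (\<Sum>u\<in>{s<..l}. int l + 1)"
      by (rule sum.cong) (use IH in auto)
    also have "\<dots> = int (l - s) * (int l + 1)" by simp
    finally have "(int (\<mu> s))\<^sup>2 + (int (N - s) * int (\<mu> s) - int (l - s) * (int l + 1)) = (int N + 1) * int (\<mu> s)"
      using eq[of s] less.prems lN by (simp add: sum_subtractf)
    \<comment> \<open>With the later entries known, the equation is quadratic in
      \<open>\<mu> s\<close> and factors with roots l + 1 and s - l.\<close>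
    then have "(int (\<mu> s) - (int l + 1)) * (int (\<mu> s) + (int l - int s)) = 0"
      using less.prems lN by (simp add: algebra_simps power2_eq_square of_nat_diff)
    \<comment> \<open>For s < l this is positive, and for s = l it is \<open>\<mu> l\<close>, which
      is nonzero by the choice of l.\<close>
    moreover have "int (\<mu> s) + (int l - int s) \<noteq> 0"
      using l_in less.prems by (cases "s = l") auto
    ultimately show ?case by simp
  qed
  show ?thesis
    by (rule that[OF lN]) (use above below in auto)
qed

lemma sum_split_at:
  fixes g :: "nat \<Rightarrow> int"
  assumes "s \<in> {1..N}"
  shows "(\<Sum>u=1..N. if u < s then 0 else if u = s then a else g u) = a + (\<Sum>u\<in>{s<..N}. g u)"
proof -
  have "(\<Sum>u=1..N. if u < s then 0 else if u = s then a else g u) = (\<Sum>u\<in>{s..N}. if u < s then 0 else if u = s then a else g u)"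
    by (rule sum.mono_neutral_right) (use assms in auto)
  also have "{s..N} = insert s {s<..N}" using assms by auto
  also have "(\<Sum>u\<in>insert s {s<..N}. if u < s then 0 else if u = s then a else g u) = a + (\<Sum>u\<in>{s<..N}. g u)"
    by simp
  finally show ?thesis .
qed

text \<open>
  An invariant outside the span whose weight has maximal height is a highest weight vector modulo
  the span, so that the characteristic identity determines its weight.
\<close>
lemma even_invariants:
  assumes "has_wt n \<mu> f" "pinv n (U ` {1..N}) f" "\<And>s. s \<notin> U ` {1..N} \<Longrightarrow> \<mu> s = 0"
  shows "f \<in> gram_span n (U ` {1..N})"
  using assms
proof (induction "\<Sum>u=1..N. \<mu> (U u)" arbitrary: \<mu> f rule: less_induct)
  case less
  define m where "m = (\<Sum>u=1..N. \<mu> (U u))"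
  let ?C = "U ` {1..N}"
  \<comment> \<open>The counterexamples in the same total degree m; smaller degrees are covered by
    the induction hypothesis.\<close>
  define bad where "bad p = (has_wt n (fst p) (snd p) \<and> pinv n ?C (snd p) \<and> (\<forall>s. s \<notin> ?C \<longrightarrow> fst p s = 0)
     \<and> (\<Sum>u=1..N. fst p (U u)) = m \<and> snd p \<notin> gram_span n ?C)" for p :: "(idx \<Rightarrow> nat) \<times> fock"
  \<comment> \<open>The coefficients decrease in u, so turning a column t into a column s < t raises
    the height, by t - s.\<close>
  define ht where "ht p = (\<Sum>u=1..N. (N - u) * fst p (U u))" for p :: "(idx \<Rightarrow> nat) \<times> fock"
  show ?case
  proof (rule ccontr)
    assume "f \<notin> gram_span n ?C"
    then have "bad (\<mu>, f)" using less.prems by (auto simp: bad_def m_def)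
    moreover have "\<forall>p. bad p \<longrightarrow> ht p < Suc (N * m)"
    proof (intro allI impI)
      fix p assume "bad p"
      have "ht p \<le> (\<Sum>u=1..N. N * fst p (U u))" unfolding ht_def by (intro sum_mono mult_right_mono) auto
      also have "\<dots> = N * m" using \<open>bad p\<close> by (simp add: bad_def sum_distrib_left[symmetric])
      finally show "ht p < Suc (N * m)" by simp
    qed
    ultimately have "\<exists>p. bad p \<and> (\<forall>q. bad q \<longrightarrow> ht q \<le> ht p)"
      by (rule ex_has_greatest_nat)
    then obtain p where p: "bad p" "\<forall>q. bad q \<longrightarrow> ht q \<le> ht p"
      by (elim exE conjE)
    obtain \<nu> g where pe: "p = (\<nu>, g)" by (cases p)
    have g: "has_wt n \<nu> g" "pinv n ?C g" "\<And>s. s \<notin> ?C \<Longrightarrow> \<nu> s = 0" "(\<Sum>u=1..N. \<nu> (U u)) = m" "g \<notin> gram_span n ?C"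
      using p(1) by (auto simp: bad_def pe)
    have raise: "app (col_op n (U s) (U t)) g \<in> gram_span n ?C" if st: "s \<in> {1..N}" "t \<in> {1..N}" "s < t" for s t
    proof (cases "\<nu> (U t) = 0")
      case True
      then show ?thesis using col_op_wt_0[OF g(1)] gram_span_0 by simp
    next
      case False
      let ?\<nu> = "inc (U s) (dec (U t) \<nu>)"
      define \<nu>' where "\<nu>' = ?\<nu>"
      have e: "int (\<nu>' (U u)) = int (\<nu> (U u)) + ((if u = s then 1 else 0) - (if u = t then 1 else 0))" for u
        using st False by (auto simp: \<nu>'_def inc_def dec_def)
      have "int (\<Sum>u=1..N. \<nu>' (U u)) = int (\<Sum>u=1..N. \<nu> (U u)) + ((\<Sum>u=1..N. if u = s then 1 else 0) - (\<Sum>u=1..N. if u = t then 1 else 0))"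
        unfolding of_nat_sum e sum.distrib sum_subtractf ..
      then have sum: "(\<Sum>u=1..N. \<nu>' (U u)) = m" using st g(4) by (simp del: of_nat_sum)
      have "int (ht (\<nu>', h)) = int (ht (\<nu>, g)) + ((\<Sum>u=1..N. if u = s then int (N - u) else 0) - (\<Sum>u=1..N. if u = t then int (N - u) else 0))" for h
        unfolding ht_def of_nat_sum sum.distrib[symmetric] sum_subtractf[symmetric] fst_conv of_nat_mult e
        by (rule sum.cong[OF refl]) (simp add: distrib_left right_diff_distrib del: of_nat_diff)
      from this[of "app (col_op n (U s) (U t)) g"] have "ht (\<nu>, g) < ht (\<nu>', app (col_op n (U s) (U t)) g)"
        using st by (simp add: of_nat_diff)
      then have "\<not> bad (\<nu>', app (col_op n (U s) (U t)) g)"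
        using p(2)[rule_format, of "(\<nu>', app (col_op n (U s) (U t)) g)"] pe by (metis leD)
      moreover have "has_wt n ?\<nu> (app (col_op n (U s) (U t)) g)" by (rule wt_col_op[OF g(1)])
      moreover have "pinv n ?C (app (col_op n (U s) (U t)) g)" using st g(2) by (intro pinv_col_op) auto
      moreover have "?\<nu> v = 0" if "v \<notin> ?C" for v using g(3)[OF that] that st by (auto simp: inc_def dec_def)
      ultimately show ?thesis using sum unfolding bad_def \<nu>'_def by auto
    qed
    have lap: "app (lap n u t) g \<in> gram_span n ?C" if ut: "u \<in> {1..N}" "t \<in> {1..N}" for u t
    proof (cases "\<nu> (U u) = 0 \<and> \<nu> (U t) = 0")
      case True
      then show ?thesis using lap_wt_0[OF g(1)] gram_span_0 by simp
    next
      case False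
      let ?\<nu> = "dec (U u) (dec (U t) \<nu>)"
      show ?thesis
      proof (rule less.hyps)
        have "(\<Sum>v=1..N. ?\<nu> (U v)) < (\<Sum>v=1..N. \<nu> (U v))"
        proof (rule sum_strict_mono_ex1)
          show "\<exists>v\<in>{1..N}. ?\<nu> (U v) < \<nu> (U v)"
            by (rule bexI[of _ "if \<nu> (U u) = 0 then t else u"]) (use False ut in \<open>auto simp: dec_def\<close>)
        qed (auto simp: dec_def)
        then show "(\<Sum>v=1..N. ?\<nu> (U v)) < (\<Sum>v=1..N. \<mu> (U v))" using g(4) m_def by simp
        show "has_wt n ?\<nu> (app (lap n u t) g)" by (rule wt_lap[OF g(1)])
        show "pinv n ?C (app (lap n u t) g)" using ut g(2) by (intro pinv_lap) auto
        show "?\<nu> v = 0" if "v \<notin> ?C" for v using g(3)[OF that] by (auto simp: dec_def)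
      qed
    qed
    \<comment> \<open>The eigenvalue on g, modulo the span, of the polarization from s to u followed
      by the one back. For u < s the first one is raising and already lands in the span. For u > s
      the commutator brings the raising one to the front, at the price of the difference of the two
      weights.\<close>
    define \<kappa> where "\<kappa> s u = (if u < s then 0 else if u = s then (int (\<nu> (U s)))\<^sup>2 else int (\<nu> (U s)) - int (\<nu> (U u)))" for s u
    have step: "app (col_op n (U s) (U u)) (app (col_op n (U u) (U s)) g) - of_int (\<kappa> s u) *\<^sub>C g \<in> gram_span n ?C"
      if su: "s \<in> {1..N}" "u \<in> {1..N}" for s u
    proof -
      consider "u < s" | "u = s" | "s < u" by linarith
      then show ?thesis
      proof cases
        case 1
        then show ?thesis
          using gram_span_col_op[OF raise[OF su(2,1) 1], where s = "U u" and t = "U s"] su by (simp add: \<kappa>_def)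
      next
        case 2
        then show ?thesis by (simp add: \<kappa>_def col_op_diag[OF g(1)] app_scale power2_eq_square gram_span_0)
      next
        case 3
        have "app (col_op n (U s) (U u) * col_op n (U u) (U s)) g = app (col_op n (U u) (U s) * col_op n (U s) (U u) + col_op n (U s) (U s) - col_op n (U u) (U u)) g"
          using 3 by (subst col_op_col_op) simp
        then have "app (col_op n (U s) (U u)) (app (col_op n (U u) (U s)) g) - of_int (\<kappa> s u) *\<^sub>C g = app (col_op n (U u) (U s)) (app (col_op n (U s) (U u)) g)"
          using 3 by (simp add: \<kappa>_def col_op_diag[OF g(1)] cvec.scale_left_diff_distrib)
        also have "\<dots> \<in> gram_span n ?C" by (rule gram_span_col_op[OF raise[OF su 3]]) (use su in auto)
        finally show ?thesis .
      qed
    qed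
    have eq: "(int (\<nu> (U s)))\<^sup>2 + (\<Sum>u\<in>{s<..N}. int (\<nu> (U s)) - int (\<nu> (U u))) = (int N + 1) * int (\<nu> (U s))"
      if s: "s \<in> {1..N}" for s
    proof -
      have "(\<Sum>u=1..N. app (col_op n (U s) (U u)) (app (col_op n (U u) (U s)) g)) - (\<Sum>u=1..N. of_int (\<kappa> s u) *\<^sub>C g) \<in> gram_span n ?C"
        unfolding sum_subtractf[symmetric] by (rule gram_span_sum) (use step[OF s] in auto)
      moreover have "(\<Sum>u=1..N. app (gram n (U s) (U u)) (app (lap n u s) g)) \<in> gram_span n ?C"
        using lap s by (intro gram_span_sum gram_span_gram) auto
      ultimately have "of_nat (N + 1) *\<^sub>C of_nat (\<nu> (U s)) *\<^sub>C g - (\<Sum>u=1..N. of_int (\<kappa> s u) *\<^sub>C g) \<in> gram_span n ?C"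
        unfolding characteristic_identity[OF g(2) s] col_op_diag[OF g(1)]
        using gram_span_add by fastforce
      then have "of_int ((int N + 1) * int (\<nu> (U s)) - (\<Sum>u=1..N. \<kappa> s u)) *\<^sub>C g \<in> gram_span n ?C"
        by (simp add: cvec.scale_left_diff_distrib cvec.scale_sum_left add.commute)
      moreover have "g \<in> gram_span n ?C" if "of_int z *\<^sub>C g \<in> gram_span n ?C" "z \<noteq> 0" for z
        using gram_span_scale[OF that(1), of "inverse (of_int z)"] that(2) by simp
      \<comment> \<open>As g lies outside the span, a scalar multiple of it lies inside only for the
        scalar 0; this turns the identity modulo the span into an equation between numbers.\<close>
      ultimately have "(int N + 1) * int (\<nu> (U s)) - (\<Sum>u=1..N. \<kappa> s u) = 0" using g(5) by blast
      then show ?thesis unfolding \<kappa>_def sum_split_at[OF s] by simp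
    qed
    from weight_equation[of N "\<lambda>s. \<nu> (U s)", OF eq] obtain l where l: "l \<le> N"
      "\<And>s. s \<in> {1..N} \<Longrightarrow> \<nu> (U s) = (if s \<le> l then l + 1 else 0)" by metis
    have \<nu>: "\<nu> = (\<lambda>s. if s \<in> U ` {1..l} then l + 1 else 0)"
    proof
      fix s show "\<nu> s = (if s \<in> U ` {1..l} then l + 1 else 0)"
        using l g(3)[of s] by (cases "s \<in> ?C") auto
    qed
    have sub: "U ` {1..l} \<subseteq> ?C" using l(1) by auto
    have "pinv n (U ` {1..l}) g"
      using g(2) pinv_mono[OF sub _ g(1)] by (auto simp: \<nu>)
    then have "g \<in> gram_span n (U ` {1..l})" using g(1) unfolding \<nu> by (intro rectangular_weight)
    then show False using gram_span_mono[OF _ sub] g(5) by blast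
  qed
qed

text \<open>Polarizing an odd column into an unused even one and back multiplies by the degree.\<close>
lemma weight_invariants:
  assumes "has_wt n \<mu> f" "pinv n (idx_set N q) f" "\<And>s. s \<notin> idx_set N q \<Longrightarrow> \<mu> s = 0"
    "(\<Sum>s=1..q. \<mu> (B s)) \<le> card {s\<in>{1..N}. \<mu> (U s) = 0}"
  shows "f \<in> gram_span n (idx_set N q)"
  using assms
proof (induction "\<Sum>s=1..q. \<mu> (B s)" arbitrary: \<mu> f)
  case 0
  then have z: "\<mu> (B s) = 0" if "s \<in> {1..q}" for s using that by simp
  have sub: "U ` {1..N} \<subseteq> idx_set N q" by (auto simp: idx_set_def)
  have z': "\<mu> s = 0" if "s \<notin> U ` {1..N}" for s
  proof (cases "s \<in> idx_set N q")
    case True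
    with that obtain b where "s = B b" "b \<in> {1..q}" by (auto simp: idx_set_def)
    then show ?thesis using z by simp
  qed (rule 0(4))
  have "pinv n (idx_set N q) f = pinv n (U ` {1..N}) f"
    by (rule pinv_mono[OF sub _ 0(2)]) (auto intro: z')
  with 0(3) have "pinv n (U ` {1..N}) f" by blast
  from even_invariants[OF 0(2) this z'] show ?case by (rule gram_span_mono[OF _ sub])
next
  case (Suc k)
  have "(\<Sum>s=1..q. \<mu> (B s)) \<noteq> 0" using Suc.hyps(2) by linarith
  then obtain b where b: "b \<in> {1..q}" "\<mu> (B b) \<noteq> 0"
    by (rule sum.not_neutral_contains_not_neutral)
  \<comment> \<open>The supply of empty even columns is at least the total odd column degree, so one
    is left; each step uses up one of them and lowers this degree by one.\<close>
  have "card {s\<in>{1..N}. \<mu> (U s) = 0} > 0" using Suc.prems(4) Suc.hyps(2) by linarith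
  then obtain a where a: "a \<in> {1..N}" "\<mu> (U a) = 0" by (auto simp: card_gt_0_iff)
  let ?\<nu> = "inc (U a) (dec (B b) \<mu>)"
  let ?g = "app (col_op n (U a) (B b)) f"
  have ab: "U a \<in> idx_set N q" "B b \<in> idx_set N q" using a b by auto
  have sum: "Suc (\<Sum>s=1..q. ?\<nu> (B s)) = (\<Sum>s=1..q. \<mu> (B s))"
  proof -
    have "(\<Sum>s\<in>{1..q} - {b}. ?\<nu> (B s)) = (\<Sum>s\<in>{1..q} - {b}. \<mu> (B s))"
      by (rule sum.cong) (auto simp: inc_def dec_def)
    moreover have "Suc (?\<nu> (B b)) = \<mu> (B b)" using b(2) by (simp add: inc_def dec_def)
    ultimately show ?thesis
      unfolding sum.remove[OF finite_atLeastAtMost b(1)] by simp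
  qed
  have "?g \<in> gram_span n (idx_set N q)"
  proof (rule Suc.hyps(1))
    show "k = (\<Sum>s=1..q. ?\<nu> (B s))" using sum Suc.hyps(2) by simp
    show "has_wt n ?\<nu> ?g" by (rule wt_col_op[OF Suc.prems(1)])
    show "pinv n (idx_set N q) ?g" using ab Suc.prems(2) by (intro pinv_col_op) auto
    show "?\<nu> s = 0" if "s \<notin> idx_set N q" for s
      using Suc.prems(3)[OF that] ab that by (auto simp: inc_def dec_def)
    have "{s\<in>{1..N}. ?\<nu> (U s) = 0} = {s\<in>{1..N}. \<mu> (U s) = 0} - {a}"
      by (auto simp: inc_def dec_def)
    then show "(\<Sum>s=1..q. ?\<nu> (B s)) \<le> card {s\<in>{1..N}. ?\<nu> (U s) = 0}"
      using sum Suc.prems(4) a by simp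
  qed
  then have "app (col_op n (B b) (U a)) ?g \<in> gram_span n (idx_set N q)" by (rule gram_span_col_op[OF _ ab])
  \<comment> \<open>Both polarizations are odd, so their supercommutator is an anticommutator, equal
    to the sum of the two diagonal polarizations. The reversed product and the diagonal polarization
    of column a vanish because that column is empty.\<close>
  moreover have "app (col_op n (B b) (U a) * col_op n (U a) (B b)) f = of_nat (\<mu> (B b)) *\<^sub>C f"
    using a(2) by (subst col_op_col_op) (simp add: col_op_diag[OF Suc.prems(1)] col_op_wt_0[OF Suc.prems(1)] app_uminus_right)
  ultimately have "of_nat (\<mu> (B b)) *\<^sub>C f \<in> gram_span n (idx_set N q)" by simp
  from gram_span_scale[OF this, of "inverse (of_nat (\<mu> (B b)))"] show ?case using b by simp
qed

section \<open>Weight components and the return to the given columns\<close>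

definition wproj :: "nat \<Rightarrow> (idx \<Rightarrow> nat) \<Rightarrow> linop"
  where "wproj n \<mu> = Abs_linop (lin_ext (\<lambda>\<alpha>. if col n \<alpha> = \<mu> then single \<alpha> 1 else 0))"

lemma wproj_single: "app (wproj n \<mu>) (single \<alpha> c) = (if col n \<alpha> = \<mu> then single \<alpha> c else 0)"
  by (simp add: wproj_def Abs_linop_inverse clinear_lin_ext)

lemma lookup_wproj: "lookup (app (wproj n \<mu>) f) \<gamma> = (if col n \<gamma> = \<mu> then lookup f \<gamma> else 0)"
proof -
  define E where "E f = (if col n \<gamma> = \<mu> then lookup f \<gamma> else 0)" for f :: fock
  have "(\<lambda>f. lookup (app (wproj n \<mu>) f) \<gamma>) f = E f"
  proof (rule free_clinear_eqI)
    show "clinear (\<lambda>f. lookup (app (wproj n \<mu>) f) \<gamma>)"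
      by (rule clinearI) (simp_all add: app_add app_scale lookup_add lookup_cscale)
    show "clinear E" unfolding E_def
      by (rule clinearI) (simp_all add: lookup_add lookup_cscale)
    show "lookup (app (wproj n \<mu>) (single \<alpha> 1)) \<gamma> = E (single \<alpha> 1)" for \<alpha>
      by (auto simp: E_def wproj_single lookup_single when_def)
  qed
  then show ?thesis by (simp add: E_def)
qed

text \<open>Row operators preserve every column degree, so the weight components of an invariant are
  invariants themselves.\<close>

lemma wproj_row_op:
  assumes "i \<in> idx_set n n" "j \<in> idx_set n n"
  shows "wproj n \<mu> * row_op C i j = row_op C i j * wproj n \<mu>"
proof -
  have "wproj n \<mu> * (mul (i, s) * der (j, s)) = mul (i, s) * der (j, s) * wproj n \<mu>" for s
  proof (rule linop_eqI)
    fix \<alpha> :: mono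
    let ?\<beta> = "(\<alpha>((j, s) := \<alpha> (j, s) - 1))((i, s) := Suc ((\<alpha>((j, s) := \<alpha> (j, s) - 1)) (i, s)))"
    have "col n ?\<beta> = col n \<alpha>" if "\<alpha> (j, s) \<noteq> 0"
      using col_ge[OF assms(2), of \<alpha> s] that col_ge[OF assms(1), of "\<alpha>((j, s) := \<alpha> (j, s) - 1)" s]
      unfolding col_upd[OF assms(1)] by (auto simp: col_upd[OF assms(2)] fun_eq_iff)
    then show "app (wproj n \<mu> * (mul (i, s) * der (j, s))) (single \<alpha> 1)
       = app (mul (i, s) * der (j, s) * wproj n \<mu>) (single \<alpha> 1)"
      by (cases "\<alpha> (j, s) = 0") (simp_all add: app_der_single app_mul_single wproj_single)
  qed
  then show ?thesis by (simp add: row_op_def sum_distrib_left sum_distrib_right)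
qed

lemma pinv_wproj:
  assumes "pinv n C f" shows "pinv n C (app (wproj n \<mu>) f)"
proof -
  have *: "app (row_op C i j) (app (wproj n \<mu>) f) = app (wproj n \<mu>) (app (row_op C i j) f)"
    if "i \<in> idx_set n n" "j \<in> idx_set n n" for i j
    using arg_cong[OF wproj_row_op[OF that], of "\<lambda>P. app P f"] by simp
  have "app T (app (wproj n \<mu>) f) = app (wproj n \<mu>) (app T f)" if "(b, T) \<in> pe_ops n C" for b T
    using that unfolding pe_ops_def by (auto simp: * app_add app_diff)
  then show ?thesis using assms by (fastforce simp: pinv_def)
qed

text \<open>Setting the variables of all columns outside \<open>C\<close> to zero. An inner product
  with an index outside \<open>C\<close> disappears, so this leads back from auxiliary columns to
  the original ones.\<close>

definition kill :: "idx set \<Rightarrow> linop"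
  where "kill C = Abs_linop (lin_ext (\<lambda>\<alpha>. if \<forall>v. snd v \<notin> C \<longrightarrow> \<alpha> v = 0 then single \<alpha> 1 else 0))"

lemma kill_single: "app (kill C) (single \<alpha> c) = (if \<forall>v. snd v \<notin> C \<longrightarrow> \<alpha> v = 0 then single \<alpha> c else 0)"
proof -
  have "app (kill C) (single \<alpha> c)
    = c *\<^sub>C (if \<forall>v. snd v \<notin> C \<longrightarrow> \<alpha> v = 0 then single \<alpha> 1 else 0)"
    by (simp only: kill_def Abs_linop_inverse mem_Collect_eq clinear_lin_ext lin_ext_single)
  then show ?thesis
    by (simp only: if_distrib[of "cscale c"] cscale_single mult_1_right cvec.scale_zero_right)
qed

lemma kill_mul: "kill C * mul (i, s) = (if s \<in> C then mul (i, s) * kill C else 0)"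
proof (rule linop_eqI)
  fix \<alpha> :: mono
  have "(\<forall>v. snd v \<notin> C \<longrightarrow> (\<alpha>((i, s) := Suc (\<alpha> (i, s)))) v = 0) \<longleftrightarrow> s \<in> C \<and> (\<forall>v. snd v \<notin> C \<longrightarrow> \<alpha> v = 0)"
    by (auto simp del: fun_upd_apply) (auto split: if_splits)
  then show "app (kill C * mul (i, s)) (single \<alpha> 1) = app (if s \<in> C then mul (i, s) * kill C else 0) (single \<alpha> 1)"
    by (auto simp: app_mul_single kill_single simp del: fun_upd_apply split_paired_All)
qed

lemma kill_gram: "kill C * gram n s t = (if s \<in> C \<and> t \<in> C then gram n s t * kill C else 0)"
proof -
  have "kill C * (mul (i, s) * mul (j, t)) = (if s \<in> C \<and> t \<in> C then mul (i, s) * mul (j, t) * kill C else 0)" for i j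
    by (auto simp: kill_mul mult.assoc simp flip: mult.assoc[of "kill C"])
  then show ?thesis
    by (auto simp: gram_def sum_distrib_left sum_distrib_right distrib_left distrib_right signed_mult signed_add)
qed

lemma gram_span_kill: "f \<in> gram_span n C' \<Longrightarrow> app (kill C) f \<in> gram_span n C"
proof (induction rule: gram_span.induct)
  case gram_span_vac
  have "app (kill C) vac = vac" by (simp add: vac_def kill_single)
  then show ?case by (simp add: gram_span.gram_span_vac)
next
  case (gram_span_gram f s t)
  have "app (kill C) (app (gram n s t) f) = (if s \<in> C \<and> t \<in> C then app (gram n s t) (app (kill C) f) else 0)"
    using arg_cong[OF kill_gram, of "\<lambda>P. app P f" C n s t] by (simp split: if_splits)
  then show ?case using gram_span_gram by (auto intro: gram_span.gram_span_gram gram_span_0)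
qed (auto simp: app_add app_scale intro: gram_span.intros)

lemma kill_id:
  assumes "\<And>\<alpha> v. \<alpha> \<in> keys f \<Longrightarrow> snd v \<notin> C \<Longrightarrow> \<alpha> v = 0"
  shows "app (kill C) f = f"
proof -
  have "app (kill C) f = (\<Sum>\<alpha>\<in>keys f. lookup f \<alpha> *\<^sub>C app (kill C) (single \<alpha> 1))"
    by (subst (1) free_decomp[of f, symmetric]) (simp add: app_sum_right app_scale del: cscale_single)
  also have "\<dots> = (\<Sum>\<alpha>\<in>keys f. lookup f \<alpha> *\<^sub>C single \<alpha> 1)"
    by (rule sum.cong) (use assms in \<open>auto simp: kill_single simp del: cscale_single\<close>)
  finally show ?thesis unfolding free_decomp .
qed

lemma fock_invariants:
  assumes keys: "\<And>\<alpha>. \<alpha> \<in> keys f \<Longrightarrow> legal n \<alpha> \<and> (\<forall>v. snd v \<notin> idx_set p q \<longrightarrow> \<alpha> v = 0)"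
    and inv: "pinv n (idx_set p q) f"
  shows "f \<in> gram_span n (idx_set p q)"
proof -
  \<comment> \<open>A bound for the odd column degree of every monomial of f. Adding m empty even
    columns therefore meets the cardinality condition of \<open>weight_invariants\<close>.\<close>
  define m where "m = (\<Sum>\<alpha>\<in>keys f. \<Sum>s=1..q. col n \<alpha> (B s))"
  define N where "N = p + m"
  have sub: "idx_set p q \<subseteq> idx_set N q" by (auto simp: idx_set_def N_def)
  have col0: "col n \<alpha> s = 0" if "\<alpha> \<in> keys f" "s \<notin> idx_set p q" for \<alpha> s
    using keys[OF that(1)] that(2) by (simp add: col_def)
  have "app (wproj n \<mu>) f \<in> gram_span n (idx_set N q)" if \<mu>: "\<mu> \<in> col n ` keys f" for \<mu>
  proof -
    from \<mu> obtain \<alpha> where \<alpha>: "\<alpha> \<in> keys f" "\<mu> = col n \<alpha>" by auto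
    have wt: "has_wt n \<mu> (app (wproj n \<mu>) f)"
      using keys by (auto simp: has_wt_def in_keys_iff lookup_wproj split: if_splits)
    have z: "\<mu> s = 0" if "s \<notin> idx_set p q" for s using col0[OF \<alpha>(1) that] \<alpha>(2) by simp
    show ?thesis
    proof (rule weight_invariants[OF wt])
      show "pinv n (idx_set N q) (app (wproj n \<mu>) f)"
        using pinv_mono[OF sub _ wt] z pinv_wproj[OF inv] by auto
      show "\<mu> s = 0" if "s \<notin> idx_set N q" for s using z sub that by blast
      have "(\<Sum>s=1..q. \<mu> (B s)) \<le> m"
        unfolding m_def \<alpha>(2) using \<alpha>(1) by (intro member_le_sum) auto
      also have "m = card {p<..N}" by (simp add: N_def)
      also have "\<dots> \<le> card {s \<in> {1..N}. \<mu> (U s) = 0}"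
        by (rule card_mono) (auto simp: z)
      finally show "(\<Sum>s=1..q. \<mu> (B s)) \<le> card {s \<in> {1..N}. \<mu> (U s) = 0}" .
    qed
  qed
  then have "(\<Sum>\<mu>\<in>col n ` keys f. app (wproj n \<mu>) f) \<in> gram_span n (idx_set N q)"
    by (rule gram_span_sum)
  also have "(\<Sum>\<mu>\<in>col n ` keys f. app (wproj n \<mu>) f) = f"
  proof (rule poly_mapping_eqI)
    show "lookup (\<Sum>\<mu>\<in>col n ` keys f. app (wproj n \<mu>) f) \<gamma> = lookup f \<gamma>" for \<gamma>
      by (auto simp: lookup_sum lookup_wproj in_keys_iff)
  qed
  finally have "app (kill (idx_set p q)) f \<in> gram_span n (idx_set p q)" by (rule gram_span_kill)
  moreover have "app (kill (idx_set p q)) f = f" by (rule kill_id) (use keys in auto)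
  ultimately show ?thesis by simp
qed

section \<open>Transfer to the symmetric algebra\<close>

lemma row_op_mul:
  assumes "finite C" "s \<in> C"
  shows "row_op C k j * mul (a, s) = signed ((oi k \<noteq> oi j) \<and> odv (a, s)) (mul (a, s) * row_op C k j) + (if j = a then mul (k, s) else 0)"
proof -
  have *: "mul (k, c) * der (j, c) * mul (a, s) = signed ((oi k \<noteq> oi j) \<and> odv (a, s)) (mul (a, s) * (mul (k, c) * der (j, c)))
     + (if c = s then if j = a then mul (k, s) else 0 else 0)" for c
  proof -
    have "mul (k, c) * der (j, c) * mul (a, s) = mul (k, c) * (der (j, c) * mul (a, s))" by (simp add: mult.assoc)
    also have "\<dots> = signed (odv (j, c) \<and> odv (a, s)) (mul (k, c) * mul (a, s) * der (j, c)) + (if c = s then if j = a then mul (k, s) else 0 else 0)"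
      unfolding der_mul by (auto simp: signed_def distrib_left right_diff_distrib mult.assoc)
    also have "mul (k, c) * mul (a, s) = signed (odv (k, c) \<and> odv (a, s)) (mul (a, s) * mul (k, c))"
      using mul_mul[of "(k, c)" "(a, s)"] by (auto simp: signed_def)
    finally show ?thesis by (cases "oi k"; cases "oi j"; cases "oi c") (simp_all add: odv_iff signed_def mult.assoc)
  qed
  have "row_op C k j * mul (a, s) = (\<Sum>c\<in>C. mul (k, c) * der (j, c) * mul (a, s))"
    by (simp add: row_op_def sum_distrib_right)
  also have "\<dots> = signed ((oi k \<noteq> oi j) \<and> odv (a, s)) (mul (a, s) * row_op C k j) + (if j = a then mul (k, s) else 0)"
    unfolding * using assms by (simp add: sum.distrib row_op_def sum_distrib_left flip: signed_sum)
  finally show ?thesis .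
qed

lemma clinear_sum: "clinear f \<Longrightarrow> f (sum g A) = (\<Sum>x\<in>A. f (g x))"
  by (induction A rule: infinite_finite_induct) (simp_all add: clinear_0 clinear_add)

lemma dual_act_add: "dual_act (C + C') = dual_act C + dual_act C'"
  and dual_act_diff: "dual_act (C - C') = dual_act C - dual_act C'"
proof -
  show "dual_act (C + C') = dual_act C + dual_act C'"
    by (rule gl_eqI, rule dual_eqI) (simp add: gl_apply_dual_act gl_apply_plus even_part_add odd_part_add dual_apply_add algebra_simps)
  show "dual_act (C - C') = dual_act C - dual_act C'"
    by (rule gl_eqI, rule dual_eqI) (simp add: gl_apply_dual_act gl_apply_minus even_part_diff odd_part_diff dual_apply_diff algebra_simps)
qed

section \<open>Coordinates and the representation on superpolynomials\<close>

locale bases =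
  fixes n p q :: nat
    and e :: "idx \<Rightarrow> 'v::superspace" and e' :: "idx \<Rightarrow> 'v sdual"
    and w :: "idx \<Rightarrow> 'w::superspace"
  assumes e: "homogeneous_basis (idx_set n n) e"
    and e': "dual_basis (idx_set n n) e e'"
    and w: "homogeneous_basis (idx_set p q) w"
begin

abbreviation "rows \<equiv> idx_set n n"
abbreviation "cols \<equiv> idx_set p q"

definition wc :: "idx \<Rightarrow> 'w \<Rightarrow> complex"
  where "wc s y = cvec.representation (w ` cols) y (w s)"

lemma wind: "cvec.independent (w ` cols)" "cvec.span (w ` cols) = UNIV" "inj_on w cols"
  using w by (auto simp: homogeneous_basis_def)

lemma clinear_wc: "clinear (wc s)"
  by (rule clinearI) (simp_all add: wc_def cvec.representation_add cvec.representation_scale wind)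

lemma wc_w: "s \<in> cols \<Longrightarrow> t \<in> cols \<Longrightarrow> wc s (w t) = (if s = t then 1 else 0)"
  using wind(3) by (auto simp: wc_def cvec.representation_basis[OF wind(1)] inj_on_def)

lemma wc_expand: "(\<Sum>s\<in>cols. wc s y *\<^sub>C w s) = y"
proof -
  have "(\<Sum>b\<in>w ` cols. cvec.representation (w ` cols) y b *\<^sub>C b) = y"
    by (rule cvec.sum_representation_eq) (use wind in auto)
  then show ?thesis by (simp add: wc_def sum.reindex[OF wind(3)])
qed

lemma par_e: "i \<in> rows \<Longrightarrow> even_part (e i) = (if oi i then 0 else e i)"
  and par_w: "s \<in> cols \<Longrightarrow> even_part (w s) = (if oi s then 0 else w s)"
  using e w by (auto simp: homogeneous_basis_def has_parity_def)

lemma par_e': "i \<in> rows \<Longrightarrow> even_part (e' i) = (if oi i then 0 else e' i)"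
  using dual_basis_parity[OF e e'] by (auto simp: has_parity_def)

lemma wc_even_part: "s \<in> cols \<Longrightarrow> wc s (even_part y) = (if oi s then 0 else wc s y)"
proof -
  assume s: "s \<in> cols"
  have "wc s (even_part y) = wc s (even_part (\<Sum>t\<in>cols. wc t y *\<^sub>C w t))" by (simp add: wc_expand)
  also have "\<dots> = (\<Sum>t\<in>cols. wc t y * wc s (even_part (w t)))"
    by (simp add: clinear_sum[OF clinear_even_part] clinear_sum[OF clinear_wc] clinear_scale[OF clinear_even_part]
        clinear_scale[OF clinear_wc])
  also have "\<dots> = (\<Sum>t\<in>cols. if t = s then (if oi s then 0 else wc s y) else 0)"
    using s by (intro sum.cong refl) (auto simp: par_w wc_w clinear_0[OF clinear_wc])
  also have "\<dots> = (if oi s then 0 else wc s y)" using s by simp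
  finally show ?thesis .
qed

lemma dual_expand: "(\<Sum>i\<in>rows. dual_apply f (e i) *\<^sub>C e' i) = f"
proof (rule dual_eqI)
  fix v
  have s: "dual_apply (sum g X) v = (\<Sum>i\<in>X. dual_apply (g i) v)" for g :: "idx \<Rightarrow> 'v sdual" and X v
    by (induction X rule: infinite_finite_induct) simp_all
  have "v \<in> cvec.span (e ` rows)" using e by (simp add: homogeneous_basis_def)
  then show "dual_apply (\<Sum>i\<in>rows. dual_apply f (e i) *\<^sub>C e' i) v = dual_apply f v"
  proof (induction rule: cvec.span_induct_alt)
    case (step c x y)
    then obtain j where j: "j \<in> rows" "x = e j" by auto
    have "dual_apply (\<Sum>i\<in>rows. dual_apply f (e i) *\<^sub>C e' i) (e j) = (\<Sum>i\<in>rows. if i = j then dual_apply f (e j) else 0)"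
      unfolding s using e' j(1) by (intro sum.cong refl) (auto simp: dual_basis_def)
    then show ?case using step(2) j by (simp add: dual_apply_add dual_apply_scale)
  qed simp
qed

text \<open>Coordinates come from the universal property of the tensor product;
  \<open>coord_basis\<close> and \<open>coord_expand\<close> together then say that the elements
  \<open>e' i \<otimes>\<^sub>s w s\<close> form a basis.\<close>

definition coord :: "var \<Rightarrow> ('v sdual, 'w) stensor \<Rightarrow> complex"
  where "coord a = tensor_ext (\<lambda>f y. dual_apply f (e (fst a)) * wc (snd a) y)"

lemma bilin_coord: "bilin (\<lambda>f y. dual_apply f (e (fst a)) * wc (snd a) y)"
  unfolding bilin_def
  by (auto intro!: clinearI simp: clinear_add[OF clinear_wc] clinear_scale[OF clinear_wc] algebra_simps)

lemma clinear_coord: "clinear (coord a)"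
  unfolding coord_def by (rule clinear_tensor_ext[OF bilin_coord])

lemma coord_tensor: "coord (i, s) (f \<otimes>\<^sub>s y) = dual_apply f (e i) * wc s y"
  using tensor_ext_tensor[OF bilin_coord, of "(i, s)" f y] by (simp add: coord_def)

lemma coord_basis: "i \<in> rows \<Longrightarrow> j \<in> rows \<Longrightarrow> s \<in> cols \<Longrightarrow> t \<in> cols \<Longrightarrow>
   coord (i, s) (e' j \<otimes>\<^sub>s w t) = (if i = j \<and> s = t then 1 else 0)"
  using e' by (auto simp: coord_tensor wc_w dual_basis_def)

definition xb :: "var \<Rightarrow> ('v sdual, 'w) stensor"
  where "xb a = e' (fst a) \<otimes>\<^sub>s w (snd a)"

lemma coord_expand: "(\<Sum>a\<in>rows \<times> cols. coord a u *\<^sub>C xb a) = u"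
proof (rule tensor_clinear_eqI[where H = "\<lambda>u. u"])
  show "clinear (\<lambda>u. \<Sum>a\<in>rows \<times> cols. coord a u *\<^sub>C xb a)"
    by (rule clinearI) (simp_all add: clinear_add[OF clinear_coord] clinear_scale[OF clinear_coord]
       cscale_add_left sum.distrib cvec.scale_sum_right)
  show "clinear (\<lambda>u :: ('v sdual, 'w) stensor. u)" by (rule clinearI) simp_all
  fix f y
  have l: "sum g X \<otimes>\<^sub>s y = (\<Sum>i\<in>X. g i \<otimes>\<^sub>s y)" for g :: "idx \<Rightarrow> 'v sdual" and X and y :: 'w
    by (induction X rule: infinite_finite_induct) (simp_all add: tensor_add_left)
  have r: "x \<otimes>\<^sub>s sum g X = (\<Sum>i\<in>X. x \<otimes>\<^sub>s g i)" for g :: "idx \<Rightarrow> 'w" and X and x :: "'v sdual"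
    by (induction X rule: infinite_finite_induct) (simp_all add: tensor_add_right)
  have "f \<otimes>\<^sub>s y = (\<Sum>i\<in>rows. dual_apply f (e i) *\<^sub>C e' i) \<otimes>\<^sub>s (\<Sum>s\<in>cols. wc s y *\<^sub>C w s)"
    by (simp add: dual_expand wc_expand)
  also have "\<dots> = (\<Sum>i\<in>rows. \<Sum>s\<in>cols. coord (i, s) (f \<otimes>\<^sub>s y) *\<^sub>C xb (i, s))"
    by (simp add: l r tensor_scale_left tensor_scale_right coord_tensor xb_def cvec.scale_sum_right mult.commute)
      (rule sum.swap)
  finally show "(\<Sum>a\<in>rows \<times> cols. coord a (f \<otimes>\<^sub>s y) *\<^sub>C xb a) = f \<otimes>\<^sub>s y"
    by (simp add: sum.cartesian_product split_def)
qed

lemma coord_even_part: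
  assumes "a \<in> rows \<times> cols"
  shows "coord a (even_part u) = (if odv a then 0 else coord a u)"
proof -
  obtain i s where a: "a = (i, s)" "i \<in> rows" "s \<in> cols" using assms by auto
  show ?thesis
  proof (rule tensor_clinear_eqI[where G = "\<lambda>u. coord a (even_part u)"])
    show "clinear (\<lambda>u. coord a (even_part u))" by (rule clinear_comp[OF clinear_coord clinear_even_part])
    show "clinear (\<lambda>u. if odv a then 0 else coord a u)"
      by (rule clinearI) (simp_all add: clinear_add[OF clinear_coord] clinear_scale[OF clinear_coord])
    fix x y
    have o: "dual_apply (odd_part x) (e i) = (if oi i then dual_apply x (e i) else 0)" "wc s (odd_part y) = (if oi s then wc s y else 0)"
      using a by (auto simp: odd_part_def dual_apply_even_part par_e wc_even_part clinear_diff[OF clinear_wc])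
    show "coord a (even_part (x \<otimes>\<^sub>s y)) = (if odv a then 0 else coord a (x \<otimes>\<^sub>s y))"
      using a by (simp add: even_part_tensor clinear_add[OF clinear_coord] coord_tensor o dual_apply_even_part par_e wc_even_part odv_iff)
  qed
qed

lemma coord_parity: "a \<in> rows \<times> cols \<Longrightarrow> has_parity k u \<Longrightarrow> coord a u \<noteq> 0 \<Longrightarrow> odv a = odd k"
  using coord_even_part[of a u] by (auto simp: has_parity_def clinear_0[OF clinear_coord] split: if_splits)

lemma xb_parity: "a \<in> rows \<times> cols \<Longrightarrow> has_parity (of_bool (odv a)) (xb a)"
  by (cases a) (auto simp: has_parity_def xb_def even_part_tensor par_e' par_w odd_part_def odv_iff)

lemma grade_inv_xb: "a \<in> rows \<times> cols \<Longrightarrow> grade_inv (xb a) = signed (odv a) (xb a)"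
  using grade_inv_parity[OF xb_parity, of a] by (auto simp: signed_def)

definition Zu :: "('v sdual, 'w) stensor \<Rightarrow> linop"
  where "Zu u = (\<Sum>a\<in>rows \<times> cols. coord a u *\<^sub>C mul a)"

lemma clinear_Zu: "clinear Zu"
  unfolding Zu_def
  by (rule clinearI) (simp_all add: clinear_add[OF clinear_coord] clinear_scale[OF clinear_coord]
       cscale_add_left sum.distrib cvec.scale_sum_right)

lemma Zu_xb: "a \<in> rows \<times> cols \<Longrightarrow> Zu (xb a) = mul a"
proof -
  assume a: "a \<in> rows \<times> cols"
  have "Zu (xb a) = (\<Sum>b\<in>rows \<times> cols. if b = a then mul a else 0)"
    unfolding Zu_def by (rule sum.cong) (use a in \<open>auto simp: xb_def coord_basis split: if_splits\<close>)
  then show ?thesis using a by simp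
qed

lemma xb_eqI:
  fixes F H :: "('v sdual, 'w) stensor \<Rightarrow> 'z::cvector"
  assumes "clinear F" "clinear H" "\<And>a. a \<in> rows \<times> cols \<Longrightarrow> F (xb a) = H (xb a)"
  shows "F u = H u"
proof -
  have "F (\<Sum>a\<in>rows \<times> cols. coord a u *\<^sub>C xb a) = H (\<Sum>a\<in>rows \<times> cols. coord a u *\<^sub>C xb a)"
    by (simp only: clinear_sum[OF assms(1)] clinear_sum[OF assms(2)] clinear_scale[OF assms(1)] clinear_scale[OF assms(2)] assms(3) cong: sum.cong)
  then show ?thesis by (simp add: coord_expand)
qed

text \<open>Nonzero coordinates of a homogeneous element sit at variables of its own parity, which
  reduces the claim to \<open>mul_mul\<close>. This is what makes \<open>rho\<close> vanish on the
  defining relations of the symmetric algebra.\<close>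

lemma Zu_supercommute:
  assumes "has_parity k u" "has_parity l v"
  shows "Zu u * Zu v = (-1) ^ (k * l) *\<^sub>C (Zu v * Zu u)"
proof -
  have "Zu u * Zu v = (\<Sum>a\<in>rows \<times> cols. \<Sum>b\<in>rows \<times> cols. (coord a u * coord b v) *\<^sub>C (mul a * mul b))"
    by (simp add: Zu_def sum_product linop_cscale_mult mult.commute)
  also have "\<dots> = (\<Sum>a\<in>rows \<times> cols. \<Sum>b\<in>rows \<times> cols. ((-1) ^ (k * l) * (coord a u * coord b v)) *\<^sub>C (mul b * mul a))"
  proof (intro sum.cong refl)
    fix a b assume ab: "a \<in> rows \<times> cols" "b \<in> rows \<times> cols"
    show "(coord a u * coord b v) *\<^sub>C (mul a * mul b) = ((-1) ^ (k * l) * (coord a u * coord b v)) *\<^sub>C (mul b * mul a)"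
    proof (cases "coord a u = 0 \<or> coord b v = 0")
      case False
      then have "odv a = odd k" "odv b = odd l" using coord_parity assms ab by blast+
      then show ?thesis using mul_mul[of a b] by (auto simp: uminus_power_if)
    qed auto
  qed
  also have "\<dots> = (-1) ^ (k * l) *\<^sub>C (Zu v * Zu u)"
    unfolding Zu_def sum_product by (subst sum.swap) (simp add: linop_cscale_mult cvec.scale_sum_right mult_ac)
  finally show ?thesis .
qed

definition wordop :: "('v sdual, 'w) stensor list \<Rightarrow> linop"
  where "wordop us = prod_list (map Zu us)"

definition rho :: "('v sdual, 'w) stensor free_alg \<Rightarrow> linop"
  where "rho = lin_ext (\<lambda>m. wordop (letters m))"

lemma clinear_rho: "clinear rho"
  unfolding rho_def by (rule clinear_lin_ext)

lemma rho_mult: "rho (a * b) = rho a * rho b"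
proof (rule free_mult_eqI[of "\<lambda>a b. rho (a * b)" "\<lambda>a b. rho a * rho b"])
  show "bilin (\<lambda>a b. rho (a * b))" by (rule bilin_free_comp_mult[OF clinear_rho])
  show "bilin (\<lambda>a b. rho a * rho b)"
    unfolding bilin_def
    by (auto intro!: clinearI simp: clinear_add[OF clinear_rho] clinear_scale[OF clinear_rho] algebra_simps linop_cscale_mult)
qed (simp add: mult_single rho_def plus_fword_def wordop_def)

lemma rho_gen: "rho (fgen u) = Zu u"
  by (simp add: rho_def fgen_def wordop_def)

lemma rho_relator:
  assumes "r \<in> sym_relators" shows "rho r = 0"
  using assms
proof (cases r rule: sym_relators_cases)
  case (commute k l u v)
  then show ?thesis
    by (simp add: clinear_diff[OF clinear_rho] clinear_scale[OF clinear_rho] rho_mult rho_gen Zu_supercommute[OF commute(1,2)])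
qed (simp_all add: clinear_diff[OF clinear_rho] clinear_scale[OF clinear_rho] rho_gen clinear_add[OF clinear_Zu] clinear_scale[OF clinear_Zu])

text \<open>The superpolynomial of an element: its multiplication operator applied to the constant
  1. The choice of a representative is immaterial by \<open>Phi_abs\<close>.\<close>

definition Phi :: "('v sdual, 'w) stensor symalg \<Rightarrow> fock"
  where "Phi s = app (rho (rep_symalg s)) vac"

lemma Phi_abs: "Phi (abs_symalg a) = app (rho a) vac"
proof -
  have "rho (rep_symalg (abs_symalg a)) = rho a"
  proof (rule free_span_cong[OF clinear_rho])
    show "rep_symalg (abs_symalg a) - a \<in> cvec.span {x * r * y | x r y. r \<in> sym_relators}"
      using Quotient_rep_abs[OF Quotient_symalg, of a] equivp_reflp[OF symalg_equivp]
      by (simp add: sym_rel_def sym_ideal_def)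
  qed (auto simp: rho_mult rho_relator)
  then show ?thesis by (simp add: Phi_def)
qed

lemma clinear_Phi: "clinear Phi"
proof (rule clinearI)
  show "Phi (s + t) = Phi s + Phi t" for s t
    by (cases s rule: symalg_cases, cases t rule: symalg_cases)
      (simp add: plus_symalg.abs_eq Phi_abs clinear_add[OF clinear_rho])
  show "Phi (c *\<^sub>C s) = c *\<^sub>C Phi s" for c s
    by (cases s rule: symalg_cases)
      (simp add: cscale_symalg.abs_eq Phi_abs clinear_scale[OF clinear_rho])
qed

lemma Phi_gen_mult: "Phi (sym_gen u * s) = app (Zu u) (Phi s)"
  by (cases s rule: symalg_cases) (simp add: sym_gen.abs_eq times_symalg.abs_eq Phi_abs rho_mult rho_gen)

lemma Phi_1: "Phi 1 = vac"
proof -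
  have "(1 :: ('v sdual, 'w) stensor symalg) = abs_symalg (single (FWord []) 1)"
    by (simp add: abs_symalg_word sym_word_def)
  then have "Phi 1 = Phi (abs_symalg (single (FWord []) 1))" by (rule arg_cong)
  then have "Phi 1 = app (rho (single (FWord []) 1)) vac" unfolding Phi_abs .
  then show ?thesis by (simp add: rho_def wordop_def)
qed

lemma sym_word_Nil: "sym_word [] = 1" and sym_word_Cons: "sym_word (u # us) = sym_gen u * sym_word us"
  by (simp_all add: sym_word_def)

lemma symalg_word_induct:
  assumes "clinear F" "clinear H" "\<And>us. F (sym_word us) = H (sym_word us)"
  shows "F s = H s"
proof -
  obtain a where s: "s = abs_symalg a" by (rule symalg_cases)
  have "F (abs_symalg a) = H (abs_symalg a)"
  proof (rule free_clinear_eqI[of "\<lambda>a. F (abs_symalg a)" "\<lambda>a. H (abs_symalg a)"])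
    show "clinear (\<lambda>a. F (abs_symalg a))" "clinear (\<lambda>a. H (abs_symalg a))"
      by (rule clinear_comp[OF assms(1) clinear_abs_symalg], rule clinear_comp[OF assms(2) clinear_abs_symalg])
    fix k show "F (abs_symalg (single k 1)) = H (abs_symalg (single k 1))"
      using assms(3)[of "letters k"] by (simp flip: abs_symalg_word)
  qed
  then show ?thesis by (simp add: s)
qed

text \<open>\<open>T\<close> is the operator on \<open>fock\<close> that corresponds to the action of \<open>X\<close>, of parity \<open>b\<close>.\<close>
definition matches :: "bool \<Rightarrow> linop \<Rightarrow> 'v gl \<Rightarrow> bool"
  where "matches b T X \<longleftrightarrow> even_part X = (if b then 0 else X) \<and> app T vac = 0 \<and>
    (\<forall>a\<in>rows \<times> cols. T * mul a = signed (b \<and> odv a) (mul a * T) + Zu (gl_apply (dual_act X) (e' (fst a)) \<otimes>\<^sub>s w (snd a)))"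

text \<open>Both sides obey the same Leibniz rule on words of generators and vanish on the empty
  word, so commuting \<open>T\<close> with one generator settles the claim.\<close>

lemma Phi_intertwine:
  assumes "matches b T X"
  shows "Phi (sym_act (leibniz (dual_act X) 0) s) = app T (Phi s)"
proof -
  let ?X = "leibniz (dual_act X) (0 :: 'w gl)"
  have parts: "even_part ?X = (if b then 0 else ?X)" "odd_part ?X = (if b then ?X else 0)"
  proof -
    have z: "leibniz (dual_act (0 :: 'v gl)) (0 :: 'w gl) = 0"
      by (rule gl_eqI, rule tensor_clinear_eqI[OF clinear_gl_apply clinear_gl_apply])
        (simp add: gl_apply_leibniz dual_act_diff[of 0 0, simplified])
    show "even_part ?X = (if b then 0 else ?X)"
      using assms z by (simp add: matches_def leibniz_parts dual_act_parts)
    then show "odd_part ?X = (if b then ?X else 0)" by (simp add: odd_part_def)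
  qed
  have gen: "T * Zu u = Zu (gl_apply ?X u) + Zu (if b then grade_inv u else u) * T" for u
  proof (rule xb_eqI[where F = "\<lambda>u. T * Zu u"])
    show "clinear (\<lambda>u. T * Zu u)"
      by (rule clinearI) (simp_all add: clinear_add[OF clinear_Zu] clinear_scale[OF clinear_Zu] distrib_left linop_cscale_mult)
    show "clinear (\<lambda>u. Zu (gl_apply ?X u) + Zu (if b then grade_inv u else u) * T)"
      by (rule clinearI) (simp_all add: clinear_add[OF clinear_Zu] clinear_scale[OF clinear_Zu] gl_apply_add gl_apply_scale
         grade_inv_add grade_inv_scale distrib_right linop_cscale_mult cscale_add_right)
    fix a assume a: "a \<in> rows \<times> cols"
    have neg: "Zu (- u) = - Zu u" for u using clinear_diff[OF clinear_Zu, of 0 u] clinear_0[OF clinear_Zu] by simp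
    have X: "gl_apply ?X (xb a) = gl_apply (dual_act X) (e' (fst a)) \<otimes>\<^sub>s w (snd a)"
      by (simp add: xb_def gl_apply_leibniz)
    show "T * Zu (xb a) = Zu (gl_apply ?X (xb a)) + Zu (if b then grade_inv (xb a) else xb a) * T"
      using assms a unfolding matches_def X Zu_xb[OF a]
      by (cases "odv a") (auto simp: grade_inv_xb[OF a] neg Zu_xb[OF a] signed_def)
  qed
  have word: "Phi (der_word ?X us) = app T (Phi (sym_word us))" for us
  proof (induction us)
    case Nil
    then show ?case using assms by (simp add: clinear_0[OF clinear_Phi] sym_word_Nil Phi_1 matches_def)
  next
    case (Cons u us)
    have "app T (Phi (sym_word (u # us))) = app (T * Zu u) (Phi (sym_word us))"
      by (simp add: sym_word_Cons Phi_gen_mult)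
    also have "\<dots> = app (Zu (gl_apply ?X u)) (Phi (sym_word us)) + app (Zu (if b then grade_inv u else u)) (app T (Phi (sym_word us)))"
      unfolding gen by simp
    also have "\<dots> = Phi (der_word ?X (u # us))"
      by (cases b) (simp_all add: parts Phi_gen_mult clinear_add[OF clinear_Phi] Cons.IH)
    finally show ?case ..
  qed
  show ?thesis
  proof (rule symalg_word_induct[where F = "\<lambda>s. Phi (sym_act ?X s)"])
    show "clinear (\<lambda>s. Phi (sym_act ?X s))" by (rule clinear_comp[OF clinear_Phi clinear_sym_act])
    show "clinear (\<lambda>s. app T (Phi s))" by (rule clinear_comp[OF clinear_app clinear_Phi])
    show "Phi (sym_act ?X (sym_word us)) = app T (Phi (sym_word us))" for us
      using word by (simp add: sym_act_abs free_der_def flip: abs_symalg_word)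
  qed
qed

end

lemma grade_inv_signed: "even_part x = (if b then 0 else x) \<Longrightarrow> grade_inv x = signed b x"
  by (auto simp: grade_inv_def odd_part_def signed_def split: if_splits)

lemma tensor_if: "(if c then x else 0) \<otimes>\<^sub>s y = (if c then x \<otimes>\<^sub>s y else 0)"
  "x \<otimes>\<^sub>s (if c then y else 0) = (if c then x \<otimes>\<^sub>s y else 0)"
  by simp_all

lemma prod_list_0: "0 \<in> set xs \<Longrightarrow> prod_list xs = 0" for xs :: "'a::ring_1 list"
  by (induction xs) auto

definition supported :: "nat \<Rightarrow> idx set \<Rightarrow> fock \<Rightarrow> bool"
  where "supported n C f \<longleftrightarrow> (\<forall>\<alpha>\<in>keys f. legal n \<alpha> \<and> (\<forall>v. snd v \<notin> C \<longrightarrow> \<alpha> v = 0))"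

lemma supported_0: "supported n C 0" and supported_vac: "supported n C vac"
  by (auto simp: supported_def vac_def legal_def)

lemma supported_add: "supported n C f \<Longrightarrow> supported n C g \<Longrightarrow> supported n C (f + g)"
  using Poly_Mapping.keys_add[of f g] by (fastforce simp: supported_def)

lemma supported_scale: "supported n C f \<Longrightarrow> supported n C (c *\<^sub>C f)"
  by (auto simp: supported_def in_keys_iff lookup_cscale)

lemma supported_sum: "(\<And>x. x \<in> A \<Longrightarrow> supported n C (g x)) \<Longrightarrow> supported n C (sum g A)"
  by (induction A rule: infinite_finite_induct) (auto intro: supported_0 supported_add)

lemma supported_mul:
  assumes "supported n C f" "a \<in> idx_set n n \<times> C"
  shows "supported n C (app (mul a) f)"
  unfolding supported_def
proof
  fix \<gamma> assume "\<gamma> \<in> keys (app (mul a) f)"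
  note k = keys_mul[OF this]
  let ?\<alpha> = "\<gamma>(a := \<gamma> a - 1)"
  have "legal n ?\<alpha> \<and> (\<forall>v. snd v \<notin> C \<longrightarrow> ?\<alpha> v = 0)"
    using assms(1) k(3) unfolding supported_def by blast
  then have \<alpha>: "legal n ?\<alpha>" "\<And>v. snd v \<notin> C \<Longrightarrow> ?\<alpha> v = 0" by blast+
  have "odv a \<longrightarrow> \<gamma> a \<le> 1"
  proof
    assume "odv a"
    then have "?\<alpha> a \<le> 1" using \<alpha>(1) unfolding legal_def by blast
    then have "\<gamma> a \<le> 2" by simp
    moreover have "odd (\<gamma> a)" using k(2) \<open>odv a\<close> by blast
    then have "\<gamma> a \<noteq> 2" by (metis even_numeral)
    ultimately show "\<gamma> a \<le> 1" by linarith
  qed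
  then have "legal n \<gamma>" using legal_of_upd[OF \<alpha>(1)] assms(2) by auto
  moreover have "\<gamma> v = 0" if "snd v \<notin> C" for v
  proof -
    have "v \<noteq> a" using assms(2) that by auto
    then show ?thesis using \<alpha>(2)[OF that] by simp
  qed
  ultimately show "legal n \<gamma> \<and> (\<forall>v. snd v \<notin> C \<longrightarrow> \<gamma> v = 0)" by blast
qed

section \<open>Elements of \<open>pe\<close> and their operators\<close>

context bases
begin

text \<open>The sign undoes the factor -(-1)^(p(D)p(f)) of the dual action, evaluated at f =
  \<open>e' b\<close>. In this way the dual action sends \<open>e' b\<close> to \<open>e' a\<close>
  with coefficient 1 in all parities.\<close>

definition elem_gl :: "idx \<Rightarrow> idx \<Rightarrow> 'v gl"
  where "elem_gl a b = Abs_gl (\<lambda>v. signed (oi b \<longrightarrow> oi a) (dual_apply (e' a) v *\<^sub>C e b))"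

lemma elem_gl_apply: "gl_apply (elem_gl a b) v = signed (oi b \<longrightarrow> oi a) (dual_apply (e' a) v *\<^sub>C e b)"
proof -
  have "clinear (\<lambda>v. signed (oi b \<longrightarrow> oi a) (dual_apply (e' a) v *\<^sub>C e b))"
    by (rule clinearI) (auto simp: signed_def dual_apply_add dual_apply_scale cscale_add_left)
  then show ?thesis by (simp add: elem_gl_def Abs_gl_inverse)
qed

lemma elem_gl_even_part:
  assumes "a \<in> rows" "b \<in> rows"
  shows "even_part (elem_gl a b) = (if oi a \<noteq> oi b then 0 else elem_gl a b)"
proof (rule gl_eqI)
  fix v
  have o: "odd_part (e b) = (if oi b then e b else 0)"
    "dual_apply (e' a) (even_part v) = (if oi a then 0 else dual_apply (e' a) v)"
    "dual_apply (e' a) (odd_part v) = (if oi a then dual_apply (e' a) v else 0)"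
    using assms by (auto simp: odd_part_def par_e par_e' dual_apply_diff simp flip: dual_apply_even_part)
  show "gl_apply (even_part (elem_gl a b)) v = gl_apply (if oi a \<noteq> oi b then 0 else elem_gl a b) v"
    using assms by (simp add: gl_apply_even_part elem_gl_apply o par_e signed_def even_part_scale odd_part_scale even_part_uminus odd_part_uminus)
qed

lemma elem_gl_dual_act:
  assumes "a \<in> rows" "b \<in> rows" "k \<in> rows"
  shows "gl_apply (dual_act (elem_gl a b)) (e' k) = (if k = b then e' a else 0)"
proof (rule dual_eqI)
  fix v
  have d: "dual_apply (e' k) (e b) = (if k = b then 1 else 0)" using e' assms by (auto simp: dual_basis_def)
  have d': "dual_apply (e' b) (e b) = 1" using e' assms by (auto simp: dual_basis_def)
  have g: "grade_inv (e' k) = signed (oi k) (e' k)" using par_e'[OF assms(3)] by (rule grade_inv_signed)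
  have n: "dual_apply f (- x) = - dual_apply f x" for f :: "'v sdual" and x using dual_apply_diff[of f 0 x] by simp
  have "odd_part (elem_gl a b) = (if oi a \<noteq> oi b then elem_gl a b else 0)" using elem_gl_even_part[OF assms(1,2)] by (simp add: odd_part_def)
  then show "dual_apply (gl_apply (dual_act (elem_gl a b)) (e' k)) v = dual_apply (if k = b then e' a else 0) v"
    using assms by (auto simp: gl_apply_dual_act elem_gl_even_part elem_gl_apply g signed_def dual_apply_scale d d' n)
qed

lemma matches_elem_gl:
  assumes "i \<in> rows" "j \<in> rows"
  shows "matches (oi i \<noteq> oi j) (row_op cols i j) (elem_gl i j)"
proof -
  have "row_op cols i j * mul a = signed ((oi i \<noteq> oi j) \<and> odv a) (mul a * row_op cols i j) + Zu (gl_apply (dual_act (elem_gl i j)) (e' (fst a)) \<otimes>\<^sub>s w (snd a))"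
    if a: "a \<in> rows \<times> cols" for a
  proof -
    obtain k s where ks: "a = (k, s)" "k \<in> rows" "s \<in> cols" using a by auto
    have "Zu (e' i \<otimes>\<^sub>s w s) = mul (i, s)" using Zu_xb[of "(i, s)"] ks assms by (simp add: xb_def)
    then show ?thesis
      using ks assms by (auto simp: row_op_mul elem_gl_dual_act clinear_0[OF clinear_Zu])
  qed
  then show ?thesis by (simp add: matches_def elem_gl_even_part[OF assms])
qed

lemma matches_add: "matches b T X \<Longrightarrow> matches b T' X' \<Longrightarrow> matches b (T + T') (X + X')"
  and matches_diff: "matches b T X \<Longrightarrow> matches b T' X' \<Longrightarrow> matches b (T - T') (X - X')"
  by (simp_all add: matches_def even_part_add even_part_diff distrib_left distrib_right left_diff_distrib right_diff_distrib
      dual_act_add dual_act_diff gl_apply_plus gl_apply_minus tensor_add_left tensor_diff_left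
      clinear_add[OF clinear_Zu] clinear_diff[OF clinear_Zu] signed_def)

text \<open>The dual action on basis vectors determines the action on \<open>pe_tensor\<close>, so
  membership becomes one identity of tensors. The sign in its last term comes from moving X, of
  parity b, past the odd vector \<open>e' (B k)\<close>.\<close>

lemma pe_I:
  assumes "even_part X = (if b then 0 else X)"
    and d: "\<And>k. k \<in> rows \<Longrightarrow> gl_apply (dual_act X) (e' k) = d k"
    and z: "(\<Sum>k=1..n. d (U k) \<otimes>\<^sub>s e' (B k) + e' (U k) \<otimes>\<^sub>s d (B k)
       + (d (B k) \<otimes>\<^sub>s e' (U k) + signed b (e' (B k) \<otimes>\<^sub>s d (U k)))) = 0"
  shows "X \<in> pe n e'"
proof -
  have p: "even_part (dual_act X) = (if b then 0 else dual_act X)" "odd_part (dual_act X) = (if b then dual_act X else 0)"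
    using assms(1) by (auto simp: dual_act_parts dual_act_diff[of 0 0, simplified] odd_part_def)
  have g: "grade_inv (e' k) = signed (oi k) (e' k)" if "k \<in> rows" for k using par_e'[OF that] by (rule grade_inv_signed)
  have "gl_apply (leibniz (dual_act X) (dual_act X)) (pe_tensor n e') = 
    (\<Sum>k=1..n. d (U k) \<otimes>\<^sub>s e' (B k) + e' (U k) \<otimes>\<^sub>s d (B k)
       + (d (B k) \<otimes>\<^sub>s e' (U k) + signed b (e' (B k) \<otimes>\<^sub>s d (U k))))"
    unfolding pe_tensor_def clinear_sum[OF clinear_gl_apply]
    by (rule sum.cong[OF refl], cases b) (simp_all add: gl_apply_add gl_apply_leibniz p d g tensor_uminus)
  then show ?thesis using z by (simp add: pe_def)
qed

text \<open>Ensures that the image under \<open>Phi\<close> of an invariant satisfies all equations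
  in \<open>pinv\<close>.\<close>

lemma pe_match:
  assumes "(b, T) \<in> pe_ops n cols"
  shows "\<exists>X\<in>pe n e'. matches b T X"
  using assms unfolding pe_ops_def
proof (elim UnE imageE, goal_cases)
  case (1 x)
  then obtain i j where ij: "i \<in> {1..n}" "j \<in> {1..n}" and x: "x = (i, j)" by auto
  let ?X = "elem_gl (U i) (U j) - elem_gl (B j) (B i)"
  have m: "matches False (row_op cols (U i) (U j) - row_op cols (B j) (B i)) ?X"
    using ij matches_elem_gl[of "U i" "U j"] matches_elem_gl[of "B j" "B i"] by (intro matches_diff) auto
  have "?X \<in> pe n e'"
  proof (rule pe_I[of _ False "\<lambda>k. (if k = U j then e' (U i) else 0) - (if k = B i then e' (B j) else 0)"])
    show "even_part ?X = (if False then 0 else ?X)" using m by (simp add: matches_def)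
    show "gl_apply (dual_act ?X) (e' k) = (if k = U j then e' (U i) else 0) - (if k = B i then e' (B j) else 0)" if "k \<in> rows" for k
      using ij that by (simp add: dual_act_diff gl_apply_minus elem_gl_dual_act)
  qed (use ij in \<open>simp add: tensor_uminus tensor_if sum.distrib sum_negf if_distrib[of uminus] cong: if_cong\<close>)
  with m 1 x show ?case by auto
next
  case (2 x)
  then obtain i j where ij: "i \<in> {1..n}" "j \<in> {1..n}" and x: "x = (i, j)" by auto
  let ?X = "elem_gl (U i) (B j) - elem_gl (U j) (B i)"
  have m: "matches True (row_op cols (U i) (B j) - row_op cols (U j) (B i)) ?X"
    using ij matches_elem_gl[of "U i" "B j"] matches_elem_gl[of "U j" "B i"] by (intro matches_diff) auto
  have "?X \<in> pe n e'"
  proof (rule pe_I[of _ True "\<lambda>k. (if k = B j then e' (U i) else 0) - (if k = B i then e' (U j) else 0)"])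
    show "even_part ?X = (if True then 0 else ?X)" using m by (simp add: matches_def)
    show "gl_apply (dual_act ?X) (e' k) = (if k = B j then e' (U i) else 0) - (if k = B i then e' (U j) else 0)" if "k \<in> rows" for k
      using ij that by (simp add: dual_act_diff gl_apply_minus elem_gl_dual_act)
  qed (use ij in \<open>simp add: tensor_diff_left tensor_diff_right tensor_if sum.distrib sum_subtractf\<close>)
  with m 2 x show ?case by auto
next
  case (3 x)
  then obtain i j where ij: "i \<in> {1..n}" "j \<in> {1..n}" and x: "x = (i, j)" by auto
  let ?X = "elem_gl (B i) (U j) + elem_gl (B j) (U i)"
  have m: "matches True (row_op cols (B i) (U j) + row_op cols (B j) (U i)) ?X"
    using ij matches_elem_gl[of "B i" "U j"] matches_elem_gl[of "B j" "U i"] by (intro matches_add) auto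
  have "?X \<in> pe n e'"
  proof (rule pe_I[of _ True "\<lambda>k. (if k = U j then e' (B i) else 0) + (if k = U i then e' (B j) else 0)"])
    show "even_part ?X = (if True then 0 else ?X)" using m by (simp add: matches_def)
    show "gl_apply (dual_act ?X) (e' k) = (if k = U j then e' (B i) else 0) + (if k = U i then e' (B j) else 0)" if "k \<in> rows" for k
      using ij that by (simp add: dual_act_add gl_apply_plus elem_gl_dual_act)
  qed (use ij in \<open>simp add: tensor_add_left tensor_add_right tensor_if sum.distrib sum_subtractf sum_negf\<close>)
  with m 3 x show ?case by auto
qed

lemma Phi_pinv: "a \<in> invariants (pe n e') \<Longrightarrow> pinv n cols (Phi a)"
  unfolding pinv_def
proof (intro ballI, clarify)
  fix b T assume a: "a \<in> invariants (pe n e')" and "(b, T) \<in> pe_ops n cols"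
  then obtain X where X: "X \<in> pe n e'" "matches b T X" using pe_match by blast
  then have "sym_act (leibniz (dual_act X) 0) a = 0" using a by (simp add: invariants_def)
  with Phi_intertwine[OF X(2), of a] show "app T (Phi a) = 0" by (simp add: clinear_0[OF clinear_Phi])
qed

lemma supported_Phi: "supported n cols (Phi s)"
proof -
  have Zu: "supported n cols (app (Zu u) f)" if "supported n cols f" for u f
    unfolding Zu_def app_sum app_simps by (intro supported_sum supported_scale supported_mul that)
  have "supported n cols (app (wordop us) vac)" for us
    by (induction us) (simp_all add: wordop_def supported_vac Zu)
  then have "supported n cols (app (rho a) vac)" for a
    unfolding rho_def lin_ext_def app_sum app_simps by (intro supported_sum supported_scale)
  then show ?thesis by (simp add: Phi_def)
qed

section \<open>From superpolynomials back to the symmetric algebra\<close>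

definition all_vars :: "var list"
  where "all_vars = (SOME all_vars. set all_vars = rows \<times> cols \<and> sorted_wrt (\<lambda>a b. key a < key b) all_vars)"

lemma all_vars: "set all_vars = rows \<times> cols" "sorted_wrt (\<lambda>a b. key a < key b) all_vars"
proof -
  have "finite (rows \<times> cols)" by simp
  then obtain us where us: "set us = rows \<times> cols" "distinct us" using finite_distinct_list by blast
  have "distinct (map key (sort_key key us))"
    using us(2) inj_on_subset[OF inj_key subset_UNIV] by (simp add: distinct_map)
  then have "sorted_wrt (<) (map key (sort_key key us))"
    using strict_sorted_iff[of "map key (sort_key key us)"] by simp
  then have "set (sort_key key us) = rows \<times> cols \<and> sorted_wrt (\<lambda>a b. key a < key b) (sort_key key us)"
    using us(1) by (simp add: sorted_wrt_map)
  then have "set all_vars = rows \<times> cols \<and> sorted_wrt (\<lambda>a b. key a < key b) all_vars"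
    unfolding all_vars_def by (rule someI)
  then show "set all_vars = rows \<times> cols" "sorted_wrt (\<lambda>a b. key a < key b) all_vars" by auto
qed

lemma all_vars_distinct: "distinct all_vars"
  using all_vars(2) by (metis (mono_tags, lifting) distinct_conv_nth less_irrefl linorder_neqE_nat sorted_wrt_iff_nth_less)

abbreviation x :: "var \<Rightarrow> ('v sdual, 'w) stensor symalg"
  where "x a \<equiv> sym_gen (xb a)"

definition monom_prod :: "var list \<Rightarrow> mono \<Rightarrow> ('v sdual, 'w) stensor symalg"
  where "monom_prod us \<alpha> = prod_list (map (\<lambda>v. x v ^ \<alpha> v) us)"

lemma monom_prod_Cons: "monom_prod (v # us) \<alpha> = x v ^ \<alpha> v * monom_prod us \<alpha>"
  by (simp add: monom_prod_def)

text \<open>A monomial becomes the product of its variables in increasing order of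
  \<open>key\<close>, the order on which \<open>koszul_sign\<close> is based. Monomials that involve
  variables outside \<open>rows \<times> cols\<close> are sent to 0 by convention.\<close>

definition Psi :: "fock \<Rightarrow> ('v sdual, 'w) stensor symalg"
  where "Psi = lin_ext (\<lambda>\<alpha>. if \<forall>v. v \<notin> rows \<times> cols \<longrightarrow> \<alpha> v = 0 then monom_prod all_vars \<alpha> else 0)"

lemma clinear_Psi: "clinear Psi"
  unfolding Psi_def by (rule clinear_lin_ext)

lemma x_x:
  assumes "a \<in> rows \<times> cols" "b \<in> rows \<times> cols"
  shows "x a * x b = (if odv a \<and> odv b then - 1 else 1) *\<^sub>C (x b * x a)"
  using sym_gen_supercommute[OF xb_parity[OF assms(1)] xb_parity[OF assms(2)]] by auto

lemma x_pow:
  assumes "a \<in> rows \<times> cols" "b \<in> rows \<times> cols"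
  shows "x a * x b ^ k = (if odv a \<and> odv b then (- 1) ^ k else 1) *\<^sub>C (x b ^ k * x a)"
proof (induction k)
  case (Suc k)
  have "x a * x b ^ Suc k = (x a * x b) * x b ^ k" by (simp add: mult.assoc)
  also have "\<dots> = (if odv a \<and> odv b then - 1 else 1) *\<^sub>C (x b * (x a * x b ^ k))"
    unfolding x_x[OF assms] by (simp add: sym_cscale_mult mult.assoc)
  also have "\<dots> = (if odv a \<and> odv b then (- 1) ^ Suc k else 1) *\<^sub>C (x b ^ Suc k * x a)"
    unfolding Suc.IH by (auto simp: sym_cscale_mult mult.assoc)
  finally show ?case .
qed simp

lemma x_sq: "a \<in> rows \<times> cols \<Longrightarrow> odv a \<Longrightarrow> x a * x a = 0"
proof -
  assume "a \<in> rows \<times> cols" "odv a"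
  then have "x a * x a = - 1 *\<^sub>C (x a * x a)" using x_x[of a a] by simp
  then have "x a * x a = - (x a * x a)" unfolding cvec.scale_minus_left cscale_one .
  then have "x a * x a + x a * x a = 0" by (rule eq_neg_iff_add_eq_0[THEN iffD1])
  then have "2 *\<^sub>C (x a * x a) = 0"
    using cscale_add_left[of 1 1 "x a * x a"] by simp
  then have "(1 / 2) *\<^sub>C 2 *\<^sub>C (x a * x a) = 0" by (simp del: cscale_cscale)
  then show ?thesis by simp
qed

text \<open>On its way to its own place \<open>x a\<close> passes exactly the smaller variables; the
  odd ones among them produce the Koszul sign.\<close>

lemma x_monom_prod:
  assumes "sorted_wrt (\<lambda>a b. key a < key b) us" "a \<in> set us" "set us \<subseteq> rows \<times> cols"
  shows "x a * monom_prod us \<alpha> = prod_list (map (\<lambda>v. if key v < key a \<and> odv a \<and> odv v then (- 1) ^ \<alpha> v else 1) us)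
     *\<^sub>C monom_prod us (\<alpha>(a := Suc (\<alpha> a)))"
  using assms
proof (induction us)
  case (Cons v us)
  show ?case
  proof (cases "v = a")
    case True
    have k: "key a < key u" if "u \<in> set us" for u using Cons.prems(1) that True by simp
    have "map (\<lambda>v. if key v < key a \<and> odv a \<and> odv v then (- 1) ^ \<alpha> v else 1) us = map (\<lambda>_. 1 :: complex) us"
      using k by (intro map_cong refl) (metis less_asym)
    then have 1: "prod_list (map (\<lambda>v. if key v < key a \<and> odv a \<and> odv v then (- 1) ^ \<alpha> v else 1) us) = (1 :: complex)"
      by (simp only: map_replicate_const prod_list_replicate power_one)
    have "map (\<lambda>v. x v ^ (\<alpha>(a := Suc (\<alpha> a))) v) us = map (\<lambda>v. x v ^ \<alpha> v) us"
      using k by (intro map_cong refl) auto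
    then have "monom_prod us (\<alpha>(a := Suc (\<alpha> a))) = monom_prod us \<alpha>" unfolding monom_prod_def by (rule arg_cong)
    then show ?thesis using True 1 by (simp add: monom_prod_Cons mult.assoc fun_upd_same del: fun_upd_apply)
  next
    case False
    then have a: "a \<in> set us" and k: "key v < key a" using Cons.prems by auto
    have va: "v \<in> rows \<times> cols" "a \<in> rows \<times> cols" using Cons.prems a by auto
    have "x a * monom_prod (v # us) \<alpha> = (x a * x v ^ \<alpha> v) * monom_prod us \<alpha>" by (simp add: monom_prod_def mult.assoc)
    also have "\<dots> = (if odv a \<and> odv v then (- 1) ^ \<alpha> v else 1) *\<^sub>C (x v ^ \<alpha> v * (x a * monom_prod us \<alpha>))"
      unfolding x_pow[OF va(2,1)] by (simp add: sym_cscale_mult mult.assoc)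
    also have "x a * monom_prod us \<alpha> = prod_list (map (\<lambda>v. if key v < key a \<and> odv a \<and> odv v then (- 1) ^ \<alpha> v else 1) us)
       *\<^sub>C monom_prod us (\<alpha>(a := Suc (\<alpha> a)))"
      by (rule Cons.IH) (use Cons.prems a in auto)
    finally show ?thesis
      using False k by (simp add: monom_prod_Cons sym_cscale_mult fun_upd_other del: fun_upd_apply)
  qed
qed simp

lemma Psi_mul:
  assumes a: "a \<in> rows \<times> cols"
  shows "Psi (app (mul a) f) = x a * Psi f"
proof (rule free_clinear_eqI[of "\<lambda>f. Psi (app (mul a) f)" "\<lambda>f. x a * Psi f"])
  show "clinear (\<lambda>f. Psi (app (mul a) f))" by (rule clinear_comp[OF clinear_Psi clinear_app])
  show "clinear (\<lambda>f. x a * Psi f)"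
    by (rule clinearI) (simp_all add: clinear_add[OF clinear_Psi] clinear_scale[OF clinear_Psi] distrib_left sym_cscale_mult)
  fix \<alpha> :: mono
  define s where "s \<alpha> \<longleftrightarrow> (\<forall>v. v \<notin> rows \<times> cols \<longrightarrow> \<alpha> v = 0)" for \<alpha> :: mono
  have Psi: "Psi (single \<alpha> c) = (if s \<alpha> then c *\<^sub>C monom_prod all_vars \<alpha> else 0)" for \<alpha> c
    unfolding Psi_def lin_ext_single s_def[symmetric] by simp
  have s_upd: "s (\<alpha>(a := k)) = s \<alpha>" for k
    using a by (auto simp: s_def)
  show "Psi (app (mul a) (single \<alpha> 1)) = x a * Psi (single \<alpha> 1)"
  proof (cases "s \<alpha>")
    case False
    then show ?thesis by (simp add: app_mul_single Psi s_upd clinear_0[OF clinear_Psi])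
  next
    case True
    let ?f = "\<lambda>v. if key v < key a \<and> odv a \<and> odv v then (- 1) ^ \<alpha> v else (1 :: complex)"
    have "prod_list (map ?f all_vars) = prod ?f (rows \<times> cols)"
      using prod.distinct_set_conv_list[OF all_vars_distinct, of ?f] all_vars(1) by simp
    also have "\<dots> = koszul_sign a \<alpha>"
    proof (cases "odv a")
      case odd: True
      have "koszul_sign a \<alpha> = prod ?f {v. key v < key a \<and> odv v}"
        unfolding koszul_sign_def using odd by (auto intro!: prod.cong)
      also have "\<dots> = prod ?f ({v. key v < key a \<and> odv v} \<inter> (rows \<times> cols))"
      proof (rule prod.mono_neutral_right)
        show "\<forall>v\<in>{v. key v < key a \<and> odv v} - {v. key v < key a \<and> odv v} \<inter> (rows \<times> cols). ?f v = 1"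
        proof
          fix v assume "v \<in> {v. key v < key a \<and> odv v} - {v. key v < key a \<and> odv v} \<inter> (rows \<times> cols)"
          then have "\<alpha> v = 0" using True unfolding s_def by blast
          then show "?f v = 1" by simp
        qed
      qed (auto intro: finite_below)
      also have "\<dots> = prod ?f (rows \<times> cols)"
        by (rule prod.mono_neutral_left) auto
      finally show ?thesis ..
    qed (simp add: koszul_sign_def)
    finally have t: "x a * monom_prod all_vars \<alpha> = koszul_sign a \<alpha> *\<^sub>C monom_prod all_vars (\<alpha>(a := Suc (\<alpha> a)))"
      using x_monom_prod[OF all_vars(2), of a \<alpha>] all_vars(1) a by simp
    show ?thesis
    proof (cases "odv a \<and> odd (\<alpha> a)")
      case False
      then show ?thesis using True by (auto simp: app_mul_single Psi s_upd t)
    next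
      \<comment> \<open>Both sides are zero: \<open>mul a\<close> annihilates the monomial by its
        definition, and the product on the right contains the square of an odd variable.\<close>
      case odd: True
      then obtain k where k: "\<alpha> a = Suc k" by (metis even_zero not0_implies_Suc)
      have "x a ^ Suc (Suc k) = (x a * x a) * x a ^ k" by (simp add: mult.assoc)
      then have "x a ^ Suc (\<alpha> a) = 0" using x_sq[OF a] odd k by simp
      then have "0 \<in> set (map (\<lambda>v. x v ^ (\<alpha>(a := Suc (\<alpha> a))) v) all_vars)"
        using all_vars(1) a by (auto simp: image_iff intro!: bexI[of _ a])
      then have "monom_prod all_vars (\<alpha>(a := Suc (\<alpha> a))) = 0"
        unfolding monom_prod_def by (rule prod_list_0)
      then show ?thesis using odd True t by (simp add: app_mul_single Psi clinear_0[OF clinear_Psi])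
    qed
  qed
qed

lemma Psi_vac: "Psi vac = 1"
proof -
  have "monom_prod us (\<lambda>_. 0) = 1" for us by (induction us) (simp_all add: monom_prod_def)
  then show ?thesis by (simp add: Psi_def vac_def)
qed

text \<open>Together with \<open>Psi_gram\<close> this left inverse carries membership in
  \<open>gram_span\<close> over to the generated subalgebra.\<close>

lemma Psi_Phi: "Psi (Phi s) = s"
proof (rule symalg_word_induct[where F = "\<lambda>s. Psi (Phi s)" and H = "\<lambda>s. s"])
  show "clinear (\<lambda>s. Psi (Phi s))" by (rule clinear_comp[OF clinear_Psi clinear_Phi])
  show "clinear (\<lambda>s :: ('v sdual, 'w) stensor symalg. s)" by (rule clinearI) simp_all
  have Zu: "Psi (app (Zu u) f) = sym_gen u * Psi f" for u f
  proof -
    have "sym_gen u = sym_gen (\<Sum>a\<in>rows \<times> cols. coord a u *\<^sub>C xb a)" by (simp add: coord_expand)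
    then have "sym_gen u * Psi f = (\<Sum>a\<in>rows \<times> cols. coord a u *\<^sub>C (x a * Psi f))"
      by (simp add: clinear_sum[OF clinear_sym_gen] sym_gen_scale sum_distrib_right sym_cscale_mult)
    also have "\<dots> = Psi (app (Zu u) f)"
      unfolding Zu_def app_sum app_simps clinear_sum[OF clinear_Psi] clinear_scale[OF clinear_Psi]
      by (rule sum.cong) (simp_all add: Psi_mul)
    finally show ?thesis ..
  qed
  show "Psi (Phi (sym_word us)) = sym_word us" for us
    by (induction us) (simp_all add: sym_word_Nil sym_word_Cons Phi_1 Psi_vac Phi_gen_mult Zu)
qed

lemma Psi_gram:
  assumes "s \<in> cols" "t \<in> cols"
  shows "Psi (app (gram n s t) f) = inner_product n e' w s t * Psi f"
proof -
  have x: "xstar e' w i s = x (i, s)" for i s by (simp add: xstar_def xb_def)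
  have neg: "Psi (- f) = - Psi f" for f using clinear_diff[OF clinear_Psi, of 0 f] clinear_0[OF clinear_Psi] by simp
  have p: "(- 1) ^ idx_parity s *\<^sub>C y = signed (oi s) y" for y :: "('v sdual, 'w) stensor symalg" by (simp add: signed_def uminus_power_if)
  show ?thesis
    unfolding gram_def inner_product_def app_sum clinear_sum[OF clinear_Psi] sum_distrib_right x p
    by (rule sum.cong) (use assms in \<open>auto simp: app_signed signed_def clinear_add[OF clinear_Psi] neg Psi_mul distrib_right left_diff_distrib mult.assoc\<close>)
qed

lemma invariants_generated:
  "subalgebra hull {inner_product n e' w s t | s t. s \<in> cols \<and> t \<in> cols} = invariants (pe n e')"
    (is "subalgebra hull ?I = _")
proof
  have "?I \<subseteq> invariants (pe n e')"
    using w by (auto simp: invariants_def homogeneous_basis_def intro!: inner_product_invariant[OF _ _ e e'])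
  moreover have "subalgebra (invariants (pe n e') :: ('v sdual, 'w) stensor symalg set)"
    by (rule subalgebra_invariants) (rule pe_graded[OF e e'])
  ultimately show "subalgebra hull ?I \<subseteq> invariants (pe n e')" by (rule hull_minimal)
next
  define H where "H = subalgebra hull ?I"
  have "subalgebra H" unfolding H_def by (rule subalgebra_hull)
  then have H: "cvec.subspace H" "1 \<in> H" "\<And>a b. a \<in> H \<Longrightarrow> b \<in> H \<Longrightarrow> a * b \<in> H"
    unfolding subalgebra_def by auto
  show "invariants (pe n e') \<subseteq> subalgebra hull ?I"
  proof
    fix a :: "('v sdual, 'w) stensor symalg"
    assume "a \<in> invariants (pe n e')"
    then have "Phi a \<in> gram_span n cols"
      using supported_Phi[of a] Phi_pinv by (intro fock_invariants) (auto simp: supported_def)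
    \<comment> \<open>Induction over the construction of \<open>Phi a\<close> in
      \<open>gram_span\<close>: \<open>Psi\<close> turns each \<open>gram\<close> into
      multiplication by a generator of H.\<close>
    then have "Psi (Phi a) \<in> H"
    proof induction
      case (gram_span_gram f s t)
      then have "inner_product n e' w s t \<in> H" unfolding H_def by (intro hull_inc) blast
      then show ?case using H(3) gram_span_gram by (simp add: Psi_gram)
    qed (simp_all add: H Psi_vac clinear_add[OF clinear_Psi] clinear_scale[OF clinear_Psi]
        cvec.subspace_add cvec.subspace_scale)
    then show "a \<in> subalgebra hull ?I" by (simp add: Psi_Phi H_def)
  qed
qed

end

theorem corollary1p4p1p1:
  fixes n p q :: nat
    and e :: "idx \<Rightarrow> 'v::superspace" and e' :: "idx \<Rightarrow> 'v sdual"
    and w :: "idx \<Rightarrow> 'w::superspace"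
  assumes "homogeneous_basis (idx_set n n) e"
    and "dual_basis (idx_set n n) e e'"
    and "homogeneous_basis (idx_set p q) w"
  shows "subalgebra hull {inner_product n e' w s t | s t. s \<in> idx_set p q \<and> t \<in> idx_set p q}
    = invariants (pe n e')"
  by (rule bases.invariants_generated) (unfold_locales; fact assms)

end
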